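(* Let $F$ be a totally real number field of degree $n$, with unit group $U_F$, and let $\psi:(\mathbf R^\times)^n\to\{\pm1\}$ be a continuous character. Let $\phi:F\to\mathbf C$ be a function for which there are fractional ideals $\mathfrak a,\mathfrak b$ of $F$ such that $\phi$ is constant modulo $\mathfrak a$ and vanishes outside $\mathfrak b$, and such that $\phi(v\alpha)=\psi(v)\phi(\alpha)$ for all $\alpha\in F$, $v\in U_F$. Let $\Lambda\subset\mathbf C$ be the $\mathbf Z$-module generated by the values $\phi(\alpha)$, $\alpha\in F$. Let $V$ be a free subgroup of finite index of $U_F$ such that $v_n>0$ for all $v\in V$. Let $\mathcal B=\sum_B n_B B$ be a finite formal $\mathbf Z$-linear combination of $\mathbf Q$-bases $B=(f_{B,1},\dots,f_{B,n})$ of $F$ such that, for almost every $y\in(\mathbf R^\times)^n$ and every $x\in(\mathbf R^\times)^n$, $$\sum_{v\in V}\sum_B n_B\,\chi_{vB}(x,y)=\chi_{(e_1,\dots,e_n)}(x,y).$$ (i) There exists $F(\phi,\mathcal B,y)\in\Lambda\big[q^\alpha,\tfrac1{1-q^\alpha},\ \alpha\in F^\times\big]$ such that, for every $y\in\mathbf R^n$ with $\mathrm{Tr}(f_{B,i}\,y)\neq0$ for all $i$ and all $B$ with $n_B\ne 0$, $$\sum_{\alpha\in F}\phi(\alpha)\sum_B n_B\,\chi_B(\alpha,y)\,q^\alpha=F(\phi,\mathcal B,y).$$ (ii) Set $F^*(\phi,\mathcal B,y)=F(\phi,\mathcal B,y)-\phi(0)\sum_Bn_B\chi_B(0,y)$.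 Then, for almost every $y\in(\mathbf R^\times)^n$, $$\sum_{v\in V}\psi(v)\,\mathrm N(v)\,F^*(\phi,\mathcal B,vy)=\epsilon(\mathrm N(y))\sum_{\substack{\beta\in F^\times\\ \beta^{-1}y\in(\mathbf R_{>0})^n}}\phi(\beta)\,e^{-\mathrm{Tr}(\beta y)}.$$
   Context: Fix an ordering $\tau_1,\dots,\tau_n$ of the embeddings $F\to\mathbf R$ and view $F\subset\mathbf R^n\cong \mathbf R\otimes F$ via $\alpha\mapsto(\tau_1(\alpha),\dots,\tau_n(\alpha))$; $v_n$ denotes the $n$-th coordinate of $v$. $\mathbf R^n$ carries the coordinatewise product and canonical basis $e_1,\dots,e_n$; $\mathrm{Tr}(x)=\sum_i x_i$, $\mathrm N(x)=\prod_i x_i$; $\epsilon(t)\in\{\pm1\}$ is the sign of $t\in\mathbf R^\times$. The character $\psi$ is evaluated on $F^\times$ through the embedding. "Almost every" refers to Lebesgue measure. $q^\alpha$ denotes the function $y\mapsto e^{-\mathrm{Tr}(\alpha y)}$. $\Lambda[q^\alpha,\frac1{1-q^\alpha},\ \alpha\in F^\times]$ is the set of finite $\Lambda$-linear combinations of monomials in the functions $q^\alpha$ and $\frac{1}{1-q^\alpha}$, $\alpha\in F^\times$. For a basis $B=(f_1,\dots,f_n)$ of $\mathbf R^n$ and $y\in\mathbf R^n$ with $\mathrm{Tr}(f_iy)\ne0$ for all $i$, put $\epsilon(B,y)=\epsilon(\det B)\prod_i\epsilon(\mathrm{Tr}(f_iy))$, let $C_B^0(y)$ be the open cone $\{\sum_i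 t_i\,\epsilon(\mathrm{Tr}(f_iy))f_i:\ t_i>0\}$, $\chi^0_B(x,y)=\epsilon(B,y)\mathbf 1_{C^0_B(y)}(x)$, and $\chi_B(x,y)=\lim_{t\to0^+}\chi_B^0(x+te_n,y)$. For $v\in(\mathbf R^\times)^n$, $vB=(vf_1,\dots,vf_n)$. *)

theory Defs
  imports "HOL-Analysis.Analysis" "HOL-Algebra.Ring" "HOL-Algebra.Free_Abelian_Groups"
begin

section \<open>Totally real number fields\<close>

global_interpretation rat_vs: vector_space "\<lambda>(q::rat) (x::'f::field_char_0). of_rat q * x"
  by unfold_locales (simp_all add: algebra_simps of_rat_add of_rat_mult)

global_interpretation int_mod: Modules.module "\<lambda>(k::int) (z::complex). of_int k * z"
  by unfold_locales (simp_all add: algebra_simps)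

definition number_field :: "'f::field_char_0 itself \<Rightarrow> bool" where
  "number_field _ \<longleftrightarrow> (\<exists>S::'f set. finite S \<and> rat_vs.span S = UNIV)"

definition field_degree :: "'f::field_char_0 itself \<Rightarrow> nat" where
  "field_degree _ = rat_vs.dim (UNIV::'f set)"

definition field_embedding :: "('a::field \<Rightarrow> 'b::field) \<Rightarrow> bool" where
  "field_embedding \<sigma> \<longleftrightarrow> \<sigma> 1 = 1 \<and> (\<forall>x y. \<sigma> (x + y) = \<sigma> x + \<sigma> y) \<and> (\<forall>x y. \<sigma> (x * y) = \<sigma> x * \<sigma> y)"

definition totally_real :: "'f::field_char_0 itself \<Rightarrow> bool" where
  "totally_real _ \<longleftrightarrow> (\<forall>\<sigma> :: 'f \<Rightarrow> complex. field_embedding \<sigma> \<longrightarrow> range \<sigma> \<subseteq> \<real>)"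

definition integer_ring :: "'f::field_char_0 ring" where
  "integer_ring = \<lparr>carrier = {x. algebraic_int x}, mult = (*), one = 1, ring.zero = 0, add = (+)\<rparr>"

definition unit_group :: "'f::field_char_0 monoid" where
  "unit_group = units_of integer_ring"

definition fractional_ideal :: "'f::field_char_0 set \<Rightarrow> bool" where
  "fractional_ideal I \<longleftrightarrow>
     I \<noteq> {0} \<and> 0 \<in> I \<and> (\<forall>x\<in>I. \<forall>y\<in>I. x + y \<in> I) \<and>
     (\<forall>r\<in>carrier integer_ring. \<forall>x\<in>I. r * x \<in> I) \<and>
     (\<exists>d\<in>carrier integer_ring. d \<noteq> 0 \<and> (\<forall>x\<in>I. d * x \<in> carrier integer_ring))"

definition rat_basis :: "('n \<Rightarrow> 'f::field_char_0) \<Rightarrow> bool" where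
  "rat_basis B \<longleftrightarrow> inj B \<and> rat_vs.independent (range B) \<and> rat_vs.span (range B) = UNIV"

text \<open>A basis of a free abelian group is a subset of its carrier, so it is enough to let \<open>S\<close> range
  over sets of elements of the same type.\<close>

definition free_abelian :: "'a monoid \<Rightarrow> bool" where
  "free_abelian G \<longleftrightarrow> (\<exists>S::'a set. G \<cong> free_Abelian_group S)"


section \<open>The space $\mathbf{R}^n$\<close>

text \<open>The product \<open>x * y\<close> of vectors in the library is the coordinatewise one.  The index type
  is linearly ordered, and the $n$-th coordinate is the one at its greatest element.\<close>

definition nth_index :: "'n::{finite,linorder}" where
  "nth_index = Max UNIV"

definition emb :: "('n::finite \<Rightarrow> 'f \<Rightarrow> real) \<Rightarrow> 'f \<Rightarrow> real ^ 'n" where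
  "emb \<tau> \<alpha> = (\<chi> i. \<tau> i \<alpha>)"

definition Tr :: "real ^ 'n \<Rightarrow> real" where
  "Tr x = (\<Sum>i\<in>UNIV. x $ i)"

definition Nm :: "real ^ 'n \<Rightarrow> real" where
  "Nm x = (\<Prod>i\<in>UNIV. x $ i)"

definition unit_vecs :: "(real ^ 'n) set" where
  "unit_vecs = {x. \<forall>i. x $ i \<noteq> 0}"

definition pos_vecs :: "(real ^ 'n) set" where
  "pos_vecs = {x. \<forall>i. x $ i > 0}"

definition sign_character :: "(real ^ 'n \<Rightarrow> complex) \<Rightarrow> bool" where
  "sign_character \<psi> \<longleftrightarrow>
     \<psi> ` unit_vecs \<subseteq> {1, -1} \<and> continuous_on unit_vecs \<psi> \<and>
     (\<forall>x\<in>unit_vecs. \<forall>y\<in>unit_vecs. \<psi> (x * y) = \<psi> x * \<psi> y)"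


section \<open>Signed cones\<close>

definition basis_sign :: "('n::finite \<Rightarrow> real ^ 'n) \<Rightarrow> real ^ 'n \<Rightarrow> real" where
  "basis_sign B y = sgn (det (\<chi> i. B i)) * (\<Prod>i\<in>UNIV. sgn (Tr (B i * y)))"

definition cone0 :: "('n::finite \<Rightarrow> real ^ 'n) \<Rightarrow> real ^ 'n \<Rightarrow> (real ^ 'n) set" where
  "cone0 B y = {(\<Sum>i\<in>UNIV. (t i * sgn (Tr (B i * y))) *\<^sub>R B i) | t. \<forall>i. t i > 0}"

definition chi0 :: "('n::finite \<Rightarrow> real ^ 'n) \<Rightarrow> real ^ 'n \<Rightarrow> real ^ 'n \<Rightarrow> real" where
  "chi0 B x y = basis_sign B y * indicator (cone0 B y) x"

definition chi :: "('n::{finite,linorder} \<Rightarrow> (real, 'n) vec) \<Rightarrow> (real, 'n) vec \<Rightarrow> (real, 'n) vec \<Rightarrow> real" where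
  "chi B x y = Lim (at_right 0) (\<lambda>t. chi0 B (x + t *\<^sub>R axis nth_index 1) y)"

text \<open>For \<open>\<B> = \<Sum>\<^sub>B n\<^sub>B B\<close> this is \<open>\<Sum>\<^sub>B n\<^sub>B \<chi>\<^bsub>vB\<^esub>(x, y)\<close>.\<close>

definition chi_comb :: "('n::{finite,linorder} \<Rightarrow> 'f \<Rightarrow> real) \<Rightarrow> (('n \<Rightarrow> 'f) \<Rightarrow>\<^sub>0 int) \<Rightarrow>
    (real, 'n) vec \<Rightarrow> (real, 'n) vec \<Rightarrow> (real, 'n) vec \<Rightarrow> real" where
  "chi_comb \<tau> \<B> v x y =
     (\<Sum>B\<in>Poly_Mapping.keys \<B>.
        of_int (Poly_Mapping.lookup \<B> B) * chi (\<lambda>i. v * emb \<tau> (B i)) x y)"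

definition regular_points :: "('n::finite \<Rightarrow> 'f \<Rightarrow> real) \<Rightarrow> (('n \<Rightarrow> 'f) \<Rightarrow>\<^sub>0 int) \<Rightarrow> (real ^ 'n) set" where
  "regular_points \<tau> \<B> = {y. \<forall>B\<in>Poly_Mapping.keys \<B>. \<forall>i. Tr (emb \<tau> (B i) * y) \<noteq> 0}"


section \<open>Combinations of the functions $q^\alpha$ and $1/(1-q^\alpha)$\<close>

definition qpow :: "('n::finite \<Rightarrow> 'f \<Rightarrow> real) \<Rightarrow> 'f \<Rightarrow> real ^ 'n \<Rightarrow> complex" where
  "qpow \<tau> \<alpha> y = of_real (exp (- Tr (emb \<tau> \<alpha> * y)))"

text \<open>Since division by zero is total here, a monomial is only allowed those factors
  \<open>1 / (1 - q\<^sup>\<alpha>)\<close> which have no pole on the given set \<open>Y\<close> of arguments \<open>y\<close>; with \<open>Y = {}\<close>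
  there is no restriction.\<close>

inductive_set q_monomials ::
    "('n::finite \<Rightarrow> 'f::field_char_0 \<Rightarrow> real) \<Rightarrow> (real ^ 'n) set \<Rightarrow> (real ^ 'n \<Rightarrow> complex) set"
  for \<tau> :: "'n::finite \<Rightarrow> 'f::field_char_0 \<Rightarrow> real" and Y :: "(real ^ 'n) set" where
  one: "(\<lambda>y. 1) \<in> q_monomials \<tau> Y"
| pow: "m \<in> q_monomials \<tau> Y \<Longrightarrow> \<alpha> \<noteq> 0 \<Longrightarrow> (\<lambda>y. m y * qpow \<tau> \<alpha> y) \<in> q_monomials \<tau> Y"
| inv: "m \<in> q_monomials \<tau> Y \<Longrightarrow> \<alpha> \<noteq> 0 \<Longrightarrow> (\<forall>y\<in>Y. qpow \<tau> \<alpha> y \<noteq> 1) \<Longrightarrow>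
        (\<lambda>y. m y * (1 / (1 - qpow \<tau> \<alpha> y))) \<in> q_monomials \<tau> Y"

definition q_combinations :: "complex set \<Rightarrow> ('n::finite \<Rightarrow> 'f::field_char_0 \<Rightarrow> real) \<Rightarrow>
    (real ^ 'n) set \<Rightarrow> (real ^ 'n \<Rightarrow> complex) set" where
  "q_combinations \<Lambda> \<tau> Y =
     {(\<lambda>y. \<Sum>m\<in>S. c m * m y) | S c. finite S \<and> S \<subseteq> q_monomials \<tau> Y \<and> c ` S \<subseteq> \<Lambda>}"

end

theory Submission
  imports Defs
begin

text \<open>
  Part (i): coordinates with respect to a rational basis \<open>f\<close> turn \<open>F\<close> into \<open>\<rat>\<^sup>n\<close>. Modulo a multiple
  \<open>N\<close> of the basis that lies in \<open>\<aa>\<close>, the support of \<open>\<phi>\<close> has finitely many classes, and the sum over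
  a cone splits into a product of geometric series. Since
  \<open>\<Sum>\<^bsub>m \<ge> 0\<^esub> z\<^sup>m\<close> and \<open>- \<Sum>\<^bsub>m < 0\<^esub> z\<^sup>m\<close> are the same rational function of \<open>z\<close>, the signs in
  \<open>\<epsilon>(B, y)\<close> make the sum independent of the chamber of \<open>y\<close>.

  Part (ii): \<open>\<chi>\<close> satisfies \<open>\<chi>\<^bsub>vB\<^esub>(v\<alpha>, y) = N(v) \<chi>\<^bsub>B\<^esub>(\<alpha>, vy)\<close>, so the left-hand side is a double series
  over \<open>v\<close> and \<open>\<beta> = v\<alpha>\<close> whose sum over \<open>v\<close> is given by the hypothesis on \<open>\<B>\<close>. The interchange needs
  absolute convergence. The number of units with \<open>\<Sum>\<^sub>i \<bar>ln \<bar>v\<^sub>i\<bar>\<bar> \<le> r\<close> grows only polynomially in \<open>r\<close>,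
  while the largest \<open>\<bar>v\<^sub>i\<bar>\<close> is exponentially large. Hence the slabs where \<open>Tr(f\<^sub>i v y)\<close> is
  smaller than a fixed fractional power of \<open>max \<bar>v\<^sub>i\<bar>\<close> have summable measure, and for almost every \<open>y\<close>
  all the numbers \<open>\<bar>Tr(f\<^sub>i v y)\<bar>\<close> are bounded below by such a power, up to a constant.
\<close>

section \<open>Rational coordinates and real embeddings\<close>

text \<open>The limit along \<open>e_n\<close> in \<open>chi\<close> decides which facets belong to
  a cone. For a basis of the field this is unambiguous because no coordinate of \<open>e_n\<close>
  vanishes, and it is compatible with \<open>V\<close> because multiplication by \<open>v\<close>
  sends \<open>e_n\<close> to a positive multiple of itself. The term at 0 has to be split off
  before the order of summation is changed: its exponential factor is 1 for every \<open>v\<close>,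
  so nothing forces decay, and the hypothesis on the cones speaks only of points with nonzero
  coordinates. Every nonzero field element is such a point. Write \<open>l(v)\<close> for the sum of
  the \<open>|ln |v_i||\<close>. Since \<open>|N(v)| = 1\<close>, the positive logarithms add up to
  \<open>l(v)/2\<close>, so some \<open>|v_i|\<close> is at least \<open>exp (l(v)/(2n))\<close>.
  The threshold for the linear forms is the square root of this, \<open>exp (l(v)/(4n))\<close>: in
  a fixed cube the slabs then have measure at most of order \<open>exp (- l(v)/(4n))\<close>, which
  is summable, and off the slabs the terms still decay in \<open>v\<close>.\<close>

definition lincomb :: "('n::finite \<Rightarrow> 'f::field_char_0) \<Rightarrow> ('n \<Rightarrow> rat) \<Rightarrow> 'f" where
  "lincomb f s = (\<Sum>i\<in>UNIV. of_rat (s i) * f i)"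

definition coord :: "('n::finite \<Rightarrow> 'f::field_char_0) \<Rightarrow> 'f \<Rightarrow> 'n \<Rightarrow> rat" where
  "coord f \<alpha> = inv_into UNIV (lincomb f) \<alpha>"

lemma lincomb_add: "lincomb f (\<lambda>i. s i + t i) = lincomb f s + lincomb f t"
  by (simp add: lincomb_def of_rat_add distrib_right sum.distrib)

lemma lincomb_diff: "lincomb f (\<lambda>i. s i - t i) = lincomb f s - lincomb f t"
  by (simp add: lincomb_def of_rat_diff left_diff_distrib sum_subtractf)

lemma lincomb_cmult: "lincomb f (\<lambda>i. c * s i) = of_rat c * lincomb f s"
  by (simp add: lincomb_def of_rat_mult sum_distrib_left mult.assoc del: rat_vs.scale_scale)

lemma lincomb_sum: "lincomb f (\<lambda>i. \<Sum>k\<in>A. s k i) = (\<Sum>k\<in>A. lincomb f (s k))"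
  unfolding lincomb_def of_rat_sum sum_distrib_right by (rule sum.swap)

lemma lincomb_0 [simp]: "lincomb f (\<lambda>i. 0) = 0"
  by (simp add: lincomb_def)

lemma lincomb_delta: "lincomb f (\<lambda>j. if j = i then 1 else 0) = f i"
proof -
  have "lincomb f (\<lambda>j. if j = i then 1 else 0) = (\<Sum>j\<in>UNIV. if j = i then f j else 0)"
    unfolding lincomb_def by (rule sum.cong) auto
  then show ?thesis by simp
qed

lemma bij_lincomb:
  assumes "rat_basis f"
  shows "bij (lincomb f)"
proof -
  have inj: "inj f" and ind: "rat_vs.independent (range f)" and span: "rat_vs.span (range f) = UNIV"
    using assms by (auto simp: rat_basis_def)
  have reidx: "(\<Sum>v\<in>range f. of_rat (u v) * v) = lincomb f (\<lambda>i. u (f i))" for u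
    using inj by (simp add: lincomb_def sum.reindex)
  have "surj (lincomb f)"
  proof (intro surjI)
    fix x
    have "x \<in> rat_vs.span (range f)" using span by simp
    then obtain u where "x = (\<Sum>v\<in>range f. of_rat (u v) * v)"
      by (auto simp: rat_vs.span_finite)
    then show "lincomb f (SOME s. lincomb f s = x) = x"
      using reidx by (metis (mono_tags, lifting) someI)
  qed
  moreover have "inj (lincomb f)"
  proof (rule injI)
    fix s t assume "lincomb f s = lincomb f t"
    then have 0: "lincomb f (\<lambda>i. s i - t i) = 0" by (simp add: lincomb_diff)
    define u where "u v = s (inv_into UNIV f v) - t (inv_into UNIV f v)" for v
    have "(\<Sum>v\<in>range f. of_rat (u v) * v) = 0"
      using 0 inj by (simp add: reidx u_def)
    then have "u (f i) = 0" for i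
      using rat_vs.independentD[OF ind, of "range f" u "f i"] by simp
    then show "s = t" using inj by (auto simp: u_def)
  qed
  ultimately show ?thesis by (rule bijI[rotated])
qed

lemma lincomb_coord: "rat_basis f \<Longrightarrow> lincomb f (coord f \<alpha>) = \<alpha>"
  using bij_is_surj[OF bij_lincomb, of f] by (simp add: coord_def f_inv_into_f)

lemma coord_lincomb: "rat_basis f \<Longrightarrow> coord f (lincomb f s) = s"
  unfolding coord_def by (simp add: bij_is_inj bij_lincomb)

lemma coord_eqI: "rat_basis f \<Longrightarrow> lincomb f s = \<alpha> \<Longrightarrow> coord f \<alpha> = s"
  using coord_lincomb by blast

lemma coord_add: "rat_basis f \<Longrightarrow> coord f (x + y) i = coord f x i + coord f y i"
  by (subst coord_eqI[of f "\<lambda>i. coord f x i + coord f y i"]) (simp_all add: lincomb_add lincomb_coord)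

lemma coord_cmult: "rat_basis f \<Longrightarrow> coord f (of_rat c * x) i = c * coord f x i"
  by (subst coord_eqI[of f "\<lambda>i. c * coord f x i"]) (simp_all add: lincomb_cmult lincomb_coord)

lemma coord_zero: "rat_basis f \<Longrightarrow> coord f 0 i = 0"
  by (subst coord_eqI[of f "\<lambda>i. 0"]) simp_all

lemma coord_sum: "rat_basis f \<Longrightarrow> coord f (\<Sum>k\<in>A. x k) i = (\<Sum>k\<in>A. coord f (x k) i)"
  by (subst coord_eqI[of f "\<lambda>i. \<Sum>k\<in>A. coord f (x k) i"]) (simp_all add: lincomb_sum lincomb_coord)

lemma coord_basis: "rat_basis f \<Longrightarrow> coord f (f i) j = (if j = i then 1 else 0)"
  by (subst coord_eqI[OF _ lincomb_delta]) auto

lemma lincomb_eq_0_iff: "rat_basis f \<Longrightarrow> lincomb f s = 0 \<longleftrightarrow> (\<forall>i. s i = 0)"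
  by (metis coord_lincomb coord_zero ext lincomb_0)

text \<open>Row \<open>i\<close> holds the coordinates of \<open>\<alpha> * f i\<close>, so the
  matrix acts from the left on the matrix with rows \<open>emb \<tau> (f i)\<close>. The rational
  entries are typed as reals because the matrix is to be conjugated to a real diagonal one.\<close>

definition mult_matrix :: "('n::finite \<Rightarrow> 'f::field_char_0) \<Rightarrow> 'f \<Rightarrow> real ^ 'n ^ 'n" where
  "mult_matrix f \<alpha> = (\<chi> i j. of_rat (coord f (\<alpha> * f i) j))"

text \<open>As many real embeddings as the degree: this is the form in which total reality enters,
  and it makes the matrix of the embeddings of a basis square.\<close>

locale real_embeddings =
  fixes \<tau> :: "'n::{finite,linorder} \<Rightarrow> 'f::field_char_0 \<Rightarrow> real"
  assumes number_field: "number_field TYPE('f)"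
    and field_degree: "field_degree TYPE('f) = CARD('n)"
    and bij_embeddings: "bij_betw \<tau> UNIV {\<sigma>. field_embedding \<sigma>}"
begin

lemma embedding: "field_embedding (\<tau> i)"
  using bij_embeddings by (auto simp: bij_betw_def)

lemma inj_embeddings: "inj \<tau>"
  using bij_embeddings by (auto simp: bij_betw_def)

lemma tau_1 [simp]: "\<tau> i 1 = 1" and tau_add: "\<tau> i (x + y) = \<tau> i x + \<tau> i y"
  and tau_mult: "\<tau> i (x * y) = \<tau> i x * \<tau> i y"
  using embedding by (auto simp: field_embedding_def)

lemma tau_0 [simp]: "\<tau> i 0 = 0"
  using tau_add[of i 0 0] by simp

lemma tau_minus: "\<tau> i (- x) = - \<tau> i x"
  using tau_add[of i x "-x"] by simp

lemma tau_diff: "\<tau> i (x - y) = \<tau> i x - \<tau> i y"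
  using tau_add[of i x "-y"] by (simp add: tau_minus)

lemma tau_sum: "\<tau> i (sum g A) = (\<Sum>a\<in>A. \<tau> i (g a))"
  by (induction A rule: infinite_finite_induct) (auto simp: tau_add)

lemma tau_power: "\<tau> i (x ^ k) = \<tau> i x ^ k"
  by (induction k) (auto simp: tau_mult)

lemma tau_inverse_mult: "x \<noteq> 0 \<Longrightarrow> \<tau> i x * \<tau> i (inverse x) = 1"
  by (metis right_inverse tau_1 tau_mult)

lemma tau_eq_0_iff [simp]: "\<tau> i x = 0 \<longleftrightarrow> x = 0"
  by (metis mult_zero_left tau_0 tau_inverse_mult zero_neq_one)

lemma tau_inverse: "\<tau> i (inverse x) = inverse (\<tau> i x)"
  by (cases "x = 0") (auto simp: tau_inverse_mult intro: inverse_unique[symmetric])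

lemma tau_of_nat [simp]: "\<tau> i (of_nat k) = of_nat k"
  by (induction k) (auto simp: tau_add)

lemma tau_of_int [simp]: "\<tau> i (of_int k) = of_int k"
  by (cases k rule: int_diff_cases) (simp add: tau_diff)

lemma tau_of_rat [simp]: "\<tau> i (of_rat q) = of_rat q"
proof (cases q)
  case (Fract a b)
  then show ?thesis
    by (simp add: of_rat_rat divide_inverse tau_mult tau_inverse)
qed

lemma exists_rat_basis: "\<exists>f :: 'n \<Rightarrow> 'f. rat_basis f"
proof -
  obtain S :: "'f set" where S: "finite S" "rat_vs.span S = UNIV"
    using number_field by (auto simp: number_field_def)
  obtain B where B: "B \<subseteq> S" "rat_vs.independent B" "S \<subseteq> rat_vs.span B"
    using rat_vs.maximal_independent_subset[of S] by metis
  have sB: "rat_vs.span B = UNIV"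
    using B(3) S(2) by (metis rat_vs.span_minimal rat_vs.subspace_span top.extremum_uniqueI)
  have "card B = CARD('n)"
    using rat_vs.dim_eq_card[of B UNIV] B(2) sB field_degree
    by (simp add: field_degree_def)
  moreover have "finite B" using B(1) S(1) finite_subset by blast
  ultimately obtain f :: "'n \<Rightarrow> 'f" where "bij_betw f UNIV B"
    using finite_same_card_bij[of "UNIV :: 'n set" B] by auto
  then have "inj f" "range f = B" by (auto simp: bij_betw_def)
  then show ?thesis using B(2) sB by (auto simp: rat_basis_def)
qed

text \<open>Artin's argument: in the relation at \<open>a * x\<close>, minus
  \<open>\<tau> k a\<close> times the relation at \<open>x\<close>, the term of \<open>k\<close>
  cancels. The remaining shorter relation has coefficients
  \<open>c j * (\<tau> j a - \<tau> k a)\<close>, and \<open>a\<close> can be chosen to separate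
  \<open>j\<close> from \<open>k\<close>.\<close>

lemma embeddings_independent:
  assumes "finite S" and "\<And>x. (\<Sum>j\<in>S. c j * \<tau> j x) = 0" and "j \<in> S"
  shows "c j = 0"
  using assms
proof (induction S arbitrary: c j rule: finite_induct)
  case (insert k S)
  have zero: "c j = 0" if j: "j \<in> S" for j
  proof -
    have "\<tau> j \<noteq> \<tau> k" using insert.hyps j inj_embeddings by (metis injD)
    then obtain a where a: "\<tau> j a \<noteq> \<tau> k a" by auto
    have "(\<Sum>j\<in>S. (c j * (\<tau> j a - \<tau> k a)) * \<tau> j x) = 0" for x
    proof -
      have "(\<Sum>j\<in>insert k S. c j * \<tau> j (a * x)) - \<tau> k a * (\<Sum>j\<in>insert k S. c j * \<tau> j x) = 0"
        using insert.prems(1) by simp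
      then show ?thesis using insert.hyps
        by (simp add: tau_mult sum_distrib_left sum_subtractf algebra_simps)
    qed
    from insert.IH[OF this j] a show ?thesis by simp
  qed
  moreover have "c k = 0"
    using insert.prems(1)[of 1] zero insert.hyps by simp
  ultimately show ?case using insert.prems by auto
qed simp

section \<open>The matrix of embeddings, norms and traces\<close>

definition emb_matrix :: "('n \<Rightarrow> 'f) \<Rightarrow> ((real, 'n) vec, 'n) vec" where
  "emb_matrix f = (\<chi> i. emb \<tau> (f i))"

lemma emb_lincomb: "emb \<tau> (lincomb f s) = (\<Sum>i\<in>UNIV. real_of_rat (s i) *\<^sub>R emb \<tau> (f i))"
  by (simp add: vec_eq_iff emb_def lincomb_def tau_sum tau_mult)

lemma emb_mult: "emb \<tau> (x * y) = emb \<tau> x * emb \<tau> y"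
  by (simp add: vec_eq_iff emb_def tau_mult)

lemma emb_0 [simp]: "emb \<tau> 0 = 0" and emb_1 [simp]: "emb \<tau> 1 = 1"
  by (simp_all add: vec_eq_iff emb_def)

lemma emb_unit_vecs: "x \<noteq> 0 \<Longrightarrow> emb \<tau> x \<in> unit_vecs"
  by (simp add: emb_def unit_vecs_def)

text \<open>A vector in the kernel is a linear relation between the embeddings on a basis, hence on
  the whole field, and embeddings are independent.\<close>

lemma det_emb_matrix:
  fixes f :: "'n \<Rightarrow> 'f"
  assumes "rat_basis f"
  shows "det (emb_matrix f) \<noteq> 0"
proof -
  have "c = 0" if "emb_matrix f *v c = 0" for c
  proof -
    have 0: "(\<Sum>j\<in>UNIV. \<tau> j (f i) * c $ j) = 0" for i
      using that by (simp add: vec_eq_iff matrix_vector_mult_def emb_matrix_def emb_def)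
    have "(\<Sum>j\<in>UNIV. c $ j * \<tau> j x) = 0" for x
    proof -
      have "(\<Sum>j\<in>UNIV. c $ j * \<tau> j x) = (\<Sum>j\<in>UNIV. c $ j * \<tau> j (lincomb f (coord f x)))"
        using assms by (simp add: lincomb_coord)
      also have "\<dots> = (\<Sum>i\<in>UNIV. of_rat (coord f x i) * (\<Sum>j\<in>UNIV. \<tau> j (f i) * c $ j))"
        unfolding lincomb_def tau_sum tau_mult sum_distrib_left
        by (subst sum.swap) (simp add: mult_ac)
      finally show ?thesis using 0 by simp
    qed
    then have "c $ j = 0" for j
      by (rule embeddings_independent[OF finite_class.finite_UNIV _ UNIV_I])
    then show "c = 0"
      by (simp add: vec_eq_iff)
  qed
  then show ?thesis
    by (metis invertible_det_nz invertible_left_inverse matrix_left_invertible_ker)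
qed

text \<open>The \<open>j\<close>-th column of \<open>emb_matrix f\<close> is an eigenvector of the
  multiplication matrix with eigenvalue \<open>\<tau> j \<alpha>\<close>.\<close>

lemma mult_matrix_conj:
  fixes f :: "'n \<Rightarrow> 'f"
  assumes "rat_basis f"
  shows "mult_matrix f \<alpha> ** emb_matrix f = emb_matrix f ** (\<chi> i j. if i = j then \<tau> i \<alpha> else 0)"
proof -
  have "(\<Sum>k\<in>UNIV. of_rat (coord f (\<alpha> * f i) k) * \<tau> j (f k)) = \<tau> j (f i) * \<tau> j \<alpha>" for i j
  proof -
    have "(\<Sum>k\<in>UNIV. of_rat (coord f (\<alpha> * f i) k) * \<tau> j (f k)) = \<tau> j (lincomb f (coord f (\<alpha> * f i)))"
      by (simp add: lincomb_def tau_sum tau_mult)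
    then show ?thesis using assms by (simp add: lincomb_coord tau_mult)
  qed
  then show ?thesis
    by (simp add: vec_eq_iff matrix_matrix_mult_def mult_matrix_def emb_matrix_def emb_def if_distrib cong: if_cong)
qed

text \<open>Similarity to the diagonal matrix exhibits the norm as a determinant with rational
  entries; rationality and integrality of norms are read off from this.\<close>

lemma Nm_eq_det:
  fixes f :: "'n \<Rightarrow> 'f"
  assumes "rat_basis f"
  shows "Nm (emb \<tau> \<alpha>) = det (mult_matrix f \<alpha>)"
proof -
  have "det (mult_matrix f \<alpha>) * det (emb_matrix f) =
      det (emb_matrix f) * det (\<chi> i j. if i = j then \<tau> i \<alpha> else 0 :: ((real, 'n) vec, 'n) vec)"
    using arg_cong[OF mult_matrix_conj[OF assms, of \<alpha>], of det] by (simp only: det_mul)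
  moreover have "det (\<chi> i j. if i = j then \<tau> i \<alpha> else 0 :: ((real, 'n) vec, 'n) vec) = Nm (emb \<tau> \<alpha>)"
    by (subst det_diagonal) (auto simp: Nm_def emb_def)
  ultimately show ?thesis using det_emb_matrix[OF assms] by simp
qed

lemma Tr_emb_rational: "\<exists>q. Tr (emb \<tau> \<alpha>) = of_rat q"
proof -
  obtain f :: "'n \<Rightarrow> 'f" where f: "rat_basis f" using exists_rat_basis by blast
  define E where "E = emb_matrix f"
  define D where "D = (\<chi> i j. if i = j then \<tau> i \<alpha> else 0 :: ((real, 'n) vec, 'n) vec)"
  obtain E' where E': "E ** E' = mat 1" "E' ** E = mat 1"
    using det_emb_matrix[OF f] by (metis E_def invertible_def invertible_det_nz)
  have "mult_matrix f \<alpha> = E ** D ** E'"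
    using mult_matrix_conj[OF f, of \<alpha>] E'(1) unfolding D_def[symmetric] E_def[symmetric]
    by (metis matrix_mul_assoc matrix_mul_rid)
  then have "trace (mult_matrix f \<alpha>) = trace (E' ** (E ** D))"
    using trace_mul_sym[of "E ** D" E'] by simp
  then have "trace (mult_matrix f \<alpha>) = trace D"
    by (simp add: matrix_mul_assoc E'(2))
  also have "trace D = Tr (emb \<tau> \<alpha>)"
    by (simp add: trace_def D_def Tr_def emb_def)
  finally have "Tr (emb \<tau> \<alpha>) = of_rat (\<Sum>i\<in>UNIV. coord f (\<alpha> * f i) i)"
    by (simp add: trace_def mult_matrix_def of_rat_sum)
  then show ?thesis ..
qed

text \<open>The trace form is non-degenerate over \<open>\<rat>\<close>. The dual basis lies in \<open>F\<close>, which is why no coordinate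
  of \<open>e\<^sub>n\<close> with respect to a basis of \<open>F\<close> vanishes.\<close>

lemma exists_dual_vector:
  fixes f :: "'n \<Rightarrow> 'f"
  assumes "rat_basis f"
  shows "\<exists>\<gamma>. \<forall>j. Tr (emb \<tau> (\<gamma> * f j)) = (if j = i then 1 else 0)"
proof -
  define t where "t x = (THE q. Tr (emb \<tau> x) = of_rat q)" for x
  have t: "Tr (emb \<tau> x) = of_rat (t x)" for x
    unfolding t_def using Tr_emb_rational[of x] by (metis (mono_tags, lifting) of_rat_eq_iff theI)
  \<comment> \<open>The Gram matrix of the trace form is taken over the rationals, so that inverting
    it produces a dual vector in the field and not merely in real space.\<close>
  define G where "G = (\<chi> i j. t (f i * f j) :: ((rat, 'n) vec, 'n) vec)"
  have G: "of_rat ((G *v s) $ j) = Tr (emb \<tau> (lincomb f (\<lambda>i. s $ i) * f j))" for s j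
  proof -
    have "Tr (emb \<tau> (lincomb f (\<lambda>i. s $ i) * f j)) = (\<Sum>k\<in>UNIV. \<Sum>i\<in>UNIV. of_rat (s $ i) * (\<tau> k (f i) * \<tau> k (f j)))"
      by (simp add: Tr_def emb_def lincomb_def tau_mult tau_sum sum_distrib_right mult.assoc)
    also have "\<dots> = (\<Sum>i\<in>UNIV. of_rat (s $ i) * Tr (emb \<tau> (f i * f j)))"
      by (subst sum.swap) (simp add: Tr_def emb_def tau_mult sum_distrib_left)
    also have "\<dots> = of_rat ((G *v s) $ j)"
      by (simp add: t G_def matrix_vector_mult_def of_rat_sum of_rat_mult mult_ac)
    finally show ?thesis by simp
  qed
  have "s = 0" if s: "G *v s = 0" for s
  proof -
    define \<gamma> where "\<gamma> = lincomb f (\<lambda>i. s $ i)"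
    have "Tr (emb \<tau> (\<gamma> * f j)) = 0" for j
      using G[of s j] s by (simp add: \<gamma>_def)
    then have "emb_matrix f *v emb \<tau> \<gamma> = 0"
      by (simp add: vec_eq_iff matrix_vector_mult_def emb_matrix_def Tr_def emb_def tau_mult mult_ac)
    then have "emb \<tau> \<gamma> = 0"
      using det_emb_matrix[OF assms]
      by (metis invertible_det_nz invertible_left_inverse matrix_left_invertible_ker)
    then have "\<gamma> = 0"
      by (simp add: emb_def vec_eq_iff)
    then show "s = 0"
      using assms by (simp add: \<gamma>_def lincomb_eq_0_iff vec_eq_iff)
  qed
  then have "invertible G"
    by (metis invertible_left_inverse matrix_left_invertible_ker)
  then obtain s where "G *v s = axis i 1"
    by (metis invertible_right_inverse matrix_right_invertible_surjective surjD)
  then have "Tr (emb \<tau> (lincomb f (\<lambda>i. s $ i) * f j)) = (if j = i then 1 else 0)" for j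
    using G[of s j] by (auto simp: axis_def)
  then show ?thesis by blast
qed

lemma axis_coordinates:
  fixes f :: "'n \<Rightarrow> 'f"
  assumes "rat_basis f"
  shows "\<exists>c. (\<forall>i. c i \<noteq> 0) \<and> axis k 1 = (\<Sum>i\<in>UNIV. c i *\<^sub>R emb \<tau> (f i))"
proof -
  obtain E' where E': "E' ** emb_matrix f = mat 1"
    using det_emb_matrix[OF assms] by (metis invertible_def invertible_det_nz)
  define c where "c i = E' $ k $ i" for i
  have c: "axis k 1 = (\<Sum>i\<in>UNIV. c i *\<^sub>R emb \<tau> (f i))"
  proof -
    have "(E' ** emb_matrix f) $ k = (\<Sum>i\<in>UNIV. c i *\<^sub>R emb \<tau> (f i))"
      by (simp add: vec_eq_iff matrix_matrix_mult_def c_def emb_matrix_def)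
    then show ?thesis unfolding E' by (simp add: mat_def axis_def vec_eq_iff) metis
  qed
  have "c i \<noteq> 0" for i
  proof -
    obtain \<gamma> where \<gamma>: "\<And>j. Tr (emb \<tau> (\<gamma> * f j)) = (if j = i then 1 else 0)"
      using exists_dual_vector[OF assms] by blast
    have "\<gamma> \<noteq> 0" using \<gamma>[of i] by (auto simp: Tr_def)
    \<comment> \<open>Evaluating this trace directly and through the expansion of the axis gives
      \<open>c i = \<tau> k \<gamma>\<close>, which is nonzero because \<gamma> is a nonzero field
      element.\<close>
    have "\<tau> k \<gamma> = Tr (emb \<tau> \<gamma> * axis k 1)"
      by (simp add: Tr_def emb_def axis_def if_distrib cong: if_cong)
    also have "\<dots> = (\<Sum>k\<in>UNIV. \<Sum>j\<in>UNIV. c j * (\<tau> k \<gamma> * \<tau> k (f j)))"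
      unfolding c by (simp add: Tr_def emb_def sum_distrib_left mult_ac)
    also have "\<dots> = (\<Sum>j\<in>UNIV. c j * Tr (emb \<tau> (\<gamma> * f j)))"
      by (subst sum.swap) (simp add: Tr_def emb_def tau_mult sum_distrib_left)
    also have "\<dots> = c i" by (simp add: \<gamma> if_distrib cong: if_cong)
    finally show ?thesis using \<open>\<gamma> \<noteq> 0\<close> by (metis tau_eq_0_iff)
  qed
  then show ?thesis using c by blast
qed

end

section \<open>Norms and fractional ideals\<close>

lemma common_denominator:
  fixes A :: "rat set"
  assumes "finite A"
  shows "\<exists>E::nat. E > 0 \<and> (\<forall>q\<in>A. of_nat E * q \<in> \<int>)"
  using assms
proof (induction A rule: finite_induct)
  case (insert q A)
  obtain E where E: "E > 0" "\<And>q. q \<in> A \<Longrightarrow> of_nat E * q \<in> \<int>" using insert.IH by blast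
  obtain a b where q: "q = of_int a / of_int b" "b > 0"
    by (metis Fract_of_int_quotient quotient_of_denom_pos quotient_of_div surj_pair)
  have "of_nat (E * nat b) * q = of_int (int E * a)"
    using q by (simp add: field_simps)
  then have "of_nat (E * nat b) * q \<in> \<int>" by (metis Ints_of_int)
  moreover have "of_nat (E * nat b) * r \<in> \<int>" if "r \<in> A" for r
  proof -
    have "of_nat (E * nat b) * r = of_nat (nat b) * (of_nat E * r)" by simp
    then show ?thesis using E(2)[OF that] by (metis Ints_mult Ints_of_nat)
  qed
  ultimately show ?case using E(1) q(2)
    by (intro exI[of _ "E * nat b"]) auto
qed (auto intro: exI[of _ 1])

text \<open>For \<open>q = a / b\<close> in lowest terms, \<open>b ^ m\<close> divides
  \<open>C\<close> for every \<open>m\<close>. The exponent \<open>m = C\<close> already rules out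
  \<open>b \<ge> 2\<close>, since \<open>2 ^ C > C\<close>.\<close>

lemma rational_with_bounded_denominators_is_int:
  fixes q :: real
  assumes "q \<in> \<rat>" and "C > 0" and C: "\<And>m. of_nat C * q ^ m \<in> \<int>"
  shows "q \<in> \<int>"
proof -
  obtain a b where ab: "b > 0" "Rings.coprime a b" and q: "q = of_int a / of_int b"
    using assms(1) by (auto elim: Rats_cases')
  have dvd: "b ^ m dvd int C" for m
  proof -
    obtain z where "of_nat C * q ^ m = of_int z" using C Ints_cases by blast
    then have "real_of_int (int C * a ^ m) = of_int (z * b ^ m)"
      using ab(1) by (simp add: q field_simps)
    then have "b ^ m dvd int C * a ^ m" by (metis dvd_triv_right of_int_eq_iff)
    moreover have "Rings.coprime (b ^ m) (a ^ m)"
      using ab(2) by (simp add: coprime_commute)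
    ultimately show ?thesis using coprime_dvd_mult_left_iff by blast
  qed
  have "b = 1"
  proof (rule ccontr)
    assume "b \<noteq> 1"
    then have "b \<ge> 2" using ab(1) by simp
    then have "(2::int) ^ C \<le> b ^ C" by (intro power_mono) auto
    also have "\<dots> \<le> int C" using dvd[of C] assms(2) by (intro zdvd_imp_le) auto
    finally show False by (metis less_exp of_nat_less_iff of_nat_numeral of_nat_power not_less)
  qed
  then show ?thesis using q by simp
qed

lemma det_Ints:
  fixes A :: "real ^ 'n ^ 'n"
  shows "(\<And>i j. A $ i $ j \<in> \<int>) \<Longrightarrow> det A \<in> \<int>"
  unfolding det_def by (intro Ints_sum Ints_mult Ints_prod Ints_of_int) auto

lemma det_Rats:
  fixes A :: "real ^ 'n ^ 'n"
  shows "(\<And>i j. A $ i $ j \<in> \<rat>) \<Longrightarrow> det A \<in> \<rat>"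
  unfolding det_def by (intro Rats_sum Rats_mult Rats_prod Rats_of_int) auto

text \<open>If \<open>a\<close> is the leading coefficient of an integral polynomial
  \<open>p\<close> of degree \<open>d\<close> vanishing at \<open>x\<close>, then
  \<open>a ^ (d - 1) * p(x)\<close> is a monic integral polynomial in \<open>a * x\<close>.\<close>

lemma algebraic_multiple_is_int:
  fixes x :: "'a::field_char_0"
  assumes "algebraic x"
  shows "\<exists>k::nat. k > 0 \<and> algebraic_int (of_nat k * x)"
proof -
  obtain p :: "int poly" where p: "p \<noteq> 0" "poly (map_poly of_int p) x = 0"
    using assms by (erule algebraicE')
  define a where "a = lead_coeff p"
  define d where "d = degree p"
  have a: "a \<noteq> 0" using p(1) by (simp add: a_def)
  have root: "(\<Sum>i\<le>d. of_int (coeff p i) * x ^ i) = 0"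
    using p(2) by (simp add: poly_altdef d_def coeff_map_poly degree_map_poly)
  have d: "d > 0"
  proof (rule ccontr)
    assume "\<not> d > 0"
    then have "of_int a = (0::'a)" using root by (simp add: a_def d_def)
    then show False using a by simp
  qed
  define r :: "'a poly" where "r = (\<Sum>i<d. monom (of_int (coeff p i * a ^ (d - 1 - i))) i)"
  define q where "q = monom 1 d + r"
  have coeff_r: "coeff r i = (if i < d then of_int (coeff p i * a ^ (d - 1 - i)) else 0)" for i
    by (simp add: r_def coeff_sum if_distrib cong: if_cong)
  have "degree r < d"
    using d coeff_r by (intro degree_lessI) auto
  then have deg: "degree q = d"
    by (simp add: q_def degree_add_eq_left degree_monom_eq)
  have "algebraic_int (of_int a * x)"
  proof
    show "lead_coeff q = 1" using deg coeff_r[of d] by (simp add: q_def)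
    show "\<forall>i. coeff q i \<in> \<int>" by (simp add: q_def coeff_r)
    have "poly q (of_int a * x) =
        (of_int a * x) ^ d + (\<Sum>i<d. of_int (coeff p i * a ^ (d - 1 - i)) * (of_int a * x) ^ i)"
      by (simp add: q_def r_def poly_sum poly_monom)
    also have "(\<Sum>i<d. of_int (coeff p i * a ^ (d - 1 - i)) * (of_int a * x) ^ i) =
        (\<Sum>i<d. of_int a ^ (d - 1) * (of_int (coeff p i) * x ^ i))"
    proof (rule sum.cong)
      fix i assume "i \<in> {..<d}"
      then have "of_int a ^ (d - 1) = of_int a ^ (d - 1 - i) * (of_int a ^ i :: 'a)"
        by (simp flip: power_add)
      then show "of_int (coeff p i * a ^ (d - 1 - i)) * (of_int a * x) ^ i =
          of_int a ^ (d - 1) * (of_int (coeff p i) * x ^ i)"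
        by (simp add: power_mult_distrib)
    qed simp
    also have "(of_int a * x) ^ d = of_int a ^ (d - 1) * (of_int (coeff p d) * x ^ d)"
      using d by (cases d) (simp_all add: a_def d_def[symmetric] power_mult_distrib mult_ac del: rat_vs.scale_scale)
    also have "\<dots> + (\<Sum>i<d. of_int a ^ (d - 1) * (of_int (coeff p i) * x ^ i)) =
        of_int a ^ (d - 1) * (\<Sum>i\<le>d. of_int (coeff p i) * x ^ i)"
      by (simp add: sum_distrib_left distrib_left add.commute lessThan_Suc_atMost[symmetric])
    finally show "poly q (of_int a * x) = 0" using root by simp
  qed
  then have "algebraic_int (of_nat (nat \<bar>a\<bar>) * x)"
    by (cases "a > 0") (auto simp: abs_if)
  then show ?thesis using a by (intro exI[of _ "nat \<bar>a\<bar>"]) auto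
qed

section \<open>Fractional ideals and units\<close>

lemma carrier_integer_ring [simp]: "x \<in> carrier integer_ring \<longleftrightarrow> algebraic_int x"
  by (simp add: integer_ring_def)

lemma fractional_idealD:
  assumes "fractional_ideal I"
  shows "0 \<in> I" and "x \<in> I \<Longrightarrow> y \<in> I \<Longrightarrow> x + y \<in> I"
    and "algebraic_int r \<Longrightarrow> x \<in> I \<Longrightarrow> r * x \<in> I"
    and "\<exists>b\<in>I. b \<noteq> 0"
    and "\<exists>d. algebraic_int d \<and> d \<noteq> 0 \<and> (\<forall>x\<in>I. algebraic_int (d * x))"
  using assms by (auto simp: fractional_ideal_def)

lemma fractional_ideal_of_int:
  "fractional_ideal I \<Longrightarrow> x \<in> I \<Longrightarrow> of_int k * x \<in> I"
  by (intro fractional_idealD(3)) (auto intro: int_imp_algebraic_int)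

lemma fractional_ideal_diff:
  assumes "fractional_ideal I" "x \<in> I" "y \<in> I"
  shows "x - y \<in> I"
  using fractional_idealD(2)[OF assms(1,2) fractional_ideal_of_int[OF assms(1,3), of "-1"]] by simp

lemma fractional_ideal_sum:
  "fractional_ideal I \<Longrightarrow> (\<And>i. i \<in> A \<Longrightarrow> x i \<in> I) \<Longrightarrow> sum x A \<in> I"
  by (induction A rule: infinite_finite_induct) (auto intro: fractional_idealD)

lemma unit_group_carrierD:
  assumes "v \<in> carrier unit_group"
  shows "algebraic_int v" "v \<noteq> 0" "algebraic_int (inverse v)"
proof -
  have v: "algebraic_int v" "\<exists>w. algebraic_int w \<and> w * v = 1"
    using assms by (auto simp: unit_group_def units_of_def Units_def integer_ring_def)
  then show "algebraic_int v" "v \<noteq> 0" "algebraic_int (inverse v)"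
    by (auto simp: inverse_unique mult.commute dest: inverse_unique)
qed

context real_embeddings
begin

text \<open>The powers of \<open>x\<close> up to \<open>x ^ n\<close> outnumber the dimension.
  Linear dependence is a property of the set of powers, so a coincidence of two powers is treated
  apart; there \<open>X ^ i - X ^ j\<close> is the polynomial.\<close>

lemma algebraic_field: "algebraic (x :: 'f)"
proof -
  obtain f :: "'n \<Rightarrow> 'f" where f: "rat_basis f" using exists_rat_basis by blast
  define n where "n = CARD('n)"
  show ?thesis
  proof (cases "inj_on (\<lambda>i. x ^ i) {..n}")
    case False
    then obtain i j where ij: "i \<noteq> j" "x ^ i = x ^ j" by (auto simp: inj_on_def)
    define p :: "'f poly" where "p = monom 1 i - monom 1 j"
    have "p \<noteq> 0" using ij(1) by (metis coeff_0 coeff_diff coeff_monom p_def right_minus_eq zero_neq_one)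
    moreover have "poly p x = 0" using ij(2) by (simp add: p_def poly_monom)
    moreover have "coeff p k \<in> \<rat>" for k by (simp add: p_def)
    ultimately show ?thesis unfolding algebraic_altdef by blast
  next
    case True
    define S where "S = (\<lambda>i. x ^ i) ` {..n}"
    have S: "finite S" "card S = n + 1" using True by (simp_all add: S_def card_image)
    have "rat_vs.dependent S"
    proof (rule ccontr)
      assume "rat_vs.independent S"
      then have "card S \<le> card (range f)"
        using rat_vs.independent_span_bound[of "range f" S] f by (auto simp: rat_basis_def)
      also have "\<dots> \<le> n" unfolding n_def by (rule card_image_le) simp
      finally show False using S(2) by simp
    qed
    then obtain u where u: "\<exists>v\<in>S. u v \<noteq> 0" "(\<Sum>v\<in>S. of_rat (u v) * v) = 0"
      using S(1) by (auto simp: rat_vs.dependent_finite)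
    define p :: "'f poly" where "p = (\<Sum>i\<le>n. monom (of_rat (u (x ^ i))) i)"
    have coeff_p: "coeff p i = (if i \<le> n then of_rat (u (x ^ i)) else 0)" for i
      by (simp add: p_def coeff_sum if_distrib cong: if_cong)
    have "p \<noteq> 0"
    proof
      assume "p = 0"
      then have "u (x ^ i) = 0" if "i \<le> n" for i using coeff_p[of i] that by simp
      then show False using u(1) by (auto simp: S_def)
    qed
    moreover have "poly p x = 0"
      using u(2) True by (simp add: p_def S_def poly_sum poly_monom sum.reindex)
    moreover have "coeff p i \<in> \<rat>" for i by (simp add: coeff_p)
    ultimately show ?thesis unfolding algebraic_altdef by blast
  qed
qed

text \<open>Consequently \<open>E\<^sup>n N(x)\<^sup>m\<close> is an integer for all \<open>m\<close>, which forces the rational number \<open>N(x)\<close> to be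
  an integer.\<close>

lemma coord_powers_bounded_denominators:
  fixes f :: "'n \<Rightarrow> 'f"
  assumes f: "rat_basis f" and x: "algebraic_int x"
  shows "\<exists>E::nat. E > 0 \<and> (\<forall>m i j. of_nat E * coord f (x ^ m * f i) j \<in> \<int>)"
proof -
  obtain p where p: "lead_coeff p = 1" "\<And>i. coeff p i \<in> \<int>" "poly p x = 0"
    using x by (auto simp: algebraic_int.simps)
  define d where "d = degree p"
  have "\<forall>k. \<exists>c. coeff p k = of_int c"
    using p(2) unfolding Ints_def by blast
  then obtain c where c: "\<And>k. coeff p k = of_int (c k)" by metis
  have "(\<Sum>k<d. of_int (c k) * x ^ k) + x ^ d = 0"
    using p(1,3) by (simp add: poly_altdef d_def c lessThan_Suc_atMost[symmetric] del: of_int_eq_1_iff)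
  \<comment> \<open>The monic equation expresses \<open>x ^ d\<close> by lower powers with integer
    coefficients, so a common denominator for the exponents below \<open>d\<close> serves all
    exponents.\<close>
  then have xd: "x ^ d = - (\<Sum>k<d. of_int (c k) * x ^ k)"
    by (simp add: add_eq_0_iff2)
  have "finite ((\<lambda>(m, i, j). coord f (x ^ m * f i) j) ` ({..<d} \<times> UNIV \<times> UNIV))" by simp
  from common_denominator[OF this] obtain E :: nat where E: "E > 0"
    and small: "\<And>m i j. m < d \<Longrightarrow> of_nat E * coord f (x ^ m * f i) j \<in> \<int>"
    by fastforce
  have "of_nat E * coord f (x ^ m * f i) j \<in> \<int>" for m i j
  proof (induction m rule: less_induct)
    case (less m)
    show ?case
    proof (cases "m < d")
      case False
      then have "x ^ m * f i = x ^ d * (x ^ (m - d) * f i)"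
        by (metis le_add_diff_inverse mult.assoc not_less power_add)
      also have "\<dots> = (\<Sum>k<d. of_rat (- of_int (c k)) * (x ^ (m - d + k) * f i))"
        by (simp add: xd sum_distrib_right power_add of_rat_minus sum_negf sum_distrib_left mult_ac del: rat_vs.scale_scale)
      finally have "of_nat E * coord f (x ^ m * f i) j =
          (\<Sum>k<d. (- of_int (c k)) * (of_nat E * coord f (x ^ (m - d + k) * f i) j))"
        by (simp only: coord_sum[OF f] coord_cmult[OF f] sum_distrib_left mult.left_commute)
      also have "\<dots> \<in> \<int>"
        using False by (intro Ints_sum Ints_mult less.IH) auto
      finally show ?thesis .
    qed (use small in blast)
  qed
  then show ?thesis using E by blast
qed

lemma Nm_emb_mult: "Nm (emb \<tau> (x * y)) = Nm (emb \<tau> x) * Nm (emb \<tau> y)"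
  by (simp add: Nm_def emb_def tau_mult prod.distrib)

lemma Nm_emb_power: "Nm (emb \<tau> (x ^ m)) = Nm (emb \<tau> x) ^ m"
  by (simp add: Nm_def emb_def tau_power prod_power_distrib)

lemma Nm_emb_eq_0_iff: "Nm (emb \<tau> x) = 0 \<longleftrightarrow> x = 0"
  by (simp add: Nm_def emb_def)

lemma Nm_emb_Ints:
  assumes "algebraic_int x"
  shows "Nm (emb \<tau> x) \<in> \<int>"
proof -
  obtain f :: "'n \<Rightarrow> 'f" where f: "rat_basis f" using exists_rat_basis by blast
  obtain E :: nat where E: "E > 0" and int: "\<And>m i j. of_nat E * coord f (x ^ m * f i) j \<in> \<int>"
    using coord_powers_bounded_denominators[OF f assms] by blast
  show ?thesis
  proof (rule rational_with_bounded_denominators_is_int[of _ "E ^ CARD('n)"])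
    show "Nm (emb \<tau> x) \<in> \<rat>"
      unfolding Nm_eq_det[OF f] by (intro det_Rats) (simp add: mult_matrix_def)
    show "E ^ CARD('n) > 0" using E by simp
    fix m
    define A where "A = mult_matrix f (x ^ m)"
    have "det (\<chi> i. real E *s A $ i) = (\<Prod>i\<in>(UNIV::'n set). real E) * det (\<chi> i. A $ i)"
      by (rule det_rows_mul)
    then have "of_nat (E ^ CARD('n)) * Nm (emb \<tau> x) ^ m = det (\<chi> i. real E *s A $ i)"
      using Nm_eq_det[OF f, of "x ^ m"] by (simp add: A_def Nm_emb_power)
    also have "\<dots> \<in> \<int>"
    proof (rule det_Ints)
      fix i j
      obtain z where "of_nat E * coord f (x ^ m * f i) j = of_int z" using int Ints_cases by blast
      then have "real E * of_rat (coord f (x ^ m * f i) j) = of_int z"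
        by (metis of_rat_mult of_rat_of_int_eq of_rat_of_nat_eq)
      then show "(\<chi> i. real E *s A $ i) $ i $ j \<in> \<int>"
        by (simp add: A_def mult_matrix_def)
    qed
    finally show "of_nat (E ^ CARD('n)) * Nm (emb \<tau> x) ^ m \<in> \<int>" .
  qed
qed

lemma abs_Nm_emb_ge_1:
  assumes "algebraic_int x" "x \<noteq> 0"
  shows "\<bar>Nm (emb \<tau> x)\<bar> \<ge> 1"
  using Nm_emb_Ints[OF assms(1)] assms(2) Nm_emb_eq_0_iff[of x] by (simp add: Ints_nonzero_abs_ge1)

lemma abs_Nm_emb_unit:
  assumes "v \<in> carrier unit_group"
  shows "\<bar>Nm (emb \<tau> v)\<bar> = 1"
proof -
  note v = unit_group_carrierD[OF assms]
  have "\<bar>Nm (emb \<tau> v)\<bar> * \<bar>Nm (emb \<tau> (inverse v))\<bar> = \<bar>Nm (emb \<tau> (v * inverse v))\<bar>"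
    by (simp add: Nm_emb_mult abs_mult)
  also have "\<dots> = 1" using v(2) by (simp add: Nm_def)
  finally have 1: "\<bar>Nm (emb \<tau> v)\<bar> * \<bar>Nm (emb \<tau> (inverse v))\<bar> = 1" .
  have "\<bar>Nm (emb \<tau> v)\<bar> \<ge> 1" "\<bar>Nm (emb \<tau> (inverse v))\<bar> \<ge> 1"
    using v by (auto intro: abs_Nm_emb_ge_1)
  then show ?thesis using 1
    by (smt (verit) mult_le_cancel_left1)
qed

text \<open>For a nonzero \<open>b\<close> in the ideal some positive multiple
  \<open>k i * (f i / b)\<close> is integral, and multiplying by \<open>b\<close> lands in the
  ideal. The product of the \<open>k i\<close> works for all \<open>i\<close> at once.\<close>

lemma fractional_ideal_multiple:
  fixes f :: "'n \<Rightarrow> 'f"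
  assumes I: "fractional_ideal I"
  shows "\<exists>N::nat. N > 0 \<and> (\<forall>i. of_nat N * f i \<in> I)"
proof -
  obtain b where b: "b \<in> I" "b \<noteq> 0" using fractional_idealD(4)[OF I] by blast
  have "\<exists>k::nat. k > 0 \<and> algebraic_int (of_nat k * (f i / b))" for i
    using algebraic_multiple_is_int algebraic_field by blast
  then obtain k :: "'n \<Rightarrow> nat" where k: "\<And>i. k i > 0" "\<And>i. algebraic_int (of_nat (k i) * (f i / b))"
    by metis
  have "of_nat (\<Prod>i\<in>UNIV. k i) * f i \<in> I" for i
  proof -
    have "of_nat (k i) * (f i / b) * b \<in> I"
      using fractional_idealD(3)[OF I k(2) b(1)] .
    then have "of_nat (k i) * f i \<in> I" using b(2) by simp
    then have "of_int (int (\<Prod>j\<in>UNIV - {i}. k j)) * (of_nat (k i) * f i) \<in> I"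
      using I by (rule fractional_ideal_of_int[rotated])
    moreover have "(\<Prod>j\<in>UNIV. k j) = (\<Prod>j\<in>UNIV - {i}. k j) * k i"
      by (subst prod.remove[of UNIV i]) auto
    ultimately show ?thesis by (simp add: mult.assoc)
  qed
  moreover have "(\<Prod>i\<in>UNIV. k i) > 0" using k(1) by (simp add: prod_pos)
  ultimately show ?thesis by blast
qed

text \<open>All discreteness statements are derived from the norm of single elements and from the closure of
  ideals under addition, so that it is never needed that the algebraic integers form a ring.\<close>

lemma fractional_ideal_Nm_bound:
  assumes I: "fractional_ideal I"
  shows "\<exists>l>0. \<forall>\<beta>\<in>I. \<beta> \<noteq> 0 \<longrightarrow> \<bar>Nm (emb \<tau> \<beta>)\<bar> \<ge> l"
proof -
  obtain d where d: "algebraic_int d" "d \<noteq> 0" "\<And>x. x \<in> I \<Longrightarrow> algebraic_int (d * x)"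
    using fractional_idealD(5)[OF I] by blast
  have Nd: "\<bar>Nm (emb \<tau> d)\<bar> > 0" using d(2) by (simp add: Nm_emb_eq_0_iff)
  have "\<bar>Nm (emb \<tau> \<beta>)\<bar> \<ge> 1 / \<bar>Nm (emb \<tau> d)\<bar>" if "\<beta> \<in> I" "\<beta> \<noteq> 0" for \<beta>
    using abs_Nm_emb_ge_1[OF d(3)[OF that(1)]] that(2) d(2) Nd
    by (simp add: Nm_emb_mult abs_mult divide_le_eq mult.commute)
  then show ?thesis using Nd by (intro exI[of _ "1 / \<bar>Nm (emb \<tau> d)\<bar>"]) auto
qed

text \<open>Pigeonhole with cells of side \<open>\<delta> = min 1 l\<close>, where \<open>l\<close>
  bounds nonzero norms from below. Two elements in one cell have a difference whose embeddings are
  all below 1 and also below \<open>l\<close>, so its norm is below \<open>l\<close> and it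
  vanishes. The factor singled out in the product is arbitrary.\<close>

lemma fractional_ideal_discrete:
  assumes I: "fractional_ideal I"
  shows "finite {\<beta>\<in>I. \<forall>i. \<bar>\<tau> i \<beta>\<bar> \<le> R}"
proof -
  obtain l where l: "l > 0" "\<And>\<beta>. \<beta> \<in> I \<Longrightarrow> \<beta> \<noteq> 0 \<Longrightarrow> \<bar>Nm (emb \<tau> \<beta>)\<bar> \<ge> l"
    using fractional_ideal_Nm_bound[OF I] by blast
  define \<delta> where "\<delta> = min 1 l"
  have \<delta>: "\<delta> > 0" "\<delta> \<le> 1" "\<delta> \<le> l" using l(1) by (auto simp: \<delta>_def)
  define h where "h \<beta> = (\<lambda>i. \<lfloor>\<tau> i \<beta> / \<delta>\<rfloor>)" for \<beta>
  define X where "X = {\<beta>\<in>I. \<forall>i. \<bar>\<tau> i \<beta>\<bar> \<le> R}"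
  have "h ` X \<subseteq> PiE UNIV (\<lambda>_. {- \<lceil>R / \<delta>\<rceil> .. \<lceil>R / \<delta>\<rceil>})"
  proof
    fix g assume "g \<in> h ` X"
    then obtain \<beta> where \<beta>: "g = h \<beta>" "\<And>i. \<bar>\<tau> i \<beta>\<bar> \<le> R" by (auto simp: X_def)
    have "g i \<in> {- \<lceil>R / \<delta>\<rceil> .. \<lceil>R / \<delta>\<rceil>}" for i
    proof -
      have "- (R / \<delta>) \<le> \<tau> i \<beta> / \<delta>" "\<tau> i \<beta> / \<delta> \<le> R / \<delta>"
        using \<beta>(2)[of i] \<delta>(1) by (simp_all add: field_simps abs_le_iff)
      then show ?thesis unfolding \<beta>(1) h_def
        by (simp add: le_floor_iff) linarith
    qed
    then show "g \<in> PiE UNIV (\<lambda>_. {- \<lceil>R / \<delta>\<rceil> .. \<lceil>R / \<delta>\<rceil>})" by auto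
  qed
  then have "finite (h ` X)"
    by (rule finite_subset) (simp add: finite_PiE)
  moreover have "inj_on h X"
  proof (rule inj_onI, rule ccontr)
    fix x y assume xy: "x \<in> X" "y \<in> X" "h x = h y" "x \<noteq> y"
    have less: "\<bar>\<tau> i (x - y)\<bar> < \<delta>" for i
    proof -
      have "\<lfloor>\<tau> i x / \<delta>\<rfloor> = \<lfloor>\<tau> i y / \<delta>\<rfloor>" using xy(3) by (metis h_def)
      then have "\<bar>\<tau> i x / \<delta> - \<tau> i y / \<delta>\<bar> < 1" by linarith
      moreover have "\<bar>\<tau> i x / \<delta> - \<tau> i y / \<delta>\<bar> = \<bar>\<tau> i x - \<tau> i y\<bar> / \<delta>"
        using \<delta>(1) by (simp flip: diff_divide_distrib)
      ultimately show ?thesis using \<delta>(1) by (simp add: tau_diff)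
    qed
    have "\<bar>Nm (emb \<tau> (x - y))\<bar> = (\<Prod>i\<in>UNIV. \<bar>\<tau> i (x - y)\<bar>)"
      by (simp add: Nm_def emb_def abs_prod)
    also have "\<dots> = \<bar>\<tau> nth_index (x - y)\<bar> * (\<Prod>i\<in>UNIV - {nth_index}. \<bar>\<tau> i (x - y)\<bar>)"
      by (subst prod.remove[of UNIV nth_index]) auto
    also have "\<dots> \<le> \<bar>\<tau> nth_index (x - y)\<bar> * 1"
      using less \<delta>(2) by (intro mult_left_mono prod_le_1) (auto intro: less_imp_le order_trans)
    also have "\<dots> < l" using less_le_trans[OF less \<delta>(3)] by simp
    finally have "\<bar>Nm (emb \<tau> (x - y))\<bar> < l" .
    moreover have "x - y \<in> I" using xy I by (auto simp: X_def fractional_ideal_diff)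
    ultimately show False using l(2)[of "x - y"] xy(4) by simp
  qed
  ultimately show ?thesis unfolding X_def[symmetric] by (rule finite_imageD)
qed

text \<open>Subtracting integer combinations of the \<open>N * f j\<close>, which lie in the ideal,
  moves any element to a remainder of bounded size without affecting denominators. By discreteness
  there are finitely many remainders.\<close>

lemma fractional_ideal_bounded_denominators:
  fixes f :: "'n \<Rightarrow> 'f"
  assumes I: "fractional_ideal I" and f: "rat_basis f"
  shows "\<exists>D::nat. D > 0 \<and> (\<forall>\<beta>\<in>I. \<forall>i. of_nat D * coord f \<beta> i \<in> \<int>)"
proof -
  obtain N :: nat where N: "N > 0" "\<And>i. of_nat N * f i \<in> I"
    using fractional_ideal_multiple[OF I] by blast
  define R where "R = (\<Sum>i\<in>UNIV. \<Sum>k\<in>UNIV. real N * \<bar>\<tau> k (f i)\<bar>)"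
  define Q where "Q = {\<beta>\<in>I. \<forall>k. \<bar>\<tau> k \<beta>\<bar> \<le> R}"
  have "finite Q" unfolding Q_def using I by (rule fractional_ideal_discrete)
  then have "finite ((\<lambda>(\<beta>, i). coord f \<beta> i) ` (Q \<times> UNIV))" by simp
  from common_denominator[OF this] obtain D :: nat where D: "D > 0"
    and int: "\<And>\<beta> i. \<beta> \<in> Q \<Longrightarrow> of_nat D * coord f \<beta> i \<in> \<int>"
    by fastforce
  have "of_nat D * coord f \<beta> i \<in> \<int>" if \<beta>: "\<beta> \<in> I" for \<beta> i
  proof -
    define m where "m j = \<lfloor>coord f \<beta> j / of_nat N\<rfloor>" for j
    define t where "t j = coord f \<beta> j - of_int (m j * int N)" for j
    define \<gamma> where "\<gamma> = lincomb f t"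
    have coord_\<gamma>: "coord f \<gamma> = t" by (simp add: \<gamma>_def coord_lincomb f)
    have "\<gamma> = \<beta> - (\<Sum>j\<in>UNIV. of_int (m j) * (of_nat N * f j))"
      unfolding \<gamma>_def t_def lincomb_diff lincomb_coord[OF f]
      by (simp add: lincomb_def of_rat_mult mult.assoc del: rat_vs.scale_scale)
    then have "\<gamma> \<in> I"
      using I \<beta> N(2) by (auto intro!: fractional_ideal_diff fractional_ideal_sum fractional_ideal_of_int)
    moreover have "\<bar>\<tau> k \<gamma>\<bar> \<le> R" for k
    proof -
      have t: "\<bar>t j\<bar> \<le> of_nat N" for j
      proof -
        have "of_int (m j) \<le> coord f \<beta> j / of_nat N" "coord f \<beta> j / of_nat N < of_int (m j) + 1"
          unfolding m_def by linarith+
        then show ?thesis using N(1) by (simp add: t_def field_simps)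
      qed
      have "\<bar>\<tau> k \<gamma>\<bar> \<le> (\<Sum>j\<in>UNIV. \<bar>of_rat (t j) * \<tau> k (f j)\<bar>)"
        unfolding \<gamma>_def lincomb_def tau_sum tau_mult tau_of_rat by (rule sum_abs)
      also have "\<dots> \<le> (\<Sum>j\<in>UNIV. real N * \<bar>\<tau> k (f j)\<bar>)"
      proof (rule sum_mono)
        fix j
        have "\<bar>real_of_rat (t j)\<bar> \<le> real N"
          using t[of j] by (metis abs_of_rat of_rat_less_eq of_rat_of_nat_eq)
        then show "\<bar>of_rat (t j) * \<tau> k (f j)\<bar> \<le> real N * \<bar>\<tau> k (f j)\<bar>"
          by (simp add: abs_mult mult_right_mono)
      qed
      also have "\<dots> \<le> R"
        unfolding R_def by (intro sum_mono member_le_sum) auto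
      finally show ?thesis .
    qed
    ultimately have "\<gamma> \<in> Q" by (simp add: Q_def)
    from int[OF this, of i] have "of_nat D * t i \<in> \<int>" by (simp add: coord_\<gamma>)
    then have "of_nat D * t i + of_int (int D * (m i * int N)) \<in> \<int>" by (intro Ints_add) auto
    also have "of_nat D * t i + of_int (int D * (m i * int N)) = of_nat D * coord f \<beta> i"
      by (simp add: t_def algebra_simps)
    finally show ?thesis .
  qed
  then show ?thesis using D by blast
qed

end

section \<open>Half-open cones\<close>

lemma eventually_at_right_pos_iff:
  fixes a b :: real
  shows "eventually (\<lambda>t. 0 < a + t * b \<longleftrightarrow> 0 < a \<or> a = 0 \<and> 0 < b) (at_right 0)"
proof -
  have lim: "((\<lambda>t. a + t * b) \<longlongrightarrow> a) (at_right 0)"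
    by (rule tendsto_eq_intros refl)+ simp
  consider "a > 0" | "a < 0" | "a = 0" by linarith
  then show ?thesis
  proof cases
    case 1
    then show ?thesis using order_tendstoD(1)[OF lim, of 0]
      by (auto elim: eventually_mono)
  next
    case 2
    then show ?thesis using order_tendstoD(2)[OF lim, of 0]
      by (auto elim: eventually_mono)
  next
    case 3
    have "eventually (\<lambda>t::real. t > 0) (at_right 0)"
      by (rule eventually_at_right_less)
    then show ?thesis by eventually_elim (use 3 in \<open>auto simp: zero_less_mult_iff\<close>)
  qed
qed

lemma linear_combination_unique:
  fixes B :: "'n::finite \<Rightarrow> real ^ 'n"
  assumes "det (\<chi> i. B i) \<noteq> 0" and "(\<Sum>i\<in>UNIV. u i *\<^sub>R B i) = (\<Sum>i\<in>UNIV. w i *\<^sub>R B i)"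
  shows "u i = w i"
proof -
  have "(\<Sum>i\<in>UNIV. (u i - w i) *s row i (\<chi> i. B i)) = 0"
    using assms(2) by (simp add: scaleR_left_diff_distrib sum_subtractf row_def scalar_mult_eq_scaleR)
  moreover have "\<exists>A'. (\<chi> i. B i) ** A' = mat 1"
    using assms(1) by (metis invertible_det_nz invertible_def)
  ultimately show ?thesis
    unfolding matrix_right_invertible_independent_rows by (metis right_minus_eq)
qed

lemma cone0_linear_combination:
  fixes B :: "'n::finite \<Rightarrow> real ^ 'n"
  assumes "det (\<chi> i. B i) \<noteq> 0" and "\<And>i. Tr (B i * y) \<noteq> 0"
  shows "(\<Sum>i\<in>UNIV. u i *\<^sub>R B i) \<in> cone0 B y \<longleftrightarrow> (\<forall>i. 0 < sgn (Tr (B i * y)) * u i)"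
proof
  assume "(\<Sum>i\<in>UNIV. u i *\<^sub>R B i) \<in> cone0 B y"
  then obtain t where t: "\<And>i. t i > 0"
    "(\<Sum>i\<in>UNIV. u i *\<^sub>R B i) = (\<Sum>i\<in>UNIV. (t i * sgn (Tr (B i * y))) *\<^sub>R B i)"
    by (auto simp: cone0_def)
  have "u i = t i * sgn (Tr (B i * y))" for i
    by (rule linear_combination_unique[OF assms(1) t(2)])
  then show "\<forall>i. 0 < sgn (Tr (B i * y)) * u i"
    using t(1) assms(2) by (simp add: sgn_if)
next
  assume *: "\<forall>i. 0 < sgn (Tr (B i * y)) * u i"
  have sgn: "sgn (Tr (B i * y)) * u i * sgn (Tr (B i * y)) = u i" for i
    using assms(2)[of i] by (simp add: sgn_if)
  show "(\<Sum>i\<in>UNIV. u i *\<^sub>R B i) \<in> cone0 B y"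
    unfolding cone0_def mem_Collect_eq
    by (intro exI[of _ "\<lambda>i. sgn (Tr (B i * y)) * u i"] conjI *) (simp only: sgn)
qed

text \<open>The shift along the axis turns the coordinates into \<open>s i + t * c i\<close>, whose
  signs settle for small \<open>t > 0\<close>. The limit in \<open>chi\<close> is thus that of an
  eventually constant function, and the sign of \<open>c i\<close> decides on the facet
  \<open>s i = 0\<close>.\<close>

lemma chi_linear_combination:
  fixes B :: "'n::{finite,linorder} \<Rightarrow> (real, 'n) vec"
  assumes det: "det (\<chi> i. B i) \<noteq> 0" and y: "\<And>i. Tr (B i * y) \<noteq> 0"
    and c: "axis nth_index 1 = (\<Sum>i\<in>UNIV. c i *\<^sub>R B i)"
  shows "chi B (\<Sum>i\<in>UNIV. s i *\<^sub>R B i) y = basis_sign B y *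
    of_bool (\<forall>i. 0 < sgn (Tr (B i * y)) * s i \<or> s i = 0 \<and> 0 < sgn (Tr (B i * y)) * c i)"
proof -
  define e where "e i = sgn (Tr (B i * y))" for i
  have e: "e i \<noteq> 0" for i using y[of i] by (simp add: e_def sgn_eq_0_iff)
  have eq: "(\<Sum>i\<in>UNIV. s i *\<^sub>R B i) + t *\<^sub>R axis nth_index 1 = (\<Sum>i\<in>UNIV. (s i + t * c i) *\<^sub>R B i)" for t
    unfolding c by (simp add: scaleR_left_distrib sum.distrib scaleR_sum_right)
  have "eventually (\<lambda>t. \<forall>i. 0 < e i * s i + t * (e i * c i) \<longleftrightarrow> 0 < e i * s i \<or> e i * s i = 0 \<and> 0 < e i * c i) (at_right 0)"
    by (intro eventually_all_finite eventually_at_right_pos_iff)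
  then have "eventually (\<lambda>t. chi0 B ((\<Sum>i\<in>UNIV. s i *\<^sub>R B i) + t *\<^sub>R axis nth_index 1) y =
      basis_sign B y * of_bool (\<forall>i. 0 < e i * s i \<or> s i = 0 \<and> 0 < e i * c i)) (at_right 0)"
  proof eventually_elim
    case (elim t)
    then show ?case
      unfolding chi0_def eq indicator_def cone0_linear_combination[OF det y] e_def[symmetric]
      using e by (simp add: algebra_simps)
  qed
  then have "((\<lambda>t. chi0 B ((\<Sum>i\<in>UNIV. s i *\<^sub>R B i) + t *\<^sub>R axis nth_index 1) y) \<longlongrightarrow>
      basis_sign B y * of_bool (\<forall>i. 0 < e i * s i \<or> s i = 0 \<and> 0 < e i * c i)) (at_right 0)"
    by (rule tendsto_eventually)
  then show ?thesis
    unfolding chi_def e_def by (intro tendsto_Lim) auto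
qed

lemma sgn_Nm: "sgn (Nm x) = (\<Prod>i\<in>UNIV. sgn (x $ i))"
proof -
  have "sgn (prod f A) = (\<Prod>i\<in>A. sgn (f i))" for f :: "'a \<Rightarrow> real" and A
    by (induction A rule: infinite_finite_induct) (auto simp: sgn_mult)
  then show ?thesis by (simp add: Nm_def)
qed

text \<open>A point with nonzero coordinates lies on no facet, so the tie-break by
  \<open>e_n\<close> never applies. The sign is that of the norm because the determinant is 1 and
  pairing with an axis reads off a coordinate.\<close>

lemma chi_axis:
  fixes x y :: "(real, 'n::{finite,linorder}) vec"
  assumes "x \<in> unit_vecs" "y \<in> unit_vecs"
  shows "chi (\<lambda>i. axis i 1) x y = sgn (Nm y) * of_bool (\<forall>i. 0 < x $ i * y $ i)"
proof -
  have Tr: "Tr (axis i 1 * y) = y $ i" for i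
  proof -
    have "(axis i 1 * y) $ k = (if k = i then y $ k else 0)" for k by (simp add: axis_def)
    then show ?thesis by (simp add: Tr_def)
  qed
  have mat: "(\<chi> i. axis i 1) = (mat 1 :: ((real, 'n) vec, 'n) vec)"
    by (simp add: mat_def axis_def vec_eq_iff)
  have c: "axis nth_index 1 = (\<Sum>i\<in>UNIV. (if i = nth_index then 1 else 0) *\<^sub>R (axis i 1 :: (real, 'n) vec))"
    by (simp add: if_distrib[of "\<lambda>c. c *\<^sub>R _"] cong: if_cong)
  have x: "x = (\<Sum>i\<in>UNIV. x $ i *\<^sub>R axis i 1)"
    by (simp add: vec_eq_iff axis_def if_distrib cong: if_cong)
  have "chi (\<lambda>i. axis i 1) (\<Sum>i\<in>UNIV. x $ i *\<^sub>R axis i 1) y = basis_sign (\<lambda>i. axis i 1) y *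
    of_bool (\<forall>i. 0 < sgn (Tr (axis i 1 * y)) * x $ i \<or>
      x $ i = 0 \<and> 0 < sgn (Tr (axis i 1 * y)) * (if i = nth_index then 1 else 0))"
    using assms by (intro chi_linear_combination c) (auto simp: mat Tr unit_vecs_def)
  also have "basis_sign (\<lambda>i. axis i 1) y = sgn (Nm y)"
    by (simp add: basis_sign_def mat Tr sgn_Nm)
  finally have *: "chi (\<lambda>i. axis i 1) x y = sgn (Nm y) *
    of_bool (\<forall>i. 0 < sgn (y $ i) * x $ i \<or> x $ i = 0 \<and> 0 < sgn (y $ i) * (if i = nth_index then 1 else 0))"
    unfolding x[symmetric] Tr .
  have "(0 < sgn (y $ i) * x $ i \<or> x $ i = 0 \<and> 0 < sgn (y $ i) * (if i = nth_index then 1 else 0)) \<longleftrightarrow>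
      0 < x $ i * y $ i" for i
  proof -
    have "x $ i \<noteq> 0" using assms(1) by (simp add: unit_vecs_def)
    then show ?thesis by (auto simp: sgn_if zero_less_mult_iff)
  qed
  then show ?thesis unfolding * by simp
qed

section \<open>Action of field elements on half-open cones\<close>

context real_embeddings
begin

text \<open>Multiplication by \<open>w\<close> multiplies the basis matrix by a diagonal matrix of
  determinant \<open>Nm w\<close>, while in the pairings \<open>w\<close> passes over to
  \<open>y\<close>.\<close>

lemma basis_sign_translate:
  "basis_sign (\<lambda>i. w * B i) y = sgn (Nm w) * basis_sign B (w * y)"
  for B :: "'n \<Rightarrow> (real, 'n) vec"
proof -
  have "(\<chi> i. w * B i) = (\<chi> i. B i) ** (\<chi> i j. if i = j then w $ i else 0)"
    by (simp add: vec_eq_iff matrix_matrix_mult_def if_distrib mult.commute cong: if_cong)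
  then have "det (\<chi> i. w * B i) = det (\<chi> i. B i) * det (\<chi> i j. if i = j then w $ i else 0 :: ((real, 'n) vec, 'n) vec)"
    by (simp add: det_mul)
  also have "det (\<chi> i j. if i = j then w $ i else 0 :: ((real, 'n) vec, 'n) vec) = Nm w"
    by (subst det_diagonal) (auto simp: Nm_def)
  finally show ?thesis
    by (simp add: basis_sign_def sgn_mult mult_ac)
qed

lemma chi_emb:
  fixes f :: "'n \<Rightarrow> 'f"
  assumes f: "rat_basis f" and c: "axis nth_index 1 = (\<Sum>i\<in>UNIV. c i *\<^sub>R emb \<tau> (f i))"
    and y: "\<And>i. Tr (emb \<tau> (f i) * y) \<noteq> 0"
  shows "chi (\<lambda>i. emb \<tau> (f i)) (emb \<tau> \<alpha>) y = basis_sign (\<lambda>i. emb \<tau> (f i)) y *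
    of_bool (\<forall>i. 0 < sgn (Tr (emb \<tau> (f i) * y)) * of_rat (coord f \<alpha> i) \<or>
      coord f \<alpha> i = 0 \<and> 0 < sgn (Tr (emb \<tau> (f i) * y)) * c i)"
proof -
  have "emb \<tau> \<alpha> = (\<Sum>i\<in>UNIV. of_rat (coord f \<alpha> i) *\<^sub>R emb \<tau> (f i))"
    using emb_lincomb[of f "coord f \<alpha>"] lincomb_coord[OF f] by simp
  then show ?thesis
    using chi_linear_combination[of "\<lambda>i. emb \<tau> (f i)" y c "\<lambda>i. of_rat (coord f \<alpha> i)"]
      det_emb_matrix[OF f] c y by (simp add: emb_matrix_def)
qed

lemma Tr_emb_lincomb:
  fixes f :: "'n \<Rightarrow> 'f"
  assumes f: "rat_basis f"
  shows "Tr (emb \<tau> \<alpha> * y) = (\<Sum>i\<in>UNIV. of_rat (coord f \<alpha> i) * Tr (emb \<tau> (f i) * y))"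
proof -
  have "emb \<tau> \<alpha> = (\<Sum>i\<in>UNIV. of_rat (coord f \<alpha> i) *\<^sub>R emb \<tau> (f i))"
    using emb_lincomb[of f "coord f \<alpha>"] lincomb_coord[OF f] by simp
  then have "Tr (emb \<tau> \<alpha> * y) = (\<Sum>k\<in>UNIV. \<Sum>i\<in>UNIV. of_rat (coord f \<alpha> i) * (emb \<tau> (f i) $ k * y $ k))"
    by (simp add: Tr_def sum_distrib_right mult.assoc)
  also have "\<dots> = (\<Sum>i\<in>UNIV. of_rat (coord f \<alpha> i) * Tr (emb \<tau> (f i) * y))"
    by (subst sum.swap) (simp add: Tr_def sum_distrib_left)
  finally show ?thesis .
qed

text \<open>The coordinates of \<open>v * \<alpha>\<close> in the translated basis are those of
  \<alpha> in the old one. Those of \<open>e_n\<close> are divided by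
  \<open>\<tau> nth_index v\<close>, and its positivity keeps their signs, hence the choice of
  facets.\<close>

lemma chi_translate:
  fixes f :: "'n \<Rightarrow> 'f"
  assumes f: "rat_basis f" and v: "\<tau> nth_index v > 0"
    and y: "\<And>i. Tr (emb \<tau> (f i) * (emb \<tau> v * y)) \<noteq> 0"
  shows "chi (\<lambda>i. emb \<tau> v * emb \<tau> (f i)) (emb \<tau> (v * \<alpha>)) y =
    sgn (Nm (emb \<tau> v)) * chi (\<lambda>i. emb \<tau> (f i)) (emb \<tau> \<alpha>) (emb \<tau> v * y)"
proof -
  have v0: "v \<noteq> 0" using v by auto
  obtain c where c: "axis nth_index 1 = (\<Sum>i\<in>UNIV. c i *\<^sub>R emb \<tau> (f i))"
    using axis_coordinates[OF f] by blast
  define w where "w = \<tau> nth_index v"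
  define B where "B = (\<lambda>i. emb \<tau> v * emb \<tau> (f i))"
  have "emb \<tau> v * axis nth_index 1 = w *\<^sub>R axis nth_index 1"
    by (simp add: vec_eq_iff axis_def emb_def w_def)
  then have "axis nth_index 1 = inverse w *\<^sub>R (emb \<tau> v * axis nth_index 1)"
    using v v0 by (simp add: w_def)
  also have "\<dots> = (\<Sum>i\<in>UNIV. (c i / w) *\<^sub>R B i)"
    unfolding c B_def by (simp add: sum_distrib_left scaleR_sum_right divide_inverse mult.commute)
  finally have c': "axis nth_index 1 = (\<Sum>i\<in>UNIV. (c i / w) *\<^sub>R B i)" .
  \<comment> \<open>The determinant is seen to be nonzero through \<open>basis_sign\<close>, of
    which its sign is a factor.\<close>
  have "sgn (det (\<chi> i. B i)) \<noteq> 0"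
  proof -
    have "basis_sign B y = sgn (Nm (emb \<tau> v)) * basis_sign (\<lambda>i. emb \<tau> (f i)) (emb \<tau> v * y)"
      unfolding B_def by (rule basis_sign_translate)
    also have "\<dots> \<noteq> 0"
      using v0 y det_emb_matrix[OF f]
      by (simp add: basis_sign_def Nm_emb_eq_0_iff sgn_eq_0_iff emb_matrix_def)
    finally show ?thesis by (auto simp: basis_sign_def)
  qed
  then have det: "det (\<chi> i. B i) \<noteq> 0" by auto
  have Tr: "Tr (B i * y) = Tr (emb \<tau> (f i) * (emb \<tau> v * y))" for i
    by (simp add: B_def mult_ac)
  have "emb \<tau> \<alpha> = (\<Sum>i\<in>UNIV. of_rat (coord f \<alpha> i) *\<^sub>R emb \<tau> (f i))"
    using emb_lincomb[of f "coord f \<alpha>"] lincomb_coord[OF f] by simp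
  then have x: "emb \<tau> (v * \<alpha>) = (\<Sum>i\<in>UNIV. of_rat (coord f \<alpha> i) *\<^sub>R B i)"
    unfolding emb_mult B_def by (simp add: sum_distrib_left)
  have "chi B (emb \<tau> (v * \<alpha>)) y = basis_sign B y *
    of_bool (\<forall>i. 0 < sgn (Tr (B i * y)) * of_rat (coord f \<alpha> i) \<or>
      (of_rat (coord f \<alpha> i) :: real) = 0 \<and> 0 < sgn (Tr (B i * y)) * (c i / w))"
    unfolding x using y by (intro chi_linear_combination det c') (simp add: Tr)
  also have "basis_sign B y = sgn (Nm (emb \<tau> v)) * basis_sign (\<lambda>i. emb \<tau> (f i)) (emb \<tau> v * y)"
    unfolding B_def by (rule basis_sign_translate)
  finally have chi: "chi B (emb \<tau> (v * \<alpha>)) y = sgn (Nm (emb \<tau> v)) * basis_sign (\<lambda>i. emb \<tau> (f i)) (emb \<tau> v * y) *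
    of_bool (\<forall>i. 0 < sgn (Tr (B i * y)) * of_rat (coord f \<alpha> i) \<or>
      (of_rat (coord f \<alpha> i) :: real) = 0 \<and> 0 < sgn (Tr (B i * y)) * (c i / w))" .
  have "(0 < sgn (Tr (B i * y)) * (c i / w)) = (0 < sgn (Tr (B i * y)) * c i)" for i
    using v by (simp add: w_def zero_less_mult_iff zero_less_divide_iff)
  then show ?thesis
    unfolding chi_emb[OF f c y] B_def[symmetric] chi unfolding Tr by (simp add: mult.assoc)
qed

end

text \<open>Elements of \<open>q_combinations\<close> are sums over a set of functions. Indices that
  give the same monomial are therefore merged, and the span is closed under adding their
  coefficients.\<close>

lemma q_combinations_sum:
  assumes "finite I" and "\<And>i. i \<in> I \<Longrightarrow> m i \<in> q_monomials \<tau> Y" and "\<And>i. i \<in> I \<Longrightarrow> c i \<in> int_mod.span A"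
  shows "(\<lambda>y. \<Sum>i\<in>I. c i * m i y) \<in> q_combinations (int_mod.span A) \<tau> Y"
proof -
  define c' where "c' g = (\<Sum>i\<in>{i\<in>I. m i = g}. c i)" for g
  have "(\<Sum>i\<in>I. c i * m i y) = (\<Sum>g\<in>m ` I. c' g * g y)" for y
  proof -
    have "(\<Sum>i\<in>I. c i * m i y) = (\<Sum>g\<in>m ` I. \<Sum>i\<in>{i\<in>I. m i = g}. c i * m i y)"
      using assms(1) by (rule sum.image_gen)
    also have "\<dots> = (\<Sum>g\<in>m ` I. c' g * g y)"
      unfolding c'_def sum_distrib_right by (intro sum.cong) auto
    finally show ?thesis .
  qed
  then have "(\<lambda>y. \<Sum>i\<in>I. c i * m i y) = (\<lambda>y. \<Sum>g\<in>m ` I. c' g * g y)" by auto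
  moreover have "c' g \<in> int_mod.span A" for g
    unfolding c'_def using assms(3) by (intro int_mod.span_sum) auto
  ultimately show ?thesis
    unfolding q_combinations_def using assms(1,2)
    by (intro CollectI exI[of _ "m ` I"] exI[of _ c']) auto
qed

lemma q_monomials_prod:
  assumes "finite A" and "\<And>i. i \<in> A \<Longrightarrow> g i \<noteq> 0" and "\<And>i y. i \<in> A \<Longrightarrow> y \<in> Y \<Longrightarrow> qpow \<tau> (g i) y \<noteq> 1"
    and "m \<in> q_monomials \<tau> Y"
  shows "(\<lambda>y. m y * (\<Prod>i\<in>A. 1 / (1 - qpow \<tau> (g i) y))) \<in> q_monomials \<tau> Y"
  using assms(1-3)
proof (induction A rule: finite_induct)
  case (insert i A)
  then have "(\<lambda>y. m y * (\<Prod>i\<in>A. 1 / (1 - qpow \<tau> (g i) y)) * (1 / (1 - qpow \<tau> (g i) y))) \<in> q_monomials \<tau> Y"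
    by (intro q_monomials.inv) auto
  moreover have "(\<lambda>y. m y * (\<Prod>i\<in>A. 1 / (1 - qpow \<tau> (g i) y)) * (1 / (1 - qpow \<tau> (g i) y))) =
      (\<lambda>y. m y * (\<Prod>i\<in>insert i A. 1 / (1 - qpow \<tau> (g i) y)))"
    using insert.hyps by (simp add: mult_ac fun_eq_iff)
  ultimately show ?case by simp
qed (use assms(4) in simp)

text \<open>The generators require a nonzero exponent; for exponent 0 the function is the empty
  monomial.\<close>

lemma (in real_embeddings) qpow_in_q_monomials: "qpow \<tau> \<alpha> \<in> q_monomials \<tau> Y"
proof (cases "\<alpha> = 0")
  case True
  then have "qpow \<tau> \<alpha> = (\<lambda>y. 1)" by (simp add: qpow_def Tr_def fun_eq_iff)
  then show ?thesis by (simp add: q_monomials.one)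
next
  case False
  have "(\<lambda>y. 1 * qpow \<tau> \<alpha> y) \<in> q_monomials \<tau> Y"
    using q_monomials.one False by (rule q_monomials.pow)
  then show ?thesis by simp
qed

section \<open>The series over a half-open cone\<close>

lemma of_bool_all:
  fixes P :: "'n::finite \<Rightarrow> bool"
  shows "of_bool (\<forall>i. P i) = (\<Prod>i\<in>UNIV. of_bool (P i) :: real)"
proof (cases "\<forall>i. P i")
  case False
  then have "(\<Prod>i\<in>UNIV. of_bool (P i) :: real) = 0" by (subst prod_zero_iff) auto
  then show ?thesis using False by simp
qed simp

lemma has_sum_int_subset:
  fixes h :: "nat \<Rightarrow> int" and f :: "int \<Rightarrow> real"
  assumes "inj h" and "\<And>m. m \<notin> range h \<Longrightarrow> f m = 0" and "((\<lambda>k. f (h k)) has_sum S) UNIV"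
  shows "(f has_sum S) UNIV"
proof -
  have "(f has_sum S) (range h)"
    using has_sum_reindex[OF assms(1), of f S] assms(3) by (simp add: o_def)
  also have "?this \<longleftrightarrow> (f has_sum S) UNIV"
    using assms(2) by (intro has_sum_cong_neutral) auto
  finally show ?thesis .
qed

text \<open>For \<open>a < 0\<close> the series runs over the negative exponents; the sign makes its sum the same
  rational function of \<open>exp (- a)\<close> as for \<open>a > 0\<close>.\<close>

lemma has_sum_signed_geometric:
  fixes a :: real
  assumes "a \<noteq> 0"
  shows "((\<lambda>m::int. sgn a * of_bool (if a > 0 then m \<ge> 0 else m < 0) * exp (- a * of_int m))
    has_sum 1 / (1 - exp (- a))) UNIV"
proof (cases "a > 0")
  case True
  have "(\<lambda>k. exp (- a) ^ k) sums (1 / (1 - exp (- a)))"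
    using True by (intro geometric_sums) simp
  then have "((\<lambda>k. exp (- a) ^ k) has_sum 1 / (1 - exp (- a))) UNIV"
    by (rule sums_nonneg_imp_has_sum) simp
  moreover have "exp (- a) ^ k = exp (- a * of_int (int k))" for k
    by (simp add: exp_of_nat_mult[symmetric] mult.commute)
  ultimately show ?thesis
    using True by (intro has_sum_int_subset[of int]) (auto simp: image_iff dest: zero_le_imp_eq_int)
next
  case False
  then have a: "a < 0" using assms by simp
  have "(\<lambda>k. exp a ^ k) sums (1 / (1 - exp a))"
    using a by (intro geometric_sums) simp
  then have "((\<lambda>k. exp a ^ k) has_sum 1 / (1 - exp a)) UNIV"
    by (rule sums_nonneg_imp_has_sum) simp
  \<comment> \<open>The factor \<open>- exp a\<close> carries the sign and shifts the exponents:
    \<open>k\<close> becomes \<open>m = - 1 - k\<close>, which leaves out \<open>m = 0\<close>. The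
    value is matched by \<open>- z / (1 - z) = 1 / (1 - 1 / z)\<close> for
    \<open>z = exp a\<close>.\<close>
  then have "((\<lambda>k. (- exp a) * exp a ^ k) has_sum (- exp a) * (1 / (1 - exp a))) UNIV"
    by (rule has_sum_cmult_right)
  also have "(\<lambda>k. (- exp a) * exp a ^ k) = (\<lambda>k. - exp (- a * of_int (- 1 - int k)))"
    by (simp add: fun_eq_iff exp_of_nat_mult[symmetric] mult.commute algebra_simps flip: exp_add)
  also have "(- exp a) * (1 / (1 - exp a)) = 1 / (1 - exp (- a))"
    using a by (simp add: exp_minus field_simps)
  finally show ?thesis
    using a
  proof (intro has_sum_int_subset[of "\<lambda>k. - 1 - int k"])
    fix m :: int assume m: "m \<notin> range (\<lambda>k. - 1 - int k)"
    have "m \<in> range (\<lambda>k. - 1 - int k)" if "m < 0"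
      by (rule image_eqI[of _ _ "nat (- 1 - m)"]) (use that in auto)
    then show "sgn a * of_bool (if 0 < a then 0 \<le> m else m < 0) * exp (- a * of_int m) = 0"
      using m a by auto
  qed (auto simp: inj_def)
qed

text \<open>Unconditional summability of a real family is absolute, which is what the product
  theorem over \<open>PiE\<close> asks of each factor.\<close>

lemma has_sum_prod_int_functions:
  fixes g :: "'n::finite \<Rightarrow> int \<Rightarrow> real"
  assumes "\<And>i. (g i has_sum S i) UNIV"
  shows "((\<lambda>m. \<Prod>i\<in>UNIV. g i (m i)) has_sum (\<Prod>i\<in>UNIV. S i)) UNIV"
proof -
  have abs: "Infinite_Set_Sum.abs_summable_on (g i) UNIV" for i
    using assms[of i] unfolding abs_summable_equivalent[symmetric]
    by (metis has_sum_imp_summable summable_on_iff_abs_summable_on_real)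
  have "Infinite_Set_Sum.abs_summable_on (\<lambda>m. \<Prod>i\<in>UNIV. g i (m i)) (PiE UNIV (\<lambda>_. UNIV))"
    using abs by (intro abs_summable_on_prod_PiE) auto
  then have "(\<lambda>m. \<Prod>i\<in>UNIV. g i (m i)) summable_on UNIV"
    unfolding abs_summable_equivalent[symmetric] by (simp add: abs_summable_summable)
  moreover have "infsum (\<lambda>m. \<Prod>i\<in>UNIV. g i (m i)) (PiE UNIV (\<lambda>_. UNIV)) = (\<Prod>i\<in>UNIV. infsum (g i) UNIV)"
    using abs unfolding abs_summable_equivalent[symmetric] by (intro infsum_prod_PiE_abs) auto
  moreover have "infsum (g i) UNIV = S i" for i using assms by (rule infsumI)
  ultimately show ?thesis by (simp add: has_sum_iff)
qed

text \<open>The box of remainders is half-open on the side that matches the half-open cones: a cone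
  contains its \<open>i\<close>-th facet according to the sign of the \<open>i\<close>-th coordinate \<open>c\<close> of \<open>e\<^sub>n\<close>.\<close>

definition half_open_box :: "real \<Rightarrow> nat \<Rightarrow> rat set" where
  "half_open_box c N = (if c > 0 then {0..<of_nat N} else {0<..of_nat N})"

lemma half_open_box_cover:
  assumes "N > 0"
  shows "\<exists>m::int. s - of_nat N * of_int m \<in> half_open_box c N"
proof (cases "c > 0")
  case True
  obtain m :: int where "of_int m \<le> s / of_nat N" "s / of_nat N < of_int m + 1"
    by (rule that[of "\<lfloor>s / of_nat N\<rfloor>"]) linarith+
  then have "of_int m * of_nat N \<le> s" "s < (of_int m + 1) * of_nat N"
    using assms by (simp_all add: pos_le_divide_eq pos_divide_less_eq)
  then show ?thesis using True
    by (intro exI[of _ m]) (simp add: half_open_box_def algebra_simps)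
next
  case False
  obtain m :: int where "of_int m - 1 < s / of_nat N" "s / of_nat N \<le> of_int m"
    by (rule that[of "\<lceil>s / of_nat N\<rceil>"]) linarith+
  then have "(of_int m - 1) * of_nat N < s" "s \<le> of_int m * of_nat N"
    using assms by (simp_all add: pos_less_divide_eq pos_divide_le_eq)
  then show ?thesis using False
    \<comment> \<open>Here the interval is open at 0 and closed at \<open>N\<close>, so the quotient
      is the ceiling minus one instead of the floor.\<close>
    by (intro exI[of _ "m - 1"]) (simp add: half_open_box_def algebra_simps)
qed

lemma half_open_box_unique:
  assumes "r \<in> half_open_box c N" "r' \<in> half_open_box c N"
    and "r + of_nat N * of_int m = r' + of_nat N * of_int m'"
  shows "r = r' \<and> m = m'"
proof -
  have N: "N > 0" using assms(1) by (cases N) (auto simp: half_open_box_def split: if_splits)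
  have "\<bar>r - r'\<bar> < of_nat N" using assms(1,2) by (auto simp: half_open_box_def split: if_splits)
  also have "r - r' = of_nat N * of_int (m' - m)" using assms(3) by (simp add: algebra_simps)
  finally have "of_nat N * \<bar>of_int (m' - m)\<bar> < (of_nat N * 1 :: rat)" by (simp add: abs_mult)
  then have "\<bar>of_int (m' - m)\<bar> < (1::rat)" using N by (subst (asm) mult_less_cancel_left_pos) auto
  then have "m = m'" by linarith
  then show ?thesis using assms(3) by simp
qed

text \<open>For \<open>c > 0\<close> the box is \<open>[0, N)\<close>, so \<open>m \<ge> 0\<close>
  means \<open>s \<ge> 0\<close>, and the point \<open>s = 0\<close> is counted when
  \<open>a > 0\<close>. For \<open>c < 0\<close> the box is \<open>(0, N]\<close>, so
  \<open>m \<ge> 0\<close> means \<open>s > 0\<close>, and \<open>s = 0\<close> is counted when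
  \<open>a < 0\<close>. Both cases give a condition on \<open>m\<close> alone.\<close>

lemma half_open_box_sign_condition:
  assumes "r \<in> half_open_box c N" and "a \<noteq> 0" and "c \<noteq> 0"
  shows "(0 < sgn a * real_of_rat (r + of_nat N * of_int m) \<or>
      r + of_nat N * of_int m = 0 \<and> 0 < sgn a * c) \<longleftrightarrow> (if a > 0 then m \<ge> 0 else m < 0)"
proof -
  define s where "s = r + of_nat N * of_int m"
  have sgn: "sgn a * real_of_rat s > 0 \<longleftrightarrow> (if a > 0 then s > 0 else s < 0)"
    using assms(2) by (auto simp: sgn_if)
  have m: "m \<ge> 0 \<Longrightarrow> of_nat N * (of_int m :: rat) \<ge> 0"
    "m < 0 \<Longrightarrow> of_nat N * (of_int m :: rat) \<le> - of_nat N"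
  proof -
    show "m \<ge> 0 \<Longrightarrow> of_nat N * (of_int m :: rat) \<ge> 0" by simp
    assume "m < 0"
    then have "of_nat N * (of_int m :: rat) \<le> of_nat N * (- 1)"
      by (intro mult_left_mono) (auto simp: of_int_le_iff[of m "-1", simplified, symmetric] simp del: of_int_le_iff)
    then show "of_nat N * (of_int m :: rat) \<le> - of_nat N" by simp
  qed
  have box: "c > 0 \<Longrightarrow> 0 \<le> r \<and> r < of_nat N" "c < 0 \<Longrightarrow> 0 < r \<and> r \<le> of_nat N"
    using assms(1) by (auto simp: half_open_box_def split: if_splits)
  have s: "c > 0 \<Longrightarrow> m \<ge> 0 \<Longrightarrow> s \<ge> 0" "c > 0 \<Longrightarrow> m < 0 \<Longrightarrow> s < 0"
    "c < 0 \<Longrightarrow> m \<ge> 0 \<Longrightarrow> s > 0" "c < 0 \<Longrightarrow> m < 0 \<Longrightarrow> s \<le> 0"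
    using m box unfolding s_def by linarith+
  have "c > 0 \<or> c < 0" "m \<ge> 0 \<or> m < 0" using assms(3) by auto
  then show ?thesis unfolding s_def[symmetric] sgn
    using s assms(2) by (elim disjE) (force simp: zero_less_mult_iff sgn_if)+
qed

section \<open>Periodic functions supported on a fractional ideal\<close>

locale lattice_function = real_embeddings \<tau>
  for \<tau> :: "'n::{finite,linorder} \<Rightarrow> 'f::field_char_0 \<Rightarrow> real" +
  fixes \<phi> :: "'f \<Rightarrow> complex" and \<aa> \<bb> :: "'f set"
  assumes period_ideal: "fractional_ideal \<aa>" and support_ideal: "fractional_ideal \<bb>"
    and periodic: "\<And>\<alpha> a. a \<in> \<aa> \<Longrightarrow> \<phi> (\<alpha> + a) = \<phi> \<alpha>"
    and support: "\<And>\<alpha>. \<alpha> \<notin> \<bb> \<Longrightarrow> \<phi> \<alpha> = 0"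
begin

text \<open>\<open>N\<close> puts every \<open>N * f i\<close> into the period ideal, and
  \<open>D\<close> bounds the denominators on the support, so the box holds finitely many candidates
  for residues. The signs \<open>c\<close> stay free, to be matched with the facets of a
  cone.\<close>

lemma periodic_decomposition:
  fixes f :: "'n \<Rightarrow> 'f"
  assumes f: "rat_basis f"
  shows "\<exists>(R::'f set) N. finite R \<and> N > 0 \<and> (\<forall>\<rho>\<in>R. \<forall>i. coord f \<rho> i \<in> half_open_box (c i) N) \<and>
    (\<forall>\<alpha> m. \<phi> (\<alpha> + lincomb f (\<lambda>i. of_nat N * of_int (m i))) = \<phi> \<alpha>) \<and>
    (\<forall>\<alpha>. \<phi> \<alpha> \<noteq> 0 \<longrightarrow> (\<exists>\<rho>\<in>R. \<exists>m. \<alpha> = \<rho> + lincomb f (\<lambda>i. of_nat N * of_int (m i))))"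
proof -
  obtain N :: nat where N: "N > 0" "\<And>i. of_nat N * f i \<in> \<aa>"
    using fractional_ideal_multiple[OF period_ideal] by blast
  obtain D :: nat where D: "D > 0" "\<And>\<beta> i. \<beta> \<in> \<bb> \<Longrightarrow> of_nat D * coord f \<beta> i \<in> \<int>"
    using fractional_ideal_bounded_denominators[OF support_ideal f] by blast
  define R where "R = {\<rho>. \<forall>i. of_nat D * coord f \<rho> i \<in> \<int> \<and> coord f \<rho> i \<in> half_open_box (c i) N}"
  have "R \<subseteq> lincomb f ` (PiE UNIV (\<lambda>_. (\<lambda>k. of_int k / of_nat D) ` {0..int (D * N)}))"
  proof
    fix \<rho> assume \<rho>: "\<rho> \<in> R"
    have "coord f \<rho> i \<in> (\<lambda>k. of_int k / of_nat D) ` {0..int (D * N)}" for i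
    proof -
      obtain k where k: "of_nat D * coord f \<rho> i = of_int k" using \<rho> by (auto simp: R_def elim: Ints_cases)
      have "0 \<le> coord f \<rho> i" "coord f \<rho> i \<le> of_nat N"
        using \<rho> by (auto simp: R_def half_open_box_def less_imp_le split: if_splits dest!: spec[of _ i])
      then have "(0::rat) \<le> of_int k" "of_int k \<le> (of_nat D * of_nat N :: rat)"
        unfolding k[symmetric] by (auto intro: mult_left_mono)
      then have "0 \<le> k" "k \<le> int (D * N)"
        by (simp, metis of_int_le_iff of_int_of_nat_eq of_nat_mult)
      moreover have "coord f \<rho> i = of_int k / of_nat D" using k D(1) by (simp add: field_simps)
      ultimately show ?thesis by auto
    qed
    then have "coord f \<rho> \<in> PiE UNIV (\<lambda>_. (\<lambda>k. of_int k / of_nat D) ` {0..int (D * N)})"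
      by (simp add: PiE_UNIV_domain)
    then show "\<rho> \<in> lincomb f ` (PiE UNIV (\<lambda>_. (\<lambda>k. of_int k / of_nat D) ` {0..int (D * N)}))"
      using lincomb_coord[OF f, of \<rho>] by (metis image_eqI)
  qed
  then have "finite R" by (rule finite_subset) (intro finite_imageI finite_PiE; simp)
  moreover have "\<phi> (\<alpha> + lincomb f (\<lambda>i. of_nat N * of_int (m i))) = \<phi> \<alpha>" for \<alpha> m
  proof (rule periodic)
    have "lincomb f (\<lambda>i. of_nat N * of_int (m i)) = (\<Sum>i\<in>UNIV. of_int (m i) * (of_nat N * f i))"
      by (simp add: lincomb_def of_rat_mult mult_ac del: rat_vs.scale_scale)
    then show "lincomb f (\<lambda>i. of_nat N * of_int (m i)) \<in> \<aa>"
      using period_ideal N(2) by (auto intro: fractional_ideal_sum fractional_ideal_of_int)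
  qed
  moreover have "\<exists>\<rho>\<in>R. \<exists>m. \<alpha> = \<rho> + lincomb f (\<lambda>i. of_nat N * of_int (m i))" if "\<phi> \<alpha> \<noteq> 0" for \<alpha>
  proof -
    have \<alpha>: "of_nat D * coord f \<alpha> i \<in> \<int>" for i using that support D(2) by blast
    have "\<forall>i. \<exists>m::int. coord f \<alpha> i - of_nat N * of_int m \<in> half_open_box (c i) N"
      using half_open_box_cover[OF N(1)] by blast
    then obtain m :: "'n \<Rightarrow> int" where m: "\<And>i. coord f \<alpha> i - of_nat N * of_int (m i) \<in> half_open_box (c i) N"
      by metis
    define \<rho> where "\<rho> = lincomb f (\<lambda>i. coord f \<alpha> i - of_nat N * of_int (m i))"
    have "of_nat D * (coord f \<alpha> i - of_nat N * of_int (m i)) \<in> \<int>" for i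
    proof -
      have "of_nat D * coord f \<alpha> i - of_int (int D * int N * m i) \<in> \<int>" by (intro Ints_diff \<alpha> Ints_of_int)
      then show ?thesis by (simp add: algebra_simps)
    qed
    then have "\<rho> \<in> R" using m by (simp add: R_def \<rho>_def coord_lincomb[OF f])
    moreover have "\<alpha> = \<rho> + lincomb f (\<lambda>i. of_nat N * of_int (m i))"
      by (simp add: \<rho>_def lincomb_coord[OF f] flip: lincomb_add)
    ultimately show ?thesis by blast
  qed
  ultimately show ?thesis using N(1)
    by (intro exI[of _ R] exI[of _ N]) (auto simp: R_def)
qed

lemma bounded_values: "\<exists>C. \<forall>\<alpha>. norm (\<phi> \<alpha>) \<le> C"
proof -
  obtain f :: "'n \<Rightarrow> 'f" where f: "rat_basis f" using exists_rat_basis by blast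
  obtain R N where R: "finite R" and per: "\<And>\<alpha> m. \<phi> (\<alpha> + lincomb f (\<lambda>i. of_nat N * of_int (m i))) = \<phi> \<alpha>"
    and dec: "\<And>\<alpha>. \<phi> \<alpha> \<noteq> 0 \<Longrightarrow> \<exists>\<rho>\<in>R. \<exists>m. \<alpha> = \<rho> + lincomb f (\<lambda>i. of_nat N * of_int (m i))"
    using periodic_decomposition[OF f] by metis
  have "norm (\<phi> \<alpha>) \<le> (\<Sum>\<rho>\<in>R. norm (\<phi> \<rho>))" for \<alpha>
  proof (cases "\<phi> \<alpha> = 0")
    case False
    then obtain \<rho> where "\<rho> \<in> R" "\<phi> \<alpha> = \<phi> \<rho>" using dec per by metis
    then show ?thesis using R member_le_sum[of \<rho> R "\<lambda>\<rho>. norm (\<phi> \<rho>)"] by simp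
  qed (simp add: sum_nonneg)
  then show ?thesis by blast
qed

text \<open>\<open>R\<close> and \<open>N\<close> are chosen before \<open>y\<close>: one rational
  expression serves all chambers. The signs of the pairings in \<open>basis_sign\<close> are
  absorbed by the one-dimensional signed series, and only the sign of the determinant is
  left.\<close>

lemma cone_series:
  fixes f :: "'n \<Rightarrow> 'f"
  assumes f: "rat_basis f"
  shows "\<exists>(R::'f set) N. finite R \<and> N > 0 \<and> (\<forall>y. (\<forall>i. Tr (emb \<tau> (f i) * y) \<noteq> 0) \<longrightarrow>
    ((\<lambda>\<alpha>. \<phi> \<alpha> * of_real (chi (\<lambda>i. emb \<tau> (f i)) (emb \<tau> \<alpha>) y) * qpow \<tau> \<alpha> y) has_sum
      (\<Sum>\<rho>\<in>R. of_real (sgn (det (emb_matrix f))) * \<phi> \<rho> *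
        (qpow \<tau> \<rho> y * (\<Prod>i\<in>UNIV. 1 / (1 - qpow \<tau> (of_nat N * f i) y))))) UNIV)"
proof -
  obtain c where c0: "\<And>i. c i \<noteq> 0" and c: "axis nth_index 1 = (\<Sum>i\<in>UNIV. c i *\<^sub>R emb \<tau> (f i))"
    using axis_coordinates[OF f] by blast
  obtain R N where R: "finite R" "N > 0" and box: "\<And>\<rho> i. \<rho> \<in> R \<Longrightarrow> coord f \<rho> i \<in> half_open_box (c i) N"
    and per: "\<And>\<alpha> m. \<phi> (\<alpha> + lincomb f (\<lambda>i. of_nat N * of_int (m i))) = \<phi> \<alpha>"
    and dec: "\<And>\<alpha>. \<phi> \<alpha> \<noteq> 0 \<Longrightarrow> \<exists>\<rho>\<in>R. \<exists>m. \<alpha> = \<rho> + lincomb f (\<lambda>i. of_nat N * of_int (m i))"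
    using periodic_decomposition[OF f, of c] by metis
  define L where "L m = lincomb f (\<lambda>i. of_nat N * of_int (m i))" for m :: "'n \<Rightarrow> int"
  have coord_L: "coord f (\<rho> + L m) i = coord f \<rho> i + of_nat N * of_int (m i)" for \<rho> m i
    by (simp add: L_def coord_add[OF f] coord_lincomb[OF f])
  have unique: "\<rho> = \<rho>' \<and> m = m'" if "\<rho> \<in> R" "\<rho>' \<in> R" "\<rho> + L m = \<rho>' + L m'" for \<rho> \<rho>' m m'
  proof -
    have "coord f \<rho> i = coord f \<rho>' i \<and> m i = m' i" for i
      using half_open_box_unique[OF box[OF that(1), of i] box[OF that(2), of i], of "m i" "m' i"]
        coord_L that(3) by metis
    then have "coord f \<rho> = coord f \<rho>'" "m = m'" by auto
    then show ?thesis using lincomb_coord[OF f] by metis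
  qed
  have "((\<lambda>\<alpha>. \<phi> \<alpha> * of_real (chi (\<lambda>i. emb \<tau> (f i)) (emb \<tau> \<alpha>) y) * qpow \<tau> \<alpha> y) has_sum
      (\<Sum>\<rho>\<in>R. of_real (sgn (det (emb_matrix f))) * \<phi> \<rho> *
        (qpow \<tau> \<rho> y * (\<Prod>i\<in>UNIV. 1 / (1 - qpow \<tau> (of_nat N * f i) y))))) UNIV"
    (is "(?g has_sum _) UNIV")
    if y: "\<And>i. Tr (emb \<tau> (f i) * y) \<noteq> 0" for y
  proof -
    define a where "a i = Tr (emb \<tau> (f i) * y)" for i
    \<comment> \<open>The rate is \<open>real N * a i\<close> because within one residue class the
      series runs over multiples of \<open>N * f i\<close>.\<close>
    define h where "h i m = sgn (real N * a i) * of_bool (if real N * a i > 0 then m \<ge> 0 else m < 0) *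
        exp (- (real N * a i) * of_int m)" for i and m :: int
    have qN: "qpow \<tau> (of_nat N * f i) y = of_real (exp (- (real N * a i)))" for i
    proof -
      have "Tr (emb \<tau> (of_nat N * f i) * y) = real N * a i"
        by (simp add: a_def Tr_def emb_def tau_mult sum_distrib_left mult.assoc)
      then show ?thesis by (simp add: qpow_def)
    qed
    have h: "((\<lambda>m. \<Prod>i\<in>UNIV. h i (m i)) has_sum (\<Prod>i\<in>UNIV. 1 / (1 - exp (- (real N * a i))))) UNIV"
      unfolding h_def using y R(2)
      by (intro has_sum_prod_int_functions has_sum_signed_geometric) (simp add: a_def)
    have summand: "?g (\<rho> + L m) = of_real (sgn (det (emb_matrix f))) * \<phi> \<rho> * qpow \<tau> \<rho> y *
        of_real (\<Prod>i\<in>UNIV. h i (m i))" if "\<rho> \<in> R" for \<rho> m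
    proof -
      have "Tr (emb \<tau> (\<rho> + L m) * y) = Tr (emb \<tau> \<rho> * y) + (\<Sum>i\<in>UNIV. real N * a i * of_int (m i))"
        unfolding Tr_emb_lincomb[OF f, of "\<rho> + L m"] Tr_emb_lincomb[OF f, of \<rho>] coord_L a_def[symmetric]
        by (simp add: of_rat_add of_rat_mult distrib_right distrib_left sum.distrib mult_ac del: rat_vs.scale_scale)
      then have q: "qpow \<tau> (\<rho> + L m) y = qpow \<tau> \<rho> y * of_real (\<Prod>i\<in>UNIV. exp (- (real N * a i) * of_int (m i)))"
        by (simp add: qpow_def exp_sum[symmetric] sum_negf flip: exp_add of_real_mult)
      have phi_L: "\<phi> (\<rho> + L m) = \<phi> \<rho>" unfolding L_def by (rule per)
      have cond: "(0 < sgn (a i) * of_rat (coord f (\<rho> + L m) i) \<or> coord f (\<rho> + L m) i = 0 \<and> 0 < sgn (a i) * c i)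
          \<longleftrightarrow> (if real N * a i > 0 then m i \<ge> 0 else m i < 0)" for i
      proof -
        have "a i \<noteq> 0" "real N * a i > 0 \<longleftrightarrow> a i > 0"
          using R(2) y[of i] by (simp_all add: a_def zero_less_mult_iff)
        then show ?thesis
          using half_open_box_sign_condition[OF box[OF that, of i] _ c0[of i], of "a i" "m i"] unfolding coord_L by simp
      qed
      have "chi (\<lambda>i. emb \<tau> (f i)) (emb \<tau> (\<rho> + L m)) y = sgn (det (emb_matrix f)) * (\<Prod>i\<in>UNIV. sgn (a i)) *
          of_bool (\<forall>i. if real N * a i > 0 then m i \<ge> 0 else m i < 0)"
        unfolding chi_emb[OF f c y] a_def[symmetric] cond by (simp add: basis_sign_def emb_matrix_def a_def)
      also have "of_bool (\<forall>i. if real N * a i > 0 then m i \<ge> 0 else m i < 0) =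
          (\<Prod>i\<in>UNIV. of_bool (if real N * a i > 0 then m i \<ge> 0 else m i < 0) :: real)"
        by (rule of_bool_all)
      also have "(\<Prod>i\<in>UNIV. sgn (a i)) = (\<Prod>i\<in>UNIV. sgn (real N * a i))"
        using R(2) by (simp add: sgn_mult)
      finally show ?thesis
        unfolding q phi_L by (simp add: h_def prod.distrib mult_ac)
    qed
    have "(?g has_sum (of_real (sgn (det (emb_matrix f))) * \<phi> \<rho> *
        (qpow \<tau> \<rho> y * (\<Prod>i\<in>UNIV. 1 / (1 - qpow \<tau> (of_nat N * f i) y))))) (range (\<lambda>m. \<rho> + L m))"
      if \<rho>: "\<rho> \<in> R" for \<rho>
    proof -
      have "inj (\<lambda>m. \<rho> + L m)" using unique[OF \<rho> \<rho>] by (auto intro: injI)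
      moreover have "((\<lambda>m. ?g (\<rho> + L m)) has_sum (of_real (sgn (det (emb_matrix f))) * \<phi> \<rho> * qpow \<tau> \<rho> y *
          of_real (\<Prod>i\<in>UNIV. 1 / (1 - exp (- (real N * a i)))))) UNIV"
        unfolding summand[OF \<rho>] by (intro has_sum_cmult_right has_sum_of_real h)
      moreover have "of_real (\<Prod>i\<in>UNIV. 1 / (1 - exp (- (real N * a i)))) =
          (\<Prod>i\<in>UNIV. 1 / (1 - qpow \<tau> (of_nat N * f i) y))"
        by (simp add: qN)
      ultimately show ?thesis
        by (subst has_sum_reindex) (simp_all add: o_def mult.assoc)
    qed
    then have "(?g has_sum (\<Sum>\<rho>\<in>R. of_real (sgn (det (emb_matrix f))) * \<phi> \<rho> *
        (qpow \<tau> \<rho> y * (\<Prod>i\<in>UNIV. 1 / (1 - qpow \<tau> (of_nat N * f i) y))))) (\<Union>\<rho>\<in>R. range (\<lambda>m. \<rho> + L m))"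
      using R(1) unique by (intro sum_has_sum) auto
    also have "?this \<longleftrightarrow> (?g has_sum (\<Sum>\<rho>\<in>R. of_real (sgn (det (emb_matrix f))) * \<phi> \<rho> *
        (qpow \<tau> \<rho> y * (\<Prod>i\<in>UNIV. 1 / (1 - qpow \<tau> (of_nat N * f i) y))))) UNIV"
    proof (rule has_sum_cong_neutral)
      fix \<alpha> assume "\<alpha> \<in> UNIV - (\<Union>\<rho>\<in>R. range (\<lambda>m. \<rho> + L m))"
      then have "\<phi> \<alpha> = 0" using dec[of \<alpha>] unfolding L_def by blast
      then show "?g \<alpha> = 0" by simp
    qed auto
    finally show ?thesis .
  qed
  then show ?thesis using R by blast
qed

end

section \<open>Lower bounds for linear forms at translates by units\<close>

text \<open>The two half-lines are the signed geometric series at \<open>c\<close> and, with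
  reversed sign, at \<open>- c\<close>.\<close>

lemma summable_on_exp_abs_int:
  fixes c :: real
  assumes "c > 0"
  shows "(\<lambda>m::int. exp (- c * \<bar>of_int m\<bar>)) summable_on UNIV"
proof -
  have 1: "(\<lambda>m::int. sgn c * of_bool (if c > 0 then m \<ge> 0 else m < 0) * exp (- c * of_int m)) summable_on UNIV"
    using has_sum_signed_geometric[of c] assms by (auto intro: has_sum_imp_summable)
  have "(\<lambda>m::int. sgn (-c) * of_bool (if - c > 0 then m \<ge> 0 else m < 0) * exp (- (-c) * of_int m)) summable_on UNIV"
    by (rule has_sum_imp_summable[OF has_sum_signed_geometric]) (use assms in simp)
  then have 2: "(\<lambda>m::int. - (sgn (-c) * of_bool (if - c > 0 then m \<ge> 0 else m < 0) * exp (- (-c) * of_int m))) summable_on UNIV"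
    by (rule summable_on_uminus[THEN iffD2])
  have "exp (- c * \<bar>of_int m\<bar>) = sgn c * of_bool (if c > 0 then m \<ge> 0 else m < 0) * exp (- c * of_int m) +
      - (sgn (-c) * of_bool (if - c > 0 then m \<ge> 0 else m < 0) * exp (- (-c) * of_int m))" for m :: int
    using assms by (auto simp: abs_if)
  then show ?thesis using summable_on_add[OF 1 2] by simp
qed

text \<open>The constant \<open>b\<close> leaves room for the loss when real logarithms are rounded
  to integers.\<close>

lemma summable_on_prod_exp_abs:
  fixes c b :: real
  assumes "c > 0"
  shows "(\<lambda>m. \<Prod>i\<in>(UNIV::'n::finite set). exp (b - c * \<bar>of_int (m i)\<bar>)) summable_on UNIV"
proof -
  have "(\<lambda>m::int. exp b * exp (- c * \<bar>of_int m\<bar>)) summable_on UNIV"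
    by (intro summable_on_cmult_right summable_on_exp_abs_int assms)
  also have "(\<lambda>m::int. exp b * exp (- c * \<bar>of_int m\<bar>)) = (\<lambda>m. exp (b - c * \<bar>of_int m\<bar>))"
    by (simp add: fun_eq_iff flip: exp_add)
  finally obtain S where "((\<lambda>m::int. exp (b - c * \<bar>of_int m\<bar>)) has_sum S) UNIV"
    by (auto simp: summable_on_def)
  then have "((\<lambda>m. \<Prod>i\<in>(UNIV::'n set). exp (b - c * \<bar>of_int (m i)\<bar>)) has_sum (\<Prod>i\<in>(UNIV::'n set). S)) UNIV"
    by (rule has_sum_prod_int_functions)
  then show ?thesis by (rule has_sum_imp_summable)
qed

text \<open>Translating the slab along the \<open>j\<close>-th axis in steps of \<open>3\<delta> / \<bar>w\<^sub>j\<bar>\<close> gives disjoint copies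
  of it in a slightly larger cube.\<close>

lemma measure_slab_le:
  fixes w :: "real ^ 'n" and R \<delta> :: real
  assumes w: "w $ j \<noteq> 0" and \<delta>: "\<delta> > 0"
  defines "S \<equiv> {y \<in> cbox (\<chi> i. - R) (\<chi> i. R). \<bar>Tr (w * y)\<bar> \<le> \<delta>}"
    and "Q \<equiv> cbox (\<chi> i. - R - 1) (\<chi> i. R + 1) :: (real ^ 'n) set"
  shows "S \<in> lmeasurable" and "measure lebesgue S \<le> 6 * \<delta> / \<bar>w $ j\<bar> * measure lebesgue Q"
proof -
  have "continuous_on UNIV (\<lambda>y. \<bar>Tr (w * y)\<bar>)"
    unfolding Tr_def by (simp add: continuous_intros)
  then have "closed {y. \<bar>Tr (w * y)\<bar> \<le> \<delta>}"
    by (rule closed_Collect_le) (rule continuous_on_const)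
  then have "compact (cbox (\<chi> i. - R) (\<chi> i. R) \<inter> {y. \<bar>Tr (w * y)\<bar> \<le> \<delta>})"
    by (intro compact_Int_closed) auto
  moreover have "S = cbox (\<chi> i. - R) (\<chi> i. R) \<inter> {y. \<bar>Tr (w * y)\<bar> \<le> \<delta>}" by (auto simp: S_def)
  ultimately have "compact S" by simp
  then show S: "S \<in> lmeasurable" by (rule lmeasurable_compact)
  define h where "h = 3 * \<delta> / \<bar>w $ j\<bar>"
  have h: "h > 0" using w \<delta> by (simp add: h_def)
  define M where "M = measure lebesgue Q"
  have M: "M \<ge> 0" by (simp add: M_def)
  have Q: "Q \<in> lmeasurable" by (simp add: Q_def)
  have S_sub: "S \<subseteq> Q"
  proof
    fix y assume "y \<in> S"
    then have "- R \<le> y $ i \<and> y $ i \<le> R" for i by (simp add: S_def mem_box_cart)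
    then have "- R - 1 \<le> y $ i \<and> y $ i \<le> R + 1" for i by (smt (verit))
    then show "y \<in> Q" by (simp add: Q_def mem_box_cart)
  qed
  have "measure lebesgue S \<le> 2 * h * M"
  proof (cases "h \<ge> 1")
    case True
    have "measure lebesgue S \<le> M"
      unfolding M_def using S Q S_sub by (intro measure_mono_fmeasurable) (auto intro: fmeasurableD)
    also have "\<dots> = 1 * M" by simp
    also have "\<dots> \<le> 2 * h * M" using M True by (intro mult_right_mono) auto
    finally show ?thesis .
  next
    case False
    \<comment> \<open>\<open>K\<close> is the number of steps of length \<open>h\<close> that fit
      into the margin 1 of the larger cube. Since \<open>1 / h > 1\<close>, rounding down loses at
      most a factor 2; with the 3 in \<open>h\<close> this makes the constant 6.\<close>
    define K where "K = nat \<lfloor>1 / h\<rfloor>"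
    define T where "T k = (+) (axis j (real k * h)) ` S" for k
    have Kh: "real K * h \<le> 1"
    proof -
      have "real K \<le> 1 / h" using h by (simp add: K_def)
      then show ?thesis using h by (simp add: field_simps)
    qed
    have K: "real K \<ge> 1 / (2 * h)"
    proof -
      have h1: "1 / h \<ge> 1" using False h by simp
      then have "\<lfloor>1 / h\<rfloor> \<ge> 1" by linarith
      then have "int K = \<lfloor>1 / h\<rfloor>" "K \<ge> 1" unfolding K_def by linarith+
      then have "real K = of_int \<lfloor>1 / h\<rfloor>" "real K \<ge> 1" by (metis of_int_of_nat_eq, simp)
      then have "real K \<ge> 1 / h - 1 \<and> real K \<ge> 1" by linarith
      moreover have "1 / (2 * h) = (1 / h) / 2" by simp
      ultimately show ?thesis by linarith
    qed
    have Tr_shift: "Tr (w * (axis j a + y)) = w $ j * a + Tr (w * y)" for a y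
    proof -
      have "Tr (w * (axis j a + y)) = (\<Sum>i\<in>UNIV. (if i = j then w $ j * a else 0) + w $ i * y $ i)"
        unfolding Tr_def by (rule sum.cong) (auto simp: axis_def algebra_simps)
      then show ?thesis by (simp add: sum.distrib Tr_def)
    qed
    have disj: "disjoint_family_on T {..<K}"
      unfolding disjoint_family_on_def
    proof (intro ballI impI, rule ccontr)
      fix k l assume kl: "k \<noteq> l" "T k \<inter> T l \<noteq> {}"
      then obtain x y where xy: "x \<in> S" "y \<in> S" "axis j (real k * h) + x = axis j (real l * h) + y"
        by (auto simp: T_def)
      then have "w $ j * (real k * h) + Tr (w * x) = w $ j * (real l * h) + Tr (w * y)"
        by (metis Tr_shift)
      then have eq: "w $ j * h * (real k - real l) = Tr (w * y) - Tr (w * x)"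
        by (simp add: algebra_simps)
      \<comment> \<open>Distinct translates shift the linear form by at least
        \<open>3 * \<delta>\<close>, whereas its values on the slab differ by at most
        \<open>2 * \<delta>\<close>.\<close>
      have "\<bar>w $ j * h * (real k - real l)\<bar> = 3 * \<delta> * \<bar>real k - real l\<bar>"
        using w \<delta> by (simp add: h_def abs_mult)
      moreover have "\<bar>real k - real l\<bar> \<ge> 1" using kl(1) by linarith
      then have "3 * \<delta> * \<bar>real k - real l\<bar> \<ge> 3 * \<delta>" using \<delta> by simp
      moreover have "\<bar>Tr (w * y) - Tr (w * x)\<bar> \<le> 2 * \<delta>" using xy(1,2) by (auto simp: S_def)
      ultimately show False using eq \<delta> by simp
    qed
    have sub: "T k \<subseteq> Q" if k: "k < K" for k
    proof
      fix z assume "z \<in> T k"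
      then obtain y where y: "y \<in> S" "z = axis j (real k * h) + y" by (auto simp: T_def)
      have "real k * h \<le> real K * h" using k h by (intro mult_right_mono) auto
      then have "real k * h \<le> 1" using Kh by (rule order_trans)
      moreover have "0 \<le> real k * h" using h by simp
      ultimately have shift: "0 \<le> axis j (real k * h) $ i \<and> axis j (real k * h) $ i \<le> 1" for i
        by (auto simp: axis_def)
      have "- R \<le> y $ i \<and> y $ i \<le> R" for i using y(1) by (auto simp: S_def mem_box_cart)
      then have "- R - 1 \<le> z $ i \<and> z $ i \<le> R + 1" for i
        using shift[of i] unfolding y(2) vector_add_component by (smt (verit))
      then show "z \<in> Q" by (simp add: Q_def mem_box_cart)
    qed
    have T: "T k \<in> lmeasurable" for k unfolding T_def using S by (rule measurable_translation)
    have "real K * measure lebesgue S = (\<Sum>k<K. measure lebesgue (T k))"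
      by (simp add: T_def measure_translation)
    also have "\<dots> = measure lebesgue (\<Union>k<K. T k)"
      using fmeasurableD[OF T] fmeasurableD2[OF T] disj
      by (intro measure_finite_Union[symmetric]) (auto simp del: emeasure_completion)
    also have "\<dots> \<le> M"
      unfolding M_def using sub T Q by (intro measure_mono_fmeasurable) (auto intro: fmeasurableD)
    finally have "real K * measure lebesgue S \<le> M" .
    moreover have "1 / (2 * h) * measure lebesgue S \<le> real K * measure lebesgue S"
      using K by (intro mult_right_mono) auto
    ultimately have "1 / (2 * h) * measure lebesgue S \<le> M" by linarith
    then show ?thesis using h by (simp add: field_simps)
  qed
  then show "measure lebesgue S \<le> 6 * \<delta> / \<bar>w $ j\<bar> * measure lebesgue Q"
    by (simp add: h_def M_def)
qed

text \<open>A Borel-Cantelli argument with a free constant: within a cube, the set where some form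
  is at most \<open>\<epsilon> * d v\<close> has measure at most \<epsilon> times a convergent sum.
  Points that are bad for every \<open>\<epsilon> = 1 / (m + 1)\<close> form a null set, and
  countably many cubes exhaust the space.\<close>

lemma AE_linear_forms_bounded_below:
  fixes W :: "'a \<Rightarrow> real ^ 'n" and d L :: "'a \<Rightarrow> real"
  assumes V: "countable V" and pos: "\<And>v. v \<in> V \<Longrightarrow> d v > 0" "\<And>v. v \<in> V \<Longrightarrow> L v > 0"
    and W: "\<And>v. v \<in> V \<Longrightarrow> \<exists>j. \<bar>W v $ j\<bar> \<ge> L v"
    and summable: "(\<lambda>v. d v / L v) summable_on V"
  shows "AE y in lebesgue. \<exists>c>0. \<forall>v\<in>V. \<bar>Tr (W v * y)\<bar> \<ge> c * d v"
proof -
  define S where "S R \<epsilon> v = {y \<in> cbox (\<chi> i. - R) (\<chi> i. R). \<bar>Tr (W v * y)\<bar> \<le> \<epsilon> * d v}" for R \<epsilon> v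
  define Q where "Q R = measure lebesgue (cbox (\<chi> i. - R - 1) (\<chi> i. R + 1) :: (real ^ 'n) set)" for R
  define X where "X R = (\<Inter>m. \<Union>v\<in>V. S R (1 / real (Suc m)) v)" for R
  have S: "S R \<epsilon> v \<in> lmeasurable" "measure lebesgue (S R \<epsilon> v) \<le> \<epsilon> * (6 * Q R) * (d v / L v)"
    if v: "v \<in> V" and \<epsilon>: "\<epsilon> > 0" for R \<epsilon> v
  proof -
    obtain j where j: "\<bar>W v $ j\<bar> \<ge> L v" using W[OF v] by blast
    then have j0: "W v $ j \<noteq> 0" using pos(2)[OF v] by auto
    have ed: "\<epsilon> * d v > 0" using pos(1)[OF v] \<epsilon> by simp
    show "S R \<epsilon> v \<in> lmeasurable" unfolding S_def by (rule measure_slab_le(1)[OF j0 ed])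
    have "measure lebesgue (S R \<epsilon> v) \<le> 6 * (\<epsilon> * d v) / \<bar>W v $ j\<bar> * Q R"
      unfolding S_def Q_def by (rule measure_slab_le(2)[OF j0 ed])
    also have "\<dots> \<le> 6 * (\<epsilon> * d v) / L v * Q R"
      using j ed pos(2)[OF v] by (intro mult_right_mono divide_left_mono) (auto simp: Q_def)
    also have "\<dots> = \<epsilon> * (6 * Q R) * (d v / L v)" by simp
    finally show "measure lebesgue (S R \<epsilon> v) \<le> \<epsilon> * (6 * Q R) * (d v / L v)" .
  qed
  define N where "N = to_nat_on V ` V"
  have inj: "inj_on (to_nat_on V) V" using V by (rule inj_on_to_nat_on)
  have inv: "from_nat_into V (to_nat_on V v) = v" if "v \<in> V" for v
    using V that by (rule from_nat_into_to_nat_on)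
  define g where "g n = (if n \<in> N then d (from_nat_into V n) / L (from_nat_into V n) else 0)" for n
  have g0: "g n \<ge> 0" for n using pos inv by (auto simp: g_def N_def intro!: divide_nonneg_pos less_imp_le)
  have "summable g"
  proof -
    have "(\<lambda>v. g (to_nat_on V v)) summable_on V"
      using summable by (rule summable_on_cong[THEN iffD1, rotated]) (simp add: g_def N_def inv)
    then have "g summable_on N"
      unfolding N_def using summable_on_reindex[OF inj, of g] by (simp add: o_def)
    then have "g summable_on UNIV"
      by (rule summable_on_cong_neutral[THEN iffD1, rotated -1]) (auto simp: g_def)
    then show ?thesis using g0 summable_on_UNIV_nonneg_real_iff by blast
  qed
  have null: "X R \<in> null_sets lebesgue" for R
  proof -
    have U: "(\<Union>v\<in>V. S R \<epsilon> v) \<in> sets lebesgue" if "\<epsilon> > 0" for \<epsilon>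
      using V S(1)[OF _ that] by (intro sets.countable_UN') (auto intro: fmeasurableD)
    have bound: "emeasure lebesgue (\<Union>v\<in>V. S R \<epsilon> v) \<le> ennreal (\<epsilon> * (6 * Q R * suminf g))" if \<epsilon>: "\<epsilon> > 0" for \<epsilon>
    proof -
      define A where "A n = (if n \<in> N then S R \<epsilon> (from_nat_into V n) else {})" for n
      have "(\<Union>v\<in>V. S R \<epsilon> v) = (\<Union>n. A n)"
        by (auto simp: A_def N_def inv split: if_splits)
      moreover have "emeasure lebesgue (\<Union>n. A n) \<le> suminf (\<lambda>n. emeasure lebesgue (A n))"
        using S(1)[OF _ \<epsilon>] inv by (intro emeasure_subadditive_countably) (auto simp: A_def N_def intro: fmeasurableD)
      moreover have "suminf (\<lambda>n. emeasure lebesgue (A n)) \<le> suminf (\<lambda>n. ennreal (\<epsilon> * (6 * Q R) * g n))"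
      proof (rule suminf_le)
        fix n
        show "emeasure lebesgue (A n) \<le> ennreal (\<epsilon> * (6 * Q R) * g n)"
        proof (cases "n \<in> N")
          case True
          then have v: "from_nat_into V n \<in> V" using inv by (auto simp: N_def)
          show ?thesis
            using S[OF v \<epsilon>, of R] True by (simp add: A_def g_def emeasure_eq_measure2 ennreal_leI)
        qed (simp add: A_def)
      qed auto
      moreover have "suminf (\<lambda>n. ennreal (\<epsilon> * (6 * Q R) * g n)) = ennreal (\<epsilon> * (6 * Q R) * suminf g)"
        using \<epsilon> g0 \<open>summable g\<close>
        by (subst suminf_ennreal2) (auto simp: Q_def suminf_mult intro: summable_mult)
      ultimately show ?thesis by (simp add: mult_ac)
    qed
    have "X R \<in> sets lebesgue" unfolding X_def using U by (intro sets.countable_INT) auto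
    moreover have "emeasure lebesgue (X R) = 0"
    proof -
      have "emeasure lebesgue (X R) \<le> ennreal (1 / real (Suc m) * (6 * Q R * suminf g))" for m
        by (rule order_trans[OF emeasure_mono bound]) (auto simp: X_def U)
      moreover have "(\<lambda>m. ennreal (1 / real (Suc m) * (6 * Q R * suminf g))) \<longlonglongrightarrow> ennreal 0"
        using LIMSEQ_inverse_real_of_nat
        by (intro tendsto_ennrealI tendsto_mult_left_zero) (simp add: inverse_eq_divide)
      ultimately have "emeasure lebesgue (X R) \<le> ennreal 0"
        by (intro LIMSEQ_le_const) auto
      then show ?thesis by simp
    qed
    ultimately show ?thesis by auto
  qed
  have "AE y in lebesgue. \<forall>r::nat. y \<notin> X (real r)"
    using null by (simp add: AE_all_countable AE_not_in)
  then show ?thesis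
  proof eventually_elim
    case (elim y)
    obtain r :: nat where r: "norm y \<le> real r" using real_arch_simple by blast
    have "y \<in> cbox (\<chi> i. - real r) (\<chi> i. real r)"
    proof -
      have "\<bar>y $ i\<bar> \<le> real r" for i using component_le_norm_cart[of y i] r by linarith
      then show ?thesis by (simp add: mem_box_cart abs_le_iff minus_le_iff)
    qed
    moreover obtain m where m: "\<And>v. v \<in> V \<Longrightarrow> y \<notin> S (real r) (1 / real (Suc m)) v"
      using elim unfolding X_def by blast
    ultimately have "\<bar>Tr (W v * y)\<bar> \<ge> 1 / real (Suc m) * d v" if "v \<in> V" for v
      using m[OF that] unfolding S_def by (simp add: not_le less_imp_le)
    then show ?case by (intro exI[of _ "1 / real (Suc m)"]) auto
  qed
qed

section \<open>Units on the logarithmic scale\<close>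

context real_embeddings
begin

text \<open>The l1-norm of the logarithmic embedding.\<close>

definition log_size :: "'f \<Rightarrow> real" where
  "log_size v = (\<Sum>i\<in>UNIV. \<bar>ln \<bar>\<tau> i v\<bar>\<bar>)"

lemma log_size_nonneg: "log_size v \<ge> 0"
  by (simp add: log_size_def sum_nonneg)

lemma countable_field: "countable (A :: 'f set)"
proof -
  obtain f :: "'n \<Rightarrow> 'f" where f: "rat_basis f" using exists_rat_basis by blast
  have "A \<subseteq> range (lincomb f)" using bij_is_surj[OF bij_lincomb[OF f]] by simp
  then show ?thesis by (rule countable_subset) (intro countable_image countableI_type)
qed

text \<open>Multiplication by a fixed nonzero element of \<open>I\<close> carries algebraic integers
  into \<open>I\<close>, where discreteness is available.\<close>

lemma finite_bounded_units:
  fixes I :: "'f set"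
  assumes I: "fractional_ideal I"
  shows "finite {u. algebraic_int u \<and> u \<noteq> 0 \<and> (\<forall>i. \<bar>ln \<bar>\<tau> i u\<bar>\<bar> \<le> 1)}" (is "finite ?U")
proof -
  obtain b where b: "b \<in> I" "b \<noteq> 0" using fractional_idealD(4)[OF I] by blast
  define R where "R = exp 1 * (\<Sum>j\<in>UNIV. \<bar>\<tau> j b\<bar>)"
  have "(\<lambda>u. u * b) ` ?U \<subseteq> {\<beta>\<in>I. \<forall>i. \<bar>\<tau> i \<beta>\<bar> \<le> R}"
  proof
    fix \<beta> assume "\<beta> \<in> (\<lambda>u. u * b) ` ?U"
    then obtain u where u: "\<beta> = u * b" "algebraic_int u" "u \<noteq> 0" "\<And>i. \<bar>ln \<bar>\<tau> i u\<bar>\<bar> \<le> 1" by auto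
    have "\<bar>\<tau> i \<beta>\<bar> \<le> R" for i
    proof -
      have "\<bar>\<tau> i u\<bar> = exp (ln \<bar>\<tau> i u\<bar>)" using u(3) by simp
      also have "\<dots> \<le> exp 1" using u(4)[of i] by (simp add: abs_le_iff)
      finally have "\<bar>\<tau> i u\<bar> \<le> exp 1" .
      moreover have "\<bar>\<tau> i b\<bar> \<le> (\<Sum>j\<in>UNIV. \<bar>\<tau> j b\<bar>)" by (intro member_le_sum) auto
      ultimately show ?thesis by (simp add: u(1) tau_mult abs_mult R_def mult_mono)
    qed
    moreover have "\<beta> \<in> I" unfolding u(1) using I u(2) b(1) by (rule fractional_idealD(3))
    ultimately show "\<beta> \<in> {\<beta>\<in>I. \<forall>i. \<bar>\<tau> i \<beta>\<bar> \<le> R}" by simp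
  qed
  then have "finite ((\<lambda>u. u * b) ` ?U)"
    using fractional_ideal_discrete[OF I] by (rule finite_subset)
  then show ?thesis by (rule finite_imageD) (use b(2) in \<open>auto simp: inj_on_def\<close>)
qed

text \<open>Round the logarithms down. Units with equal integer parts have quotients in the finite
  set \<open>Z\<close>, so every fibre has at most \<open>card Z\<close> elements, and the sum is
  dominated by a product series over all integer vectors. Rounding costs a factor
  \<open>exp c\<close> per coordinate.\<close>

lemma summable_on_exp_log_size:
  fixes I :: "'f set"
  assumes I: "fractional_ideal I" and V: "V \<subseteq> carrier unit_group"
    and div: "\<And>v w. v \<in> V \<Longrightarrow> w \<in> V \<Longrightarrow> v * inverse w \<in> V" and c: "c > 0"
  shows "(\<lambda>v. exp (- c * log_size v)) summable_on V"
proof (rule nonneg_bdd_above_summable_on)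
  define Z where "Z = {u. algebraic_int u \<and> u \<noteq> 0 \<and> (\<forall>i. \<bar>ln \<bar>\<tau> i u\<bar>\<bar> \<le> 1)}"
  have Z: "finite Z" unfolding Z_def using I by (rule finite_bounded_units)
  define h where "h v = (\<lambda>i. \<lfloor>ln \<bar>\<tau> i v\<bar>\<rfloor>)" for v
  define G where "G k = (\<Prod>i\<in>(UNIV::'n set). exp (c - c * \<bar>of_int (k i)\<bar>))" for k :: "'n \<Rightarrow> int"
  have G: "G summable_on UNIV" unfolding G_def by (rule summable_on_prod_exp_abs[OF c])
  have G0: "G k \<ge> 0" for k by (simp add: G_def prod_nonneg)
  have le_G: "exp (- c * log_size v) \<le> G (h v)" for v
  proof -
    have "- c * \<bar>ln \<bar>\<tau> i v\<bar>\<bar> \<le> c - c * \<bar>of_int (h v i)\<bar>" for i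
    proof -
      have "\<bar>of_int (h v i)\<bar> - 1 \<le> \<bar>ln \<bar>\<tau> i v\<bar>\<bar>" unfolding h_def by linarith
      then have "c * (\<bar>of_int (h v i)\<bar> - 1) \<le> c * \<bar>ln \<bar>\<tau> i v\<bar>\<bar>" using c by simp
      then show ?thesis by (simp add: algebra_simps)
    qed
    then have "(\<Sum>i\<in>UNIV. - c * \<bar>ln \<bar>\<tau> i v\<bar>\<bar>) \<le> (\<Sum>i\<in>UNIV. c - c * \<bar>of_int (h v i)\<bar>)"
      by (intro sum_mono)
    then show ?thesis unfolding G_def log_size_def by (simp add: exp_sum[symmetric] sum_distrib_left)
  qed
  have fibre: "card {v\<in>A. h v = k} \<le> card Z" if A: "A \<subseteq> V" for A k
  proof (cases "{v\<in>A. h v = k} = {}")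
    case False
    then obtain w where w: "w \<in> A" "h w = k" by auto
    then have w0: "w \<noteq> 0" using A V unit_group_carrierD(2) by blast
    have "(\<lambda>v. v * inverse w) ` {v\<in>A. h v = k} \<subseteq> Z"
    proof
      fix u assume "u \<in> (\<lambda>v. v * inverse w) ` {v\<in>A. h v = k}"
      then obtain v where v: "v \<in> A" "h v = k" "u = v * inverse w" by auto
      have v0: "v \<noteq> 0" using v(1) A V unit_group_carrierD(2) by blast
      have "u \<in> carrier unit_group" using v w A V div by blast
      moreover have "\<bar>ln \<bar>\<tau> i u\<bar>\<bar> \<le> 1" for i
      proof -
        have "ln \<bar>\<tau> i u\<bar> = ln \<bar>\<tau> i v\<bar> - ln \<bar>\<tau> i w\<bar>"
          using v0 w0 by (simp add: v(3) tau_mult tau_inverse abs_mult ln_mult ln_inverse)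
        moreover have "\<lfloor>ln \<bar>\<tau> i v\<bar>\<rfloor> = \<lfloor>ln \<bar>\<tau> i w\<bar>\<rfloor>" using v(2) w(2) by (metis h_def)
        ultimately show ?thesis by linarith
      qed
      ultimately show "u \<in> Z" using unit_group_carrierD by (auto simp: Z_def)
    qed
    then show ?thesis
      using Z w0 by (intro card_inj_on_le[of "\<lambda>v. v * inverse w"]) (auto simp: inj_on_def)
  next
    case True
    then show ?thesis by (simp only: card.empty)
  qed
  show "bdd_above (sum (\<lambda>v. exp (- c * log_size v)) ` {F. F \<subseteq> V \<and> finite F})"
  proof (rule bdd_aboveI2)
    fix A assume "A \<in> {F. F \<subseteq> V \<and> finite F}"
    then have A: "A \<subseteq> V" "finite A" by auto
    have "(\<Sum>v\<in>A. exp (- c * log_size v)) \<le> (\<Sum>v\<in>A. G (h v))" by (intro sum_mono le_G)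
    also have "\<dots> = (\<Sum>k\<in>h ` A. \<Sum>v\<in>{v\<in>A. h v = k}. G (h v))" using A(2) by (rule sum.image_gen)
    also have "\<dots> = (\<Sum>k\<in>h ` A. real (card {v\<in>A. h v = k}) * G k)" by (intro sum.cong) auto
    also have "\<dots> \<le> (\<Sum>k\<in>h ` A. real (card Z) * G k)"
      using fibre[OF A(1)] G0 by (intro sum_mono mult_right_mono) auto
    also have "\<dots> = real (card Z) * (\<Sum>k\<in>h ` A. G k)" by (simp add: sum_distrib_left)
    also have "\<dots> \<le> real (card Z) * infsum G UNIV"
      using A(2) G G0 by (intro mult_left_mono finite_sum_le_infsum) auto
    finally show "(\<Sum>v\<in>A. exp (- c * log_size v)) \<le> real (card Z) * infsum G UNIV" .
  qed
qed simp

text \<open>Norm 1 makes the logarithms sum to zero, so their positive parts sum to half of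
  \<open>log_size v\<close>, and the largest of the \<open>n\<close> is at least the
  average.\<close>

lemma unit_large_embedding:
  assumes "v \<in> carrier unit_group"
  shows "\<exists>j. \<bar>\<tau> j v\<bar> \<ge> exp (log_size v / (2 * CARD('n)))"
proof -
  have v0: "v \<noteq> 0" using assms by (rule unit_group_carrierD)
  define x where "x i = ln \<bar>\<tau> i v\<bar>" for i
  have "(\<Sum>i\<in>UNIV. x i) = ln (\<Prod>i\<in>UNIV. \<bar>\<tau> i v\<bar>)"
    using v0 by (simp add: x_def ln_prod)
  also have "(\<Prod>i\<in>UNIV. \<bar>\<tau> i v\<bar>) = \<bar>Nm (emb \<tau> v)\<bar>" by (simp add: Nm_def emb_def abs_prod)
  finally have sum0: "(\<Sum>i\<in>UNIV. x i) = 0" using abs_Nm_emb_unit[OF assms] by simp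
  have fin: "finite (range x)" by simp
  then obtain j where j: "x j = Max (range x)" using Max_in[OF fin] by (metis UNIV_I image_iff empty_not_UNIV image_is_empty)
  have max: "x i \<le> x j" for i unfolding j using fin by (rule Max_ge) simp
  have "(\<Sum>i\<in>UNIV. x i) \<le> (\<Sum>i\<in>(UNIV::'n set). x j)" by (intro sum_mono max)
  then have "x j \<ge> 0" unfolding sum0 by (simp add: zero_le_mult_iff)
  then have "\<bar>x i\<bar> + x i \<le> 2 * x j" for i using max[of i] by linarith
  then have "(\<Sum>i\<in>UNIV. \<bar>x i\<bar> + x i) \<le> (\<Sum>i\<in>(UNIV::'n set). 2 * x j)" by (intro sum_mono)
  moreover have "log_size v = (\<Sum>i\<in>UNIV. \<bar>x i\<bar>)" by (simp add: log_size_def x_def)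
  ultimately have "log_size v \<le> real CARD('n) * (2 * x j)"
    by (simp add: sum.distrib sum0)
  then have "log_size v / (2 * CARD('n)) \<le> x j" by (simp add: field_simps)
  then have "exp (log_size v / (2 * CARD('n))) \<le> exp (x j)" by simp
  also have "exp (x j) = \<bar>\<tau> j v\<bar>" using v0 by (simp add: x_def)
  finally show ?thesis by blast
qed

text \<open>The index of the large coordinate of \<open>v\<close> varies with \<open>v\<close>,
  hence the minimum \<mu> over all embeddings of \<open>f\<close>. The threshold exponent is half of
  the guaranteed one, so the quotient of threshold and size decays in
  \<open>log_size v\<close>.\<close>

lemma AE_Tr_unit_translates:
  fixes I :: "'f set"
  assumes I: "fractional_ideal I" and V: "V \<subseteq> carrier unit_group"
    and div: "\<And>v w. v \<in> V \<Longrightarrow> w \<in> V \<Longrightarrow> v * inverse w \<in> V" and f: "f \<noteq> 0"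
  shows "AE y in lebesgue. \<exists>c>0. \<forall>v\<in>V.
    \<bar>Tr (emb \<tau> f * (emb \<tau> v * y))\<bar> \<ge> c * exp (log_size v / (4 * CARD('n)))"
proof -
  define n where "n = real CARD('n)"
  have n: "n > 0" by (simp add: n_def)
  define \<mu> where "\<mu> = Min (range (\<lambda>i. \<bar>\<tau> i f\<bar>))"
  have fin: "finite (range (\<lambda>i. \<bar>\<tau> i f\<bar>))" by simp
  have \<mu>: "\<mu> > 0" unfolding \<mu>_def using f by (subst Min_gr_iff) auto
  have \<mu>_le: "\<mu> \<le> \<bar>\<tau> i f\<bar>" for i unfolding \<mu>_def using fin by (rule Min_le) simp
  have "AE y in lebesgue. \<exists>c>0. \<forall>v\<in>V. \<bar>Tr (emb \<tau> (f * v) * y)\<bar> \<ge> c * exp (log_size v / (4 * n))"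
  proof (rule AE_linear_forms_bounded_below[where L = "\<lambda>v. \<mu> * exp (log_size v / (2 * n))"])
    show "countable V" by (rule countable_field)
    fix v assume v: "v \<in> V"
    show "exp (log_size v / (4 * n)) > 0" "\<mu> * exp (log_size v / (2 * n)) > 0" using \<mu> by auto
    obtain j where "\<bar>\<tau> j v\<bar> \<ge> exp (log_size v / (2 * n))"
      using unit_large_embedding[OF subsetD[OF V v]] unfolding n_def by auto
    then show "\<exists>j. \<bar>emb \<tau> (f * v) $ j\<bar> \<ge> \<mu> * exp (log_size v / (2 * n))"
      using \<mu> \<mu>_le by (intro exI[of _ j]) (auto simp: emb_def tau_mult abs_mult intro!: mult_mono)
  next
    have "(\<lambda>v. (1 / \<mu>) * exp (- (1 / (4 * n)) * log_size v)) summable_on V"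
      using n by (intro summable_on_cmult_right summable_on_exp_log_size[OF I V div]) auto
    also have "(\<lambda>v. (1 / \<mu>) * exp (- (1 / (4 * n)) * log_size v)) =
        (\<lambda>v. exp (log_size v / (4 * n)) / (\<mu> * exp (log_size v / (2 * n))))"
    proof
      fix v
      have "exp (log_size v / (4 * n)) / exp (log_size v / (2 * n)) = exp (- (1 / (4 * n)) * log_size v)"
        using n by (simp add: field_simps flip: exp_diff)
      then have "exp (- (1 / (4 * n)) * log_size v) = exp (log_size v / (4 * n)) / exp (log_size v / (2 * n))" ..
      then show "(1 / \<mu>) * exp (- (1 / (4 * n)) * log_size v) =
          exp (log_size v / (4 * n)) / (\<mu> * exp (log_size v / (2 * n)))"
        by (simp only: times_divide_times_eq mult_1)
    qed
    finally show "(\<lambda>v. exp (log_size v / (4 * n)) / (\<mu> * exp (log_size v / (2 * n)))) summable_on V" .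
  qed
  then show ?thesis by (simp add: emb_mult n_def mult.assoc)
qed

end

section \<open>Summation over the units\<close>

lemma has_sum_sum_finite:
  fixes f :: "'a \<Rightarrow> 'b \<Rightarrow> 'c :: topological_comm_monoid_add"
  assumes "finite A" and "\<And>a. a \<in> A \<Longrightarrow> (f a has_sum s a) X"
  shows "((\<lambda>x. \<Sum>a\<in>A. f a x) has_sum (\<Sum>a\<in>A. s a)) X"
  using assms by (induction A rule: finite_induct) (auto intro: has_sum_add)

lemma mean_le: "(a + b) / 2 \<le> t" if "a \<le> t" "b \<le> t" for a b t :: real
  using add_mono[OF that] by simp

lemma abs_basis_sign_le_1: "\<bar>basis_sign B y\<bar> \<le> 1"
  by (auto simp: basis_sign_def abs_mult abs_prod sgn_if intro!: mult_le_one prod_le_1)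

lemma unit_group_subgroupD:
  assumes V: "subgroup V (unit_group :: 'f::field_char_0 monoid)"
  shows "V \<subseteq> carrier unit_group" and "v \<in> V \<Longrightarrow> w \<in> V \<Longrightarrow> v * inverse w \<in> V"
proof -
  show sub: "V \<subseteq> carrier unit_group" using V by (rule subgroup.subset)
  have mult: "x \<otimes>\<^bsub>unit_group\<^esub> y = x * y" "\<one>\<^bsub>unit_group\<^esub> = (1::'f)" for x y :: 'f
    by (simp_all add: unit_group_def units_of_def integer_ring_def)
  assume vw: "v \<in> V" "w \<in> V"
  have w: "w \<in> carrier unit_group" using sub vw by blast
  note w' = unit_group_carrierD[OF w]
  have "inverse w \<in> carrier unit_group"
    using w' by (auto simp: unit_group_def units_of_def Units_def integer_ring_def intro!: bexI[of _ w])
  then have "m_inv unit_group w = inverse w"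
    unfolding m_inv_def mult using w'(2)
    by (intro the_equality) (auto simp: inverse_unique mult.commute dest: inverse_unique)
  moreover have "m_inv unit_group w \<in> V" using V vw(2) by (rule subgroup.m_inv_closed)
  ultimately show "v * inverse w \<in> V"
    using subgroup.m_closed[OF V vw(1)] by (metis mult(1))
qed

section \<open>The generating function and its sum over the units\<close>

context lattice_function
begin

text \<open>Coefficients must lie in an integer span, so the sign of each determinant is rewritten
  as an integer. The inverse factors are admissible because regular points avoid their
  poles.\<close>

lemma generating_function:
  assumes keys: "\<And>B. B \<in> Poly_Mapping.keys \<B> \<Longrightarrow> rat_basis B"
  shows "\<exists>F \<in> q_combinations (int_mod.span (range \<phi>)) \<tau> (regular_points \<tau> \<B>).
    \<forall>y\<in>regular_points \<tau> \<B>. ((\<lambda>\<alpha>. \<phi> \<alpha> * of_real (chi_comb \<tau> \<B> 1 (emb \<tau> \<alpha>) y) * qpow \<tau> \<alpha> y) has_sum F y) UNIV"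
proof -
  define ser where "ser B R N \<longleftrightarrow> finite R \<and> N > 0 \<and> (\<forall>y. (\<forall>i. Tr (emb \<tau> (B i) * y) \<noteq> 0) \<longrightarrow>
    ((\<lambda>\<alpha>. \<phi> \<alpha> * of_real (chi (\<lambda>i. emb \<tau> (B i)) (emb \<tau> \<alpha>) y) * qpow \<tau> \<alpha> y) has_sum
      (\<Sum>\<rho>\<in>R. of_real (sgn (det (emb_matrix B))) * \<phi> \<rho> *
        (qpow \<tau> \<rho> y * (\<Prod>i\<in>UNIV. 1 / (1 - qpow \<tau> (of_nat N * B i) y))))) UNIV)" for B R and N :: nat
  have "\<forall>B\<in>Poly_Mapping.keys \<B>. \<exists>R N. ser B R N"
    using cone_series keys unfolding ser_def by blast
  then obtain R N where ser: "\<And>B. B \<in> Poly_Mapping.keys \<B> \<Longrightarrow> ser B (R B) (N B)" by metis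
  define K where "K = Poly_Mapping.keys \<B>"
  define coef where "coef B \<rho> = of_int (Poly_Mapping.lookup \<B> B) * (of_real (sgn (det (emb_matrix B))) * \<phi> \<rho>)" for B \<rho>
  define mono where "mono B \<rho> y = qpow \<tau> \<rho> y * (\<Prod>i\<in>UNIV. 1 / (1 - qpow \<tau> (of_nat (N B) * B i) y))" for B \<rho> y
  define F where "F y = (\<Sum>(B, \<rho>)\<in>Sigma K R. coef B \<rho> * mono B \<rho> y)" for y
  have fin: "finite K" "\<And>B. B \<in> K \<Longrightarrow> finite (R B)"
    using ser by (auto simp: K_def ser_def)
  have "(\<lambda>y. \<Sum>p\<in>Sigma K R. coef (fst p) (snd p) * mono (fst p) (snd p) y)
      \<in> q_combinations (int_mod.span (range \<phi>)) \<tau> (regular_points \<tau> \<B>)"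
  proof (rule q_combinations_sum)
    show "finite (Sigma K R)" using fin by auto
    fix p assume "p \<in> Sigma K R"
    then obtain B \<rho> where p: "p = (B, \<rho>)" and B: "B \<in> Poly_Mapping.keys \<B>" by (auto simp: K_def)
    have N: "N B > 0" using ser[OF B] by (simp add: ser_def)
    have B0: "B i \<noteq> 0" for i
      using coord_basis[OF keys[OF B], of i i] coord_zero[OF keys[OF B], of i] by auto
    show "mono (fst p) (snd p) \<in> q_monomials \<tau> (regular_points \<tau> \<B>)"
      unfolding p fst_conv snd_conv mono_def
    proof (rule q_monomials_prod[OF _ _ _ qpow_in_q_monomials])
      show "of_nat (N B) * B i \<noteq> 0" for i using N B0 by simp
      fix i y assume y: "y \<in> regular_points \<tau> \<B>"
      have "Tr (emb \<tau> (of_nat (N B) * B i) * y) = real (N B) * Tr (emb \<tau> (B i) * y)"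
        by (simp add: Tr_def emb_def tau_mult sum_distrib_left mult.assoc)
      also have "\<dots> \<noteq> 0" using y N B by (auto simp: regular_points_def)
      finally show "qpow \<tau> (of_nat (N B) * B i) y \<noteq> 1" by (simp add: qpow_def)
    qed simp
    define s where "s = (if det (emb_matrix B) > 0 then 1 else if det (emb_matrix B) = 0 then 0 else - 1 :: int)"
    have "of_real (sgn (det (emb_matrix B))) = (of_int s :: complex)" by (simp add: s_def sgn_if)
    then have "coef (fst p) (snd p) = of_int (Poly_Mapping.lookup \<B> B) * (of_int s * \<phi> \<rho>)"
      by (simp add: p coef_def)
    also have "\<dots> \<in> int_mod.span (range \<phi>)"
      by (intro int_mod.span_scale int_mod.span_base) simp
    finally show "coef (fst p) (snd p) \<in> int_mod.span (range \<phi>)" .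
  qed
  moreover have "F = (\<lambda>y. \<Sum>p\<in>Sigma K R. coef (fst p) (snd p) * mono (fst p) (snd p) y)"
    by (simp add: F_def case_prod_unfold fun_eq_iff)
  ultimately have "F \<in> q_combinations (int_mod.span (range \<phi>)) \<tau> (regular_points \<tau> \<B>)"
    by simp
  moreover have "((\<lambda>\<alpha>. \<phi> \<alpha> * of_real (chi_comb \<tau> \<B> 1 (emb \<tau> \<alpha>) y) * qpow \<tau> \<alpha> y) has_sum F y) UNIV"
    if y: "y \<in> regular_points \<tau> \<B>" for y
  proof -
    have "((\<lambda>\<alpha>. \<Sum>B\<in>K. of_int (Poly_Mapping.lookup \<B> B) *
        (\<phi> \<alpha> * of_real (chi (\<lambda>i. emb \<tau> (B i)) (emb \<tau> \<alpha>) y) * qpow \<tau> \<alpha> y)) has_sum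
      (\<Sum>B\<in>K. of_int (Poly_Mapping.lookup \<B> B) * (\<Sum>\<rho>\<in>R B. of_real (sgn (det (emb_matrix B))) * \<phi> \<rho> * mono B \<rho> y))) UNIV"
    proof (intro has_sum_sum_finite fin has_sum_cmult_right)
      fix B assume "B \<in> K"
      then show "((\<lambda>\<alpha>. \<phi> \<alpha> * of_real (chi (\<lambda>i. emb \<tau> (B i)) (emb \<tau> \<alpha>) y) * qpow \<tau> \<alpha> y) has_sum
          (\<Sum>\<rho>\<in>R B. of_real (sgn (det (emb_matrix B))) * \<phi> \<rho> * mono B \<rho> y)) UNIV"
        using ser[of B] y unfolding ser_def mono_def K_def regular_points_def by blast
    qed
    moreover have "(\<Sum>B\<in>K. of_int (Poly_Mapping.lookup \<B> B) * (\<Sum>\<rho>\<in>R B. of_real (sgn (det (emb_matrix B))) * \<phi> \<rho> * mono B \<rho> y)) = F y"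
      unfolding F_def using fin by (subst sum.Sigma[symmetric]) (auto simp: coef_def sum_distrib_left mult.assoc)
    moreover have "(\<Sum>B\<in>K. of_int (Poly_Mapping.lookup \<B> B) *
        (\<phi> \<alpha> * of_real (chi (\<lambda>i. emb \<tau> (B i)) (emb \<tau> \<alpha>) y) * qpow \<tau> \<alpha> y)) =
        \<phi> \<alpha> * of_real (chi_comb \<tau> \<B> 1 (emb \<tau> \<alpha>) y) * qpow \<tau> \<alpha> y" for \<alpha>
      by (simp add: chi_comb_def K_def sum_distrib_left sum_distrib_right mult_ac)
    ultimately show ?thesis by simp
  qed
  ultimately show ?thesis by blast
qed

text \<open>On the support of \<open>chi\<close> all products
  \<open>coord f \<alpha> i * t i\<close> are nonnegative, so the trace is at least
  \<open>c * e v * X \<alpha>\<close>. To dominate by a function of \<open>v\<close> times a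
  function of \<alpha>, this bound is used twice and averaged: once with \<open>e v \<ge> 1\<close>,
  once with \<open>X \<alpha> \<ge> 1 / D\<close>, where \<alpha> \<noteq> 0 and the bounded
  denominators enter.\<close>

lemma summable_on_translated_cone_series:
  fixes f :: "'n \<Rightarrow> 'f"
  assumes f: "rat_basis f" and V: "V \<subseteq> carrier unit_group"
    and div: "\<And>v w. v \<in> V \<Longrightarrow> w \<in> V \<Longrightarrow> v * inverse w \<in> V"
    and y: "\<And>i. \<exists>c>0. \<forall>v\<in>V. \<bar>Tr (emb \<tau> (f i) * (emb \<tau> v * y))\<bar> \<ge> c * exp (log_size v / (4 * CARD('n)))"
  shows "(\<lambda>(v, \<alpha>). norm (\<phi> \<alpha>) * \<bar>chi (\<lambda>i. emb \<tau> (f i)) (emb \<tau> \<alpha>) (emb \<tau> v * y)\<bar> *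
    exp (- Tr (emb \<tau> \<alpha> * (emb \<tau> v * y)))) summable_on (V \<times> (UNIV - {0}))"
proof -
  obtain cs where cs: "\<And>i. cs i > 0"
    "\<And>i v. v \<in> V \<Longrightarrow> \<bar>Tr (emb \<tau> (f i) * (emb \<tau> v * y))\<bar> \<ge> cs i * exp (log_size v / (4 * CARD('n)))"
    using y by metis
  define c where "c = Min (range cs)"
  have fin: "finite (range cs)" by simp
  have c: "c > 0" unfolding c_def using cs(1) by (subst Min_gr_iff) auto
  have c_le: "c \<le> cs i" for i unfolding c_def using fin by (rule Min_le) simp
  define \<kappa> where "\<kappa> = 1 / (4 * real CARD('n))"
  have \<kappa>: "\<kappa> > 0" by (simp add: \<kappa>_def)
  define e where "e v = exp (\<kappa> * log_size v)" for v
  have e1: "e v \<ge> 1" for v using \<kappa> log_size_nonneg[of v] by (simp add: e_def)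
  have Tr_ge: "\<bar>Tr (emb \<tau> (f i) * (emb \<tau> v * y))\<bar> \<ge> c * e v" if "v \<in> V" for i v
  proof -
    have "c * e v \<le> cs i * exp (log_size v / (4 * CARD('n)))"
      unfolding e_def \<kappa>_def using c_le[of i] by (simp add: mult_right_mono)
    then show ?thesis using cs(2)[OF that] by (rule order_trans)
  qed
  obtain D :: nat where D: "D > 0" "\<And>\<beta> i. \<beta> \<in> \<bb> \<Longrightarrow> of_nat D * coord f \<beta> i \<in> \<int>"
    using fractional_ideal_bounded_denominators[OF support_ideal f] by blast
  obtain C where C: "\<And>\<alpha>. norm (\<phi> \<alpha>) \<le> C" using bounded_values by blast
  have C0: "C \<ge> 0" using C[of 0] norm_ge_zero[of "\<phi> 0"] by linarith
  define X where "X \<alpha> = (\<Sum>i\<in>UNIV. \<bar>real_of_rat (coord f \<alpha> i)\<bar>)" for \<alpha>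
  have X_ge: "X \<alpha> \<ge> 1 / real D" if \<alpha>: "\<alpha> \<in> \<bb>" "\<alpha> \<noteq> 0" for \<alpha>
  proof -
    obtain i where i: "coord f \<alpha> i \<noteq> 0"
      using \<alpha>(2) lincomb_coord[OF f, of \<alpha>] lincomb_eq_0_iff[OF f] by metis
    have "\<bar>of_nat D * coord f \<alpha> i\<bar> \<ge> 1"
      using D \<alpha>(1) i by (intro Ints_nonzero_abs_ge1) auto
    then have "(1::rat) / of_nat D \<le> \<bar>coord f \<alpha> i\<bar>" using D(1) by (simp add: abs_mult field_simps)
    then have "real_of_rat (1 / of_nat D) \<le> real_of_rat \<bar>coord f \<alpha> i\<bar>" by (simp only: of_rat_less_eq)
    then have "1 / real D \<le> \<bar>real_of_rat (coord f \<alpha> i)\<bar>" by (simp add: of_rat_divide)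
    also have "\<dots> \<le> X \<alpha>" unfolding X_def by (rule member_le_sum) auto
    finally show ?thesis .
  qed
  define H where "H \<alpha> = exp (- (c / 2) * X \<alpha>)" for \<alpha>
  define E where "E v = C * (2 * real D / c) * exp (- \<kappa> * log_size v)" for v
  have H: "H summable_on \<bb>"
  proof -
    \<comment> \<open>Numerators over the common denominator \<open>D\<close> identify the ideal
      with a set of integer vectors, on which \<open>H\<close> is a product over
      coordinates.\<close>
    define z where "z j = lincomb f (\<lambda>i. of_int (j i) / of_nat D)" for j :: "'n \<Rightarrow> int"
    have "inj z"
    proof (rule injI)
      fix j k assume "z j = z k"
      then have "(\<lambda>i. of_int (j i) / of_nat D :: rat) = (\<lambda>i. of_int (k i) / of_nat D)"
        unfolding z_def using coord_lincomb[OF f] by metis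
      then show "j = k" using D(1) by (simp add: fun_eq_iff)
    qed
    have "(\<lambda>j. \<Prod>i\<in>(UNIV::'n set). exp (0 - (c / (2 * D)) * \<bar>of_int (j i)\<bar>)) summable_on UNIV"
      using c D(1) by (intro summable_on_prod_exp_abs) simp
    also have "(\<lambda>j. \<Prod>i\<in>(UNIV::'n set). exp (0 - (c / (2 * D)) * \<bar>of_int (j i)\<bar>)) = H \<circ> z"
    proof
      fix j
      have "- (c / 2) * X (z j) = (\<Sum>i\<in>UNIV. 0 - (c / (2 * D)) * \<bar>of_int (j i)\<bar>)"
        unfolding X_def z_def coord_lincomb[OF f] sum_distrib_left
        by (rule sum.cong) (simp_all add: of_rat_divide)
      then show "(\<Prod>i\<in>(UNIV::'n set). exp (0 - (c / (2 * D)) * \<bar>of_int (j i)\<bar>)) = (H \<circ> z) j"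
        by (simp only: H_def o_def exp_sum[OF finite_class.finite_UNIV])
    qed
    finally have "H summable_on range z" using summable_on_reindex[OF \<open>inj z\<close>, of H] by (simp only:)
    moreover have "\<bb> \<subseteq> range z"
    proof
      fix \<beta> assume "\<beta> \<in> \<bb>"
      then have "\<forall>i. \<exists>k. of_nat D * coord f \<beta> i = of_int k" using D(2) by (auto simp: Ints_def)
      then obtain j where j: "\<And>i. of_nat D * coord f \<beta> i = of_int (j i)" by metis
      have "coord f \<beta> i = of_int (j i) / of_nat D" for i using j[of i] D(1) by (simp add: field_simps)
      then have "z j = lincomb f (coord f \<beta>)" unfolding z_def by (intro arg_cong[where f = "lincomb f"]) auto
      then show "\<beta> \<in> range z" unfolding lincomb_coord[OF f] by (metis rangeI)
    qed
    ultimately show ?thesis by (rule summable_on_subset)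
  qed
  have E: "E summable_on V"
    unfolding E_def using \<kappa> by (intro summable_on_cmult_right summable_on_exp_log_size[OF support_ideal V div])
  have E0: "E v \<ge> 0" for v using C0 c by (simp add: E_def)
  have EH: "(\<lambda>(v, \<alpha>). E v * H \<alpha>) summable_on (V \<times> (\<bb> - {0}))"
  proof (rule summable_on_SigmaI)
    have H': "H summable_on (\<bb> - {0})" using H by (rule summable_on_subset) auto
    show "((\<lambda>\<alpha>. case (v, \<alpha>) of (v, \<alpha>) \<Rightarrow> E v * H \<alpha>) has_sum E v * infsum H (\<bb> - {0})) (\<bb> - {0})" for v
      using H' by (auto intro: has_sum_cmult_right)
    show "(\<lambda>v. E v * infsum H (\<bb> - {0})) summable_on V" using E by (rule summable_on_cmult_left)
  qed (use E0 in \<open>auto simp: H_def\<close>)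
  let ?T = "\<lambda>(v, \<alpha>). norm (\<phi> \<alpha>) * \<bar>chi (\<lambda>i. emb \<tau> (f i)) (emb \<tau> \<alpha>) (emb \<tau> v * y)\<bar> *
    exp (- Tr (emb \<tau> \<alpha> * (emb \<tau> v * y)))"
  have le: "?T (v, \<alpha>) \<le> E v * H \<alpha>" if v: "v \<in> V" and \<alpha>: "\<alpha> \<in> \<bb>" "\<alpha> \<noteq> 0" for v \<alpha>
  proof (cases "chi (\<lambda>i. emb \<tau> (f i)) (emb \<tau> \<alpha>) (emb \<tau> v * y) = 0")
    case True
    then show ?thesis using E0 by (simp add: H_def)
  next
    case False
    obtain k where k: "axis nth_index 1 = (\<Sum>i\<in>UNIV. k i *\<^sub>R emb \<tau> (f i))"
      using axis_coordinates[OF f] by blast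
    define t where "t i = Tr (emb \<tau> (f i) * (emb \<tau> v * y))" for i
    have t: "\<bar>t i\<bar> \<ge> c * e v" for i unfolding t_def by (rule Tr_ge[OF v])
    have "c * e v > 0" using c by (simp add: e_def)
    then have t0: "t i \<noteq> 0" for i using t[of i] by auto
    have chi: "chi (\<lambda>i. emb \<tau> (f i)) (emb \<tau> \<alpha>) (emb \<tau> v * y) = basis_sign (\<lambda>i. emb \<tau> (f i)) (emb \<tau> v * y) *
        of_bool (\<forall>i. 0 < sgn (t i) * of_rat (coord f \<alpha> i) \<or> coord f \<alpha> i = 0 \<and> 0 < sgn (t i) * k i)"
      unfolding t_def using t0 by (intro chi_emb[OF f k]) (simp add: t_def)
    then have chi1: "\<bar>chi (\<lambda>i. emb \<tau> (f i)) (emb \<tau> \<alpha>) (emb \<tau> v * y)\<bar> \<le> 1"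
      by (simp add: abs_mult abs_basis_sign_le_1)
    have cond: "0 < sgn (t i) * of_rat (coord f \<alpha> i) \<or> coord f \<alpha> i = 0" for i
      using False unfolding chi by (auto split: if_splits)
    have pos: "\<bar>real_of_rat (coord f \<alpha> i)\<bar> * (c * e v) \<le> of_rat (coord f \<alpha> i) * t i" for i
    proof -
      have "of_rat (coord f \<alpha> i) * t i = \<bar>of_rat (coord f \<alpha> i)\<bar> * \<bar>t i\<bar>"
        using cond[of i] by (auto simp: sgn_if abs_if zero_less_mult_iff split: if_splits)
      then show ?thesis using t[of i] by (simp add: mult_left_mono)
    qed
    have "Tr (emb \<tau> \<alpha> * (emb \<tau> v * y)) = (\<Sum>i\<in>UNIV. of_rat (coord f \<alpha> i) * t i)"
      unfolding t_def by (rule Tr_emb_lincomb[OF f])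
    also have "\<dots> \<ge> (\<Sum>i\<in>UNIV. \<bar>real_of_rat (coord f \<alpha> i)\<bar> * (c * e v))"
      by (intro sum_mono pos)
    finally have Tr1: "X \<alpha> * (c * e v) \<le> Tr (emb \<tau> \<alpha> * (emb \<tau> v * y))"
      by (simp only: X_def sum_distrib_right)
    have X0: "X \<alpha> \<ge> 0" by (simp add: X_def sum_nonneg)
    have "X \<alpha> * c \<le> X \<alpha> * (c * e v)"
      using X0 c e1[of v] by (simp add: mult_left_mono)
    moreover have "1 / real D * (c * e v) \<le> X \<alpha> * (c * e v)"
      using X_ge[OF \<alpha>] c by (intro mult_right_mono) (auto simp: e_def)
    moreover have half: "(c / 2) * X \<alpha> + c * e v / (2 * real D) = (X \<alpha> * c + 1 / real D * (c * e v)) / 2"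
      by (simp add: add_divide_distrib mult.commute)
    ultimately have "(c / 2) * X \<alpha> + c * e v / (2 * real D) \<le> Tr (emb \<tau> \<alpha> * (emb \<tau> v * y))"
      using Tr1 unfolding half by (intro mean_le) (auto intro: order_trans)
    then have "exp (- Tr (emb \<tau> \<alpha> * (emb \<tau> v * y))) \<le> H \<alpha> * exp (- (c * e v / (2 * real D)))"
      unfolding H_def by (simp flip: exp_add)
    \<comment> \<open>The estimate \<open>exp (- x) \<le> 1 / x\<close> gives away most of the decay
      in \<open>v\<close> but keeps a negative multiple of \<open>log_size v\<close> in the
      exponent, which is enough.\<close>
    also have "exp (- (c * e v / (2 * real D))) \<le> 2 * real D / c * exp (- \<kappa> * log_size v)"
    proof -
      define x where "x = c * e v / (2 * real D)"
      have x: "x > 0" using c D(1) by (simp add: x_def e_def)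
      have "x \<le> exp x" using exp_ge_add_one_self[of x] by linarith
      then have "exp (- x) \<le> 1 / x" using x by (simp add: exp_minus inverse_eq_divide frac_le)
      also have "1 / x = 2 * real D / c * exp (- \<kappa> * log_size v)"
        by (simp add: x_def e_def exp_minus field_simps)
      finally show ?thesis by (simp add: x_def)
    qed
    finally have exp_le: "exp (- Tr (emb \<tau> \<alpha> * (emb \<tau> v * y))) \<le> H \<alpha> * (2 * real D / c * exp (- \<kappa> * log_size v))"
      by (simp add: H_def)
    have coef: "norm (\<phi> \<alpha>) * \<bar>chi (\<lambda>i. emb \<tau> (f i)) (emb \<tau> \<alpha>) (emb \<tau> v * y)\<bar> \<le> C * 1"
      using C chi1 C0 by (intro mult_mono) auto
    then have "?T (v, \<alpha>) \<le> (C * 1) * (H \<alpha> * (2 * real D / c * exp (- \<kappa> * log_size v)))"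
      using C0 unfolding prod.case by (intro mult_mono[OF coef exp_le]) auto
    then show ?thesis by (simp add: E_def mult_ac)
  qed
  have supp: "\<alpha> \<in> \<bb>" if "\<phi> \<alpha> \<noteq> 0" for \<alpha> using that support by blast
  have "?T summable_on (V \<times> (\<bb> - {0}))"
    using EH by (rule summable_on_comparison_test) (use le in auto)
  also have "?this \<longleftrightarrow> ?T summable_on (V \<times> (UNIV - {0}))"
    by (rule summable_on_cong_neutral) (auto dest: supp)
  finally show ?thesis .
qed

text \<open>\<open>G v \<beta>\<close> is the term of the double series. The substitution
  \<open>\<beta> = v * \<alpha>\<close> explains the weights: \<open>\<psi> v\<close> comes from the
  equivariance of \<phi>, and the norm of \<open>v\<close> is the sign by which translation changes
  the orientation of a basis. The sign of \<open>Nm y\<close> is the \<open>basis_sign\<close> of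
  the standard basis.\<close>

lemma unit_translates_sum:
  assumes keys: "\<And>B. B \<in> Poly_Mapping.keys \<B> \<Longrightarrow> rat_basis B" and V: "V \<subseteq> carrier unit_group"
    and div: "\<And>v w. v \<in> V \<Longrightarrow> w \<in> V \<Longrightarrow> v * inverse w \<in> V"
    and pos: "\<And>v. v \<in> V \<Longrightarrow> \<tau> nth_index v > 0"
    and \<psi>: "\<And>v. v \<in> V \<Longrightarrow> norm (\<psi> v) = 1" "\<And>v \<alpha>. v \<in> V \<Longrightarrow> \<phi> (v * \<alpha>) = \<psi> v * \<phi> \<alpha>"
    and F: "\<And>y. y \<in> regular_points \<tau> \<B> \<Longrightarrow>
      ((\<lambda>\<alpha>. \<phi> \<alpha> * of_real (chi_comb \<tau> \<B> 1 (emb \<tau> \<alpha>) y) * qpow \<tau> \<alpha> y) has_sum F y) UNIV"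
    and unit: "y \<in> unit_vecs"
    and cones: "\<And>x. x \<in> unit_vecs \<Longrightarrow> ((\<lambda>v. chi_comb \<tau> \<B> (emb \<tau> v) x y) has_sum chi (\<lambda>i. axis i 1) x y) V"
    and bound: "\<And>B i. B \<in> Poly_Mapping.keys \<B> \<Longrightarrow>
      \<exists>c>0. \<forall>v\<in>V. \<bar>Tr (emb \<tau> (B i) * (emb \<tau> v * y))\<bar> \<ge> c * exp (log_size v / (4 * CARD('n)))"
  defines "P \<equiv> {\<beta>. \<beta> \<noteq> 0 \<and> emb \<tau> (inverse \<beta>) * y \<in> pos_vecs}"
  shows "(\<lambda>\<beta>. \<phi> \<beta> * qpow \<tau> \<beta> y) summable_on P"
    and "((\<lambda>v. \<psi> v * of_real (Nm (emb \<tau> v)) * (F (emb \<tau> v * y) - \<phi> 0 * of_real (chi_comb \<tau> \<B> 1 0 (emb \<tau> v * y))))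
      has_sum (of_real (sgn (Nm y)) * (\<Sum>\<^sub>\<infinity>\<beta>\<in>P. \<phi> \<beta> * qpow \<tau> \<beta> y))) V"
proof -
  define K where "K = Poly_Mapping.keys \<B>"
  have finK: "finite K" by (simp add: K_def)
  define G where "G v \<beta> = \<phi> \<beta> * of_real (chi_comb \<tau> \<B> (emb \<tau> v) (emb \<tau> \<beta>) y) * qpow \<tau> \<beta> y" for v \<beta>
  define G1 where "G1 v \<alpha> = \<phi> \<alpha> * of_real (chi_comb \<tau> \<B> 1 (emb \<tau> \<alpha>) (emb \<tau> v * y)) * qpow \<tau> \<alpha> (emb \<tau> v * y)" for v \<alpha>
  have v0: "v \<noteq> 0" if "v \<in> V" for v using that V unit_group_carrierD(2) by blast
  have Tr0: "Tr (emb \<tau> (B i) * (emb \<tau> v * y)) \<noteq> 0" if B: "B \<in> K" and v: "v \<in> V" for B i v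
  proof -
    obtain c where c: "c > 0" "\<And>v. v \<in> V \<Longrightarrow> \<bar>Tr (emb \<tau> (B i) * (emb \<tau> v * y))\<bar> \<ge> c * exp (log_size v / (4 * CARD('n)))"
      using bound B unfolding K_def by metis
    then have "c * exp (log_size v / (4 * CARD('n))) > 0" by simp
    then show ?thesis using c(2)[OF v] by auto
  qed
  have regular: "emb \<tau> v * y \<in> regular_points \<tau> \<B>" if "v \<in> V" for v
    using Tr0 that by (auto simp: regular_points_def K_def)
  have G_eq: "G v (v * \<alpha>) = \<psi> v * of_real (Nm (emb \<tau> v)) * G1 v \<alpha>" if v: "v \<in> V" for v \<alpha>
  proof -
    have "\<bar>Nm (emb \<tau> v)\<bar> = 1" using V v by (intro abs_Nm_emb_unit) auto
    then have sgn: "sgn (Nm (emb \<tau> v)) = Nm (emb \<tau> v)" by (auto simp: sgn_if abs_if split: if_splits)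
    have "chi (\<lambda>i. emb \<tau> v * emb \<tau> (B i)) (emb \<tau> (v * \<alpha>)) y =
        Nm (emb \<tau> v) * chi (\<lambda>i. emb \<tau> (B i)) (emb \<tau> \<alpha>) (emb \<tau> v * y)" if "B \<in> K" for B
      using chi_translate[OF _ pos[OF v], of B y \<alpha>] keys[of B] Tr0[OF that v] that sgn by (simp add: K_def)
    then have "chi_comb \<tau> \<B> (emb \<tau> v) (emb \<tau> (v * \<alpha>)) y = Nm (emb \<tau> v) * chi_comb \<tau> \<B> 1 (emb \<tau> \<alpha>) (emb \<tau> v * y)"
      unfolding chi_comb_def K_def[symmetric] sum_distrib_left by (intro sum.cong) (auto simp: mult_ac)
    moreover have "qpow \<tau> (v * \<alpha>) y = qpow \<tau> \<alpha> (emb \<tau> v * y)"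
      by (simp add: qpow_def emb_mult mult_ac)
    ultimately show ?thesis using \<psi>(2)[OF v] by (simp add: G_def G1_def mult_ac)
  qed
  have bij: "bij_betw ((*) v) (UNIV - {0}) (UNIV - {0})" if "v \<in> V" for v
    using v0[OF that] by (intro bij_betwI[of _ _ _ "\<lambda>\<beta>. inverse v * \<beta>"]) (auto simp: mult.assoc[symmetric])
  have inner: "(G v has_sum \<psi> v * of_real (Nm (emb \<tau> v)) *
      (F (emb \<tau> v * y) - \<phi> 0 * of_real (chi_comb \<tau> \<B> 1 0 (emb \<tau> v * y)))) (UNIV - {0})" if v: "v \<in> V" for v
  proof -
    have "(G1 v has_sum F (emb \<tau> v * y)) UNIV" unfolding G1_def by (rule F[OF regular[OF v]])
    moreover have "(G1 v has_sum G1 v 0) {0}" by (simp add: has_sum_finiteI)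
    ultimately have "(G1 v has_sum F (emb \<tau> v * y) - G1 v 0) (UNIV - {0})"
      by (rule has_sum_Diff) auto
    moreover have "G1 v 0 = \<phi> 0 * of_real (chi_comb \<tau> \<B> 1 0 (emb \<tau> v * y))"
      by (simp add: G1_def qpow_def Tr_def)
    ultimately have "((\<lambda>\<alpha>. \<psi> v * of_real (Nm (emb \<tau> v)) * G1 v \<alpha>) has_sum \<psi> v * of_real (Nm (emb \<tau> v)) *
        (F (emb \<tau> v * y) - \<phi> 0 * of_real (chi_comb \<tau> \<B> 1 0 (emb \<tau> v * y)))) (UNIV - {0})"
      by (auto intro: has_sum_cmult_right)
    then show ?thesis
      unfolding G_eq[OF v, symmetric] by (rule has_sum_reindex_bij_betw[OF bij[OF v], THEN iffD1])
  qed
  have "(\<lambda>(v, \<beta>). G v \<beta>) summable_on (V \<times> (UNIV - {0}))"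
  proof -
    \<comment> \<open>The bounds are available in the variables \<open>(v, \<alpha>)\<close>; the
      bijection to \<open>(v, v * \<alpha>)\<close> then carries absolute summability over to the
      pairs \<open>(v, \<beta>)\<close>.\<close>
    let ?T = "\<lambda>B (v, \<alpha>). norm (\<phi> \<alpha>) * \<bar>chi (\<lambda>i. emb \<tau> (B i)) (emb \<tau> \<alpha>) (emb \<tau> v * y)\<bar> *
      exp (- Tr (emb \<tau> \<alpha> * (emb \<tau> v * y)))"
    have "?T B summable_on (V \<times> (UNIV - {0}))" if "B \<in> K" for B
      using that bound keys V div unfolding K_def by (intro summable_on_translated_cone_series) auto
    then have s: "(?T B has_sum infsum (?T B) (V \<times> (UNIV - {0}))) (V \<times> (UNIV - {0}))" if "B \<in> K" for B
      using that by (simp only: has_sum_infsum)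
    have "((\<lambda>p. \<Sum>B\<in>K. \<bar>of_int (Poly_Mapping.lookup \<B> B)\<bar> * ?T B p) has_sum
        (\<Sum>B\<in>K. \<bar>of_int (Poly_Mapping.lookup \<B> B)\<bar> * infsum (?T B) (V \<times> (UNIV - {0})))) (V \<times> (UNIV - {0}))"
      by (intro has_sum_sum_finite finK has_sum_cmult_right s)
    then have dom: "(\<lambda>p. \<Sum>B\<in>K. \<bar>of_int (Poly_Mapping.lookup \<B> B)\<bar> * ?T B p) summable_on (V \<times> (UNIV - {0}))"
      by (rule has_sum_imp_summable)
    have "(\<lambda>(v, \<alpha>). norm (G v (v * \<alpha>))) summable_on (V \<times> (UNIV - {0}))"
    proof (rule summable_on_comparison_test[OF dom])
      fix p assume "p \<in> V \<times> (UNIV - {0::'f})"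
      then obtain v \<alpha> where p: "p = (v, \<alpha>)" and v: "v \<in> V" by auto
      have "\<bar>Nm (emb \<tau> v)\<bar> = 1" using V v by (intro abs_Nm_emb_unit) auto
      then have norm: "norm (G v (v * \<alpha>)) = norm (\<phi> \<alpha>) * \<bar>chi_comb \<tau> \<B> 1 (emb \<tau> \<alpha>) (emb \<tau> v * y)\<bar> *
          exp (- Tr (emb \<tau> \<alpha> * (emb \<tau> v * y)))"
        unfolding G_eq[OF v] G1_def qpow_def using \<psi>(1)[OF v] by (simp add: norm_mult)
      have "\<bar>chi_comb \<tau> \<B> 1 (emb \<tau> \<alpha>) (emb \<tau> v * y)\<bar> \<le>
          (\<Sum>B\<in>K. \<bar>of_int (Poly_Mapping.lookup \<B> B)\<bar> * \<bar>chi (\<lambda>i. emb \<tau> (B i)) (emb \<tau> \<alpha>) (emb \<tau> v * y)\<bar>)"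
        unfolding chi_comb_def K_def[symmetric] by (rule order_trans[OF sum_abs]) (simp add: abs_mult)
      then have "norm (G v (v * \<alpha>)) \<le> norm (\<phi> \<alpha>) *
          (\<Sum>B\<in>K. \<bar>of_int (Poly_Mapping.lookup \<B> B)\<bar> * \<bar>chi (\<lambda>i. emb \<tau> (B i)) (emb \<tau> \<alpha>) (emb \<tau> v * y)\<bar>) *
          exp (- Tr (emb \<tau> \<alpha> * (emb \<tau> v * y)))"
        unfolding norm by (intro mult_right_mono mult_left_mono) auto
      also have "\<dots> = (\<Sum>B\<in>K. \<bar>of_int (Poly_Mapping.lookup \<B> B)\<bar> * ?T B p)"
        unfolding sum_distrib_left sum_distrib_right p prod.case by (intro sum.cong refl) (simp only: mult_ac)
      finally show "(case p of (v, \<alpha>) \<Rightarrow> norm (G v (v * \<alpha>))) \<le> (\<Sum>B\<in>K. \<bar>of_int (Poly_Mapping.lookup \<B> B)\<bar> * ?T B p)"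
        by (simp only: p prod.case)
    qed auto
    then have "(\<lambda>p. G (fst p) (fst p * snd p)) summable_on (V \<times> (UNIV - {0}))"
      unfolding case_prod_unfold by (rule abs_summable_summable)
    moreover have "bij_betw (\<lambda>p. (fst p, fst p * snd p)) (V \<times> (UNIV - {0})) (V \<times> (UNIV - {0}))"
      using v0 by (intro bij_betwI[of _ _ _ "\<lambda>p. (fst p, inverse (fst p) * snd p)"]) (auto simp: mult.assoc[symmetric])
    from summable_on_reindex_bij_betw[OF this, of "\<lambda>(v, \<beta>). G v \<beta>"]
    have "(\<lambda>p. G (fst p) (fst p * snd p)) summable_on (V \<times> (UNIV - {0})) \<longleftrightarrow>
        (\<lambda>(v, \<beta>). G v \<beta>) summable_on (V \<times> (UNIV - {0}))" by simp
    ultimately show ?thesis by simp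
  qed
  then obtain S where S: "((\<lambda>(v, \<beta>). G v \<beta>) has_sum S) (V \<times> (UNIV - {0}))"
    by (auto simp: summable_on_def)
  have sum_V: "((\<lambda>v. \<psi> v * of_real (Nm (emb \<tau> v)) *
      (F (emb \<tau> v * y) - \<phi> 0 * of_real (chi_comb \<tau> \<B> 1 0 (emb \<tau> v * y)))) has_sum S) V"
    by (rule has_sum_SigmaD[OF S]) (use inner in simp)
  have "((\<lambda>(\<beta>, v). G v \<beta>) has_sum S) ((UNIV - {0}) \<times> V)"
    using S by (subst (asm) has_sum_swap) simp
  then have "((\<lambda>\<beta>. \<phi> \<beta> * of_real (chi (\<lambda>i. axis i 1) (emb \<tau> \<beta>) y) * qpow \<tau> \<beta> y) has_sum S) (UNIV - {0})"
  proof (rule has_sum_SigmaD)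
    fix \<beta> :: 'f assume "\<beta> \<in> UNIV - {0}"
    then have "emb \<tau> \<beta> \<in> unit_vecs" by (simp add: emb_unit_vecs)
    from has_sum_of_real[OF cones[OF this]]
    have "((\<lambda>v. \<phi> \<beta> * of_real (chi_comb \<tau> \<B> (emb \<tau> v) (emb \<tau> \<beta>) y) * qpow \<tau> \<beta> y) has_sum
        \<phi> \<beta> * of_real (chi (\<lambda>i. axis i 1) (emb \<tau> \<beta>) y) * qpow \<tau> \<beta> y) V"
      by (intro has_sum_cmult_left has_sum_cmult_right)
    then show "((\<lambda>v. case (\<beta>, v) of (\<beta>, v) \<Rightarrow> G v \<beta>) has_sum
        \<phi> \<beta> * of_real (chi (\<lambda>i. axis i 1) (emb \<tau> \<beta>) y) * qpow \<tau> \<beta> y) V"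
      by (simp add: G_def)
  qed
  also have "?this \<longleftrightarrow> ((\<lambda>\<beta>. of_real (sgn (Nm y)) * (\<phi> \<beta> * qpow \<tau> \<beta> y)) has_sum S) P"
  proof (rule has_sum_cong_neutral)
    have chi: "chi (\<lambda>i. axis i 1) (emb \<tau> \<beta>) y = sgn (Nm y) * of_bool (\<beta> \<in> P)" if "\<beta> \<noteq> 0" for \<beta>
    proof -
      \<comment> \<open>A real number and its inverse have the same sign, which turns the positivity
        of \<beta> times \<open>y\<close> into the condition defining \<open>P\<close>.\<close>
      have "0 < \<tau> i \<beta> * y $ i \<longleftrightarrow> 0 < inverse (\<tau> i \<beta>) * y $ i" for i
        by (simp add: zero_less_mult_iff)
      then have "(\<forall>i. 0 < emb \<tau> \<beta> $ i * y $ i) \<longleftrightarrow> \<beta> \<in> P"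
        using that by (simp add: P_def pos_vecs_def emb_def tau_inverse)
      then show ?thesis using chi_axis[OF emb_unit_vecs[OF that] unit] by simp
    qed
    show "\<And>\<beta>. \<beta> \<in> P - (UNIV - {0}) \<Longrightarrow> of_real (sgn (Nm y)) * (\<phi> \<beta> * qpow \<tau> \<beta> y) = 0"
      by (auto simp: P_def)
    show "\<And>\<beta>. \<beta> \<in> (UNIV - {0}) - P \<Longrightarrow> \<phi> \<beta> * of_real (chi (\<lambda>i. axis i 1) (emb \<tau> \<beta>) y) * qpow \<tau> \<beta> y = 0"
      by (simp add: chi)
    show "\<And>\<beta>. \<beta> \<in> (UNIV - {0}) \<inter> P \<Longrightarrow> \<phi> \<beta> * of_real (chi (\<lambda>i. axis i 1) (emb \<tau> \<beta>) y) * qpow \<tau> \<beta> y =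
        of_real (sgn (Nm y)) * (\<phi> \<beta> * qpow \<tau> \<beta> y)"
      by (simp add: chi)
  qed
  finally have sum_P: "((\<lambda>\<beta>. of_real (sgn (Nm y)) * (\<phi> \<beta> * qpow \<tau> \<beta> y)) has_sum S) P" .
  \<comment> \<open>The sign of \<open>Nm y\<close> is its own inverse; multiplying by it frees the
    series over \<open>P\<close> from the sign.\<close>
  have "Nm y \<noteq> 0" using unit by (simp add: Nm_def unit_vecs_def)
  then have sgn: "of_real (sgn (Nm y)) * of_real (sgn (Nm y)) = (1::complex)" by (simp add: sgn_if)
  have "((\<lambda>\<beta>. of_real (sgn (Nm y)) * (of_real (sgn (Nm y)) * (\<phi> \<beta> * qpow \<tau> \<beta> y))) has_sum of_real (sgn (Nm y)) * S) P"
    using sum_P by (rule has_sum_cmult_right)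
  then have has: "((\<lambda>\<beta>. \<phi> \<beta> * qpow \<tau> \<beta> y) has_sum of_real (sgn (Nm y)) * S) P"
    unfolding mult.assoc[symmetric] sgn by (simp add: mult.assoc)
  then show "(\<lambda>\<beta>. \<phi> \<beta> * qpow \<tau> \<beta> y) summable_on P" by (rule has_sum_imp_summable)
  have "of_real (sgn (Nm y)) * (\<Sum>\<^sub>\<infinity>\<beta>\<in>P. \<phi> \<beta> * qpow \<tau> \<beta> y) = S"
    unfolding infsumI[OF has] unfolding mult.assoc[symmetric] sgn by simp
  then show "((\<lambda>v. \<psi> v * of_real (Nm (emb \<tau> v)) * (F (emb \<tau> v * y) - \<phi> 0 * of_real (chi_comb \<tau> \<B> 1 0 (emb \<tau> v * y))))
      has_sum (of_real (sgn (Nm y)) * (\<Sum>\<^sub>\<infinity>\<beta>\<in>P. \<phi> \<beta> * qpow \<tau> \<beta> y))) V"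
    using sum_V by simp
qed

end

theorem mainTheorem1:
  fixes \<tau> :: "'n::{finite,linorder} \<Rightarrow> 'f::field_char_0 \<Rightarrow> real"
    and \<psi> :: "(real, 'n) vec \<Rightarrow> complex"
    and \<phi> :: "'f \<Rightarrow> complex"
    and \<aa> \<bb> V :: "'f set"
    and \<Lambda> :: "complex set"
    and \<B> :: "('n \<Rightarrow> 'f) \<Rightarrow>\<^sub>0 int"
  assumes "number_field TYPE('f)"
    and "totally_real TYPE('f)"
    and "field_degree TYPE('f) = CARD('n)"
    and "bij_betw \<tau> UNIV {\<sigma> :: 'f \<Rightarrow> real. field_embedding \<sigma>}"
    and "sign_character \<psi>"
    and "fractional_ideal \<aa>" and "fractional_ideal \<bb>"
    and "\<forall>\<alpha>. \<forall>a\<in>\<aa>. \<phi> (\<alpha> + a) = \<phi> \<alpha>"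
    and "\<forall>\<alpha>. \<alpha> \<notin> \<bb> \<longrightarrow> \<phi> \<alpha> = 0"
    and "\<forall>\<alpha>. \<forall>v\<in>carrier unit_group. \<phi> (v * \<alpha>) = \<psi> (emb \<tau> v) * \<phi> \<alpha>"
    and "\<Lambda> = int_mod.span (range \<phi>)"
    and "subgroup V unit_group"
    and "finite (rcosets\<^bsub>unit_group\<^esub> V)"
    and "free_abelian (unit_group\<lparr>carrier := V\<rparr>)"
    and "\<forall>v\<in>V. emb \<tau> v $ nth_index > 0"
    and "\<forall>B\<in>Poly_Mapping.keys \<B>. rat_basis B"
    and "AE y in lebesgue. y \<in> unit_vecs \<longrightarrow>
           (\<forall>x\<in>unit_vecs.
              ((\<lambda>v. chi_comb \<tau> \<B> (emb \<tau> v) x y) has_sum chi (\<lambda>i. axis i 1) x y) V)"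
  shows "\<exists>F \<in> q_combinations \<Lambda> \<tau> (regular_points \<tau> \<B>).
           (\<forall>y\<in>regular_points \<tau> \<B>.
              ((\<lambda>\<alpha>. \<phi> \<alpha> * of_real (chi_comb \<tau> \<B> 1 (emb \<tau> \<alpha>) y) * qpow \<tau> \<alpha> y)
                 has_sum F y) UNIV) \<and>
           (let F' = (\<lambda>y. F y - \<phi> 0 * of_real (chi_comb \<tau> \<B> 1 0 y));
                P = (\<lambda>y. {\<beta>. \<beta> \<noteq> 0 \<and> emb \<tau> (inverse \<beta>) * y \<in> pos_vecs})
            in AE y in lebesgue. y \<in> unit_vecs \<longrightarrow>
                 (\<lambda>\<beta>. \<phi> \<beta> * qpow \<tau> \<beta> y) summable_on P y \<and>
                 ((\<lambda>v. \<psi> (emb \<tau> v) * of_real (Nm (emb \<tau> v)) * F' (emb \<tau> v * y))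
                    has_sum (of_real (sgn (Nm y)) * (\<Sum>\<^sub>\<infinity>\<beta>\<in>P y. \<phi> \<beta> * qpow \<tau> \<beta> y))) V)"
proof -
  note degree = assms(3) and embeddings = assms(4) and character = assms(5) and equivariant = assms(10)
    and span = assms(11) and V = unit_group_subgroupD[OF assms(12)] and pos = assms(15) and cones = assms(17)
  have keys: "rat_basis B" if "B \<in> Poly_Mapping.keys \<B>" for B using assms(16) that by blast
  interpret lattice_function \<tau> \<phi> \<aa> \<bb>
    using assms(1,6-9) degree embeddings by unfold_locales auto
  obtain F where F: "F \<in> q_combinations \<Lambda> \<tau> (regular_points \<tau> \<B>)"
    and sums: "\<And>y. y \<in> regular_points \<tau> \<B> \<Longrightarrow>
      ((\<lambda>\<alpha>. \<phi> \<alpha> * of_real (chi_comb \<tau> \<B> 1 (emb \<tau> \<alpha>) y) * qpow \<tau> \<alpha> y) has_sum F y) UNIV"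
    using generating_function[OF keys] unfolding span by blast
  have unit: "emb \<tau> v \<in> unit_vecs" if "v \<in> V" for v
    using that V(1) unit_group_carrierD(2) by (intro emb_unit_vecs) blast
  have norm_\<psi>: "norm (\<psi> (emb \<tau> v)) = 1" if "v \<in> V" for v
    using character unit[OF that] by (auto simp: sign_character_def)
  have \<phi>_\<psi>: "\<phi> (v * \<alpha>) = \<psi> (emb \<tau> v) * \<phi> \<alpha>" if "v \<in> V" for v \<alpha>
    using equivariant V(1) that by blast
  have pos': "\<tau> nth_index v > 0" if "v \<in> V" for v
    using pos that by (simp add: emb_def)
  \<comment> \<open>Only finitely many linear forms \<open>B i\<close> occur, so their exceptional
    null sets can be united with that of the hypothesis on the cones.\<close>
  have "AE y in lebesgue. \<forall>p\<in>Poly_Mapping.keys \<B> \<times> UNIV. \<exists>c>0. \<forall>v\<in>V.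
      \<bar>Tr (emb \<tau> (fst p (snd p)) * (emb \<tau> v * y))\<bar> \<ge> c * exp (log_size v / (4 * CARD('n)))"
  proof (rule AE_finite_allI)
    fix p assume "p \<in> Poly_Mapping.keys \<B> \<times> (UNIV :: 'n set)"
    then have B: "rat_basis (fst p)" using keys by auto
    have "fst p (snd p) \<noteq> 0"
      using coord_basis[OF B, of "snd p" "snd p"] coord_zero[OF B, of "snd p"] by auto
    then show "AE y in lebesgue. \<exists>c>0. \<forall>v\<in>V.
        \<bar>Tr (emb \<tau> (fst p (snd p)) * (emb \<tau> v * y))\<bar> \<ge> c * exp (log_size v / (4 * CARD('n)))"
      by (intro AE_Tr_unit_translates[OF support_ideal] V)
  qed simp
  with cones have "AE y in lebesgue. y \<in> unit_vecs \<longrightarrow>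
      (\<lambda>\<beta>. \<phi> \<beta> * qpow \<tau> \<beta> y) summable_on {\<beta>. \<beta> \<noteq> 0 \<and> emb \<tau> (inverse \<beta>) * y \<in> pos_vecs} \<and>
      ((\<lambda>v. \<psi> (emb \<tau> v) * of_real (Nm (emb \<tau> v)) *
          (F (emb \<tau> v * y) - \<phi> 0 * of_real (chi_comb \<tau> \<B> 1 0 (emb \<tau> v * y)))) has_sum
        (of_real (sgn (Nm y)) * (\<Sum>\<^sub>\<infinity>\<beta>\<in>{\<beta>. \<beta> \<noteq> 0 \<and> emb \<tau> (inverse \<beta>) * y \<in> pos_vecs}. \<phi> \<beta> * qpow \<tau> \<beta> y))) V"
  proof eventually_elim
    case (elim y)
    show ?case
    proof
      assume y: "y \<in> unit_vecs"
      have bound: "\<exists>c>0. \<forall>v\<in>V. \<bar>Tr (emb \<tau> (B i) * (emb \<tau> v * y))\<bar> \<ge> c * exp (log_size v / (4 * CARD('n)))"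
        if "B \<in> Poly_Mapping.keys \<B>" for B i
        using elim(2) that by fastforce
      have cones_y: "((\<lambda>v. chi_comb \<tau> \<B> (emb \<tau> v) x y) has_sum chi (\<lambda>i. axis i 1) x y) V"
        if "x \<in> unit_vecs" for x
        using elim(1) y that by blast
      note result = unit_translates_sum[where \<psi> = "\<lambda>v. \<psi> (emb \<tau> v)" and \<B> = \<B> and V = V and F = F and y = y]
      show "(\<lambda>\<beta>. \<phi> \<beta> * qpow \<tau> \<beta> y) summable_on {\<beta>. \<beta> \<noteq> 0 \<and> emb \<tau> (inverse \<beta>) * y \<in> pos_vecs} \<and>
        ((\<lambda>v. \<psi> (emb \<tau> v) * of_real (Nm (emb \<tau> v)) *
            (F (emb \<tau> v * y) - \<phi> 0 * of_real (chi_comb \<tau> \<B> 1 0 (emb \<tau> v * y)))) has_sum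
          (of_real (sgn (Nm y)) * (\<Sum>\<^sub>\<infinity>\<beta>\<in>{\<beta>. \<beta> \<noteq> 0 \<and> emb \<tau> (inverse \<beta>) * y \<in> pos_vecs}. \<phi> \<beta> * qpow \<tau> \<beta> y))) V"
        by (rule conjI; rule result;
          (assumption | rule keys V pos' norm_\<psi> \<phi>_\<psi> sums y cones_y bound)+)
    qed
  qed
  then show ?thesis
    unfolding Let_def using F sums by (intro bexI[of _ F] conjI ballI) auto
qed

end
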